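(* Let $d,m\ge2$ be integers and consider the discrete torus graph on $\mathbb{Z}_m^d$. Let $(\varepsilon_{ij})_{i,j\in\mathbb{Z}_m^d}$ be independent symmetric $\pm1$ random variables. Then $$\mathbb{E}\big\|(\mathbf{1}_{i\sim j}\varepsilon_{ij})_{i,j\in\mathbb{Z}_m^d}\big\|\ \sim\ \sqrt d+N_{\varepsilon,\,d\log m}(\mathbb{Z}_2^d).$$ In particular, for $2\le m\le e^d$, $$\sqrt{\frac{d\log(d\log m)}{\log\big(ed/\log(d\log m)\big)}}\ \lesssim\ \mathbb{E}\big\|(\mathbf{1}_{i\sim j}\varepsilon_{ij})_{i,j\in\mathbb{Z}_m^d}\big\|\ \lesssim\ \sqrt{d\log(d\log m)}.$$ All implicit constants are universal (independent of $d$ and $m$).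
   Context: The discrete torus $\mathbb{Z}_m^d$ is the graph on $(\mathbb{Z}/m\mathbb{Z})^d$ in which $i\sim j$ ($i$ and $j$ are adjacent) iff $i$ and $j$ differ in exactly one coordinate and there differ by $\pm1$ modulo $m$; for $m=2$ it is the Hamming hypercube $\mathbb{Z}_2^d$. For a finite graph $G$ with vertex set $V$ and $p\ge1$ put $$N_{\varepsilon,p}(G):=\sup_{\|s\|_2,\|t\|_2\le1}\Big\|\sum_{i,j\in V}\mathbf{1}_{i\sim j}\,\varepsilon_{ij}s_it_j\Big\|_p,$$ where $(\varepsilon_{ij})_{i,j\in V}$ are independent symmetric $\pm1$ random variables indexed by ordered pairs, the supremum is over $s,t\in\mathbb{R}^V$, $\|S\|_p=(\mathbb{E}|S|^p)^{1/p}$ for a random variable $S$, and $\|\cdot\|_2$ on vectors is the Euclidean norm. For a matrix, $\|\cdot\|$ is the operator norm on $\ell_2$. For nonnegative quantities, $f\lesssim g$ means $f\le Cg$ for an absolute constant $C$, and $f\sim g$ means $f\lesssim g$ and $g\lesssim f$. $\log$ is the natural logarithm. *)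

theory Defs
  imports "HOL-Probability.Probability" "HOL-Number_Theory.Cong"
begin

text \<open>
  Vectors in \<open>\<real>\<^sup>V\<close> and \<open>V \<times> V\<close> matrices are plain functions of which only the values on the
  finite set \<open>V\<close> matter, because the index set varies with \<open>d\<close> and \<open>m\<close>. The Euclidean norm
  on \<open>\<real>\<^sup>V\<close> is \<^const>\<open>L2_set\<close>.
\<close>

definition l2_opnorm :: "'v set \<Rightarrow> ('v \<Rightarrow> 'v \<Rightarrow> real) \<Rightarrow> real" where
  "l2_opnorm V A = (SUP t\<in>{t. L2_set t V \<le> 1}. L2_set (\<lambda>i. \<Sum>j\<in>V. A i j * t j) V)"

definition Lp_norm :: "'a measure \<Rightarrow> real \<Rightarrow> ('a \<Rightarrow> real) \<Rightarrow> real" where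
  "Lp_norm M p S = (LINT \<omega>|M. \<bar>S \<omega>\<bar> powr p) powr (1 / p)"

text \<open>
  Independent symmetric signs indexed by \<open>I\<close>, realised on their canonical probability space: a
  sample point is itself the sign pattern \<open>\<epsilon> :: 'i \<Rightarrow> real\<close> (with the dummy value \<open>0\<close> outside
  \<open>I\<close>). The expectations below depend on the joint law only; lemma
  \<open>rademacher_family_expectation\<close> gives the transfer to an arbitrary probability space.
\<close>

definition rademacher :: "'i set \<Rightarrow> ('i \<Rightarrow> real) pmf" where
  "rademacher I = Pi_pmf I 0 (\<lambda>_. pmf_of_set {-1, 1})"

definition signed_adj :: "('v \<Rightarrow> 'v \<Rightarrow> bool) \<Rightarrow> ('v \<times> 'v \<Rightarrow> real) \<Rightarrow> 'v \<Rightarrow> 'v \<Rightarrow> real" where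
  "signed_adj E \<epsilon> i j = of_bool (E i j) * \<epsilon> (i, j)"

definition expected_signed_norm :: "'v set \<Rightarrow> ('v \<Rightarrow> 'v \<Rightarrow> bool) \<Rightarrow> real" where
  "expected_signed_norm V E =
     measure_pmf.expectation (rademacher (V \<times> V)) (\<lambda>\<epsilon>. l2_opnorm V (signed_adj E \<epsilon>))"

definition N_eps :: "real \<Rightarrow> 'v set \<Rightarrow> ('v \<Rightarrow> 'v \<Rightarrow> bool) \<Rightarrow> real" where
  "N_eps p V E =
     (SUP (s, t)\<in>{(s, t). L2_set s V \<le> 1 \<and> L2_set t V \<le> 1}.
        Lp_norm (measure_pmf (rademacher (V \<times> V))) p
          (\<lambda>\<epsilon>. \<Sum>(i, j)\<in>V \<times> V. of_bool (E i j) * \<epsilon> (i, j) * s i * t j))"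

text \<open>
  Residues modulo \<open>m\<close> are represented by \<open>{..<m}\<close>, and \<open>(\<int>/m\<int>)\<^sup>d\<close> by the
  functions in \<^term>\<open>{..<d} \<rightarrow>\<^sub>E {..<m}\<close>.
\<close>

definition torus_verts :: "nat \<Rightarrow> nat \<Rightarrow> (nat \<Rightarrow> nat) set" where
  "torus_verts m d = ({..<d} \<rightarrow>\<^sub>E {..<m})"

definition torus_adj :: "nat \<Rightarrow> nat \<Rightarrow> (nat \<Rightarrow> nat) \<Rightarrow> (nat \<Rightarrow> nat) \<Rightarrow> bool" where
  "torus_adj m d x y \<longleftrightarrow>
     (\<exists>k. {l. l < d \<and> x l \<noteq> y l} = {k} \<and> ([x k = y k + 1] (mod m) \<or> [y k = x k + 1] (mod m)))"


subsection \<open>Independence of the choice of probability space\<close>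

definition rademacher_family :: "'a measure \<Rightarrow> 'i set \<Rightarrow> ('i \<Rightarrow> 'a \<Rightarrow> real) \<Rightarrow> bool" where
  "rademacher_family M I X \<longleftrightarrow>
     prob_space M \<and> prob_space.indep_vars M (\<lambda>_. borel) X I \<and>
     (\<forall>i\<in>I. (\<forall>\<omega>\<in>space M. X i \<omega> \<in> {-1, 1}) \<and>
            measure M {\<omega>\<in>space M. X i \<omega> = 1} = 1 / 2 \<and>
            measure M {\<omega>\<in>space M. X i \<omega> = -1} = 1 / 2)"

lemma set_pmf_rademacher:
  "finite I \<Longrightarrow> set_pmf (rademacher I) = PiE_dflt I 0 (\<lambda>_. {-1, 1})"
  unfolding rademacher_def by (subst set_Pi_pmf) (auto simp: o_def)

lemma finite_set_pmf_rademacher: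
  "finite I \<Longrightarrow> finite (set_pmf (rademacher I))"
  by (simp add: set_pmf_rademacher finite_PiE_dflt)

lemma rademacher_family_expectation:
  fixes X :: "'i \<Rightarrow> 'a \<Rightarrow> real" and F :: "('i \<Rightarrow> real) \<Rightarrow> real"
  assumes fam: "rademacher_family M I X" and fin: "finite I"
    and F: "\<And>a b. (\<And>i. i \<in> I \<Longrightarrow> a i = b i) \<Longrightarrow> F a = F b"
  shows "(LINT \<omega>|M. F (\<lambda>i. X i \<omega>)) = measure_pmf.expectation (rademacher I) F"
proof -
  interpret prob_space M using fam by (simp add: rademacher_family_def)
  define S where "S = PiE_dflt I (0::real) (\<lambda>_. {-1, 1})"
  have finS: "finite S" unfolding S_def using fin by (intro finite_PiE_dflt) auto
  have indep: "indep_vars (\<lambda>_. borel) X I" using fam by (simp add: rademacher_family_def)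
  have val: "X i \<omega> \<in> {-1, 1}" if "i \<in> I" "\<omega> \<in> space M" for i \<omega>
    using fam that by (auto simp: rademacher_family_def)
  define B where "B a = {\<omega> \<in> space M. \<forall>i\<in>I. X i \<omega> = a i}" for a
  have rv: "random_variable borel (X i)" if "i \<in> I" for i
    using indep that by (auto simp: indep_vars_def)
  have B_sets: "B a \<in> sets M" for a
  proof -
    have "{\<omega> \<in> space M. X i \<omega> = a i} \<in> sets M" if "i \<in> I" for i
      using rv[OF that] by measurable
    then show ?thesis unfolding B_def using fin by (intro sets.sets_Collect_finite_All) auto
  qed
  have probB: "prob (B a) = pmf (rademacher I) a" if a: "a \<in> S" for a
  proof -
    have a1: "a i \<in> {-1, 1}" if "i \<in> I" for i
      using a that by (force simp: S_def PiE_dflt_def)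
    have a0: "a i = 0" if "i \<notin> I" for i
      using a that by (auto simp: S_def PiE_dflt_def)
    have "prob (B a) = (\<Prod>i\<in>I. prob {\<omega> \<in> space M. X i \<omega> = a i})"
    proof (cases "I = {}")
      case True
      then show ?thesis by (simp add: B_def prob_space)
    next
      case False
      have "B a = (\<Inter>i\<in>I. X i -` {a i} \<inter> space M)"
        using False by (auto simp: B_def)
      moreover have "prob (\<Inter>i\<in>I. X i -` {a i} \<inter> space M)
          = (\<Prod>i\<in>I. prob (X i -` {a i} \<inter> space M))"
        by (rule indep_varsD_finite[OF indep False fin]) auto
      moreover have "X i -` {a i} \<inter> space M = {\<omega> \<in> space M. X i \<omega> = a i}" for i
        by auto
      ultimately show ?thesis by simp
    qed
    also have "\<dots> = (\<Prod>i\<in>I. 1 / 2)"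
    proof (rule prod.cong[OF refl])
      fix i assume i: "i \<in> I"
      then consider "a i = -1" | "a i = 1" using a1 by blast
      then show "prob {\<omega> \<in> space M. X i \<omega> = a i} = 1 / 2"
        using fam i by cases (simp_all add: rademacher_family_def)
    qed
    also have "\<dots> = (\<Prod>i\<in>I. pmf (pmf_of_set {-1, 1::real}) (a i))"
      by (rule prod.cong[OF refl]) (use a1 in \<open>auto simp: indicator_def\<close>)
    also have "\<dots> = pmf (rademacher I) a"
      unfolding rademacher_def using fin a0 by (subst pmf_Pi') auto
    finally show ?thesis .
  qed
  have eq: "F (\<lambda>i. X i \<omega>) = (\<Sum>a\<in>S. indicator (B a) \<omega> * F a)" if w: "\<omega> \<in> space M" for \<omega>
  proof -
    define c where "c i = (if i \<in> I then X i \<omega> else 0)" for i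
    have cS: "c \<in> S" using val[OF _ w] by (auto simp: S_def PiE_dflt_def c_def)
    have "indicator (B a) \<omega> = (if a = c then 1 else (0::real))" if "a \<in> S" for a
      using that w
      by (auto simp: B_def c_def S_def PiE_dflt_def indicator_def fun_eq_iff)
    then have "(\<Sum>a\<in>S. indicator (B a) \<omega> * F a) = (\<Sum>a\<in>S. if a = c then F a else 0)"
      by (intro sum.cong) auto
    also have "\<dots> = F c" using cS finS by simp
    also have "\<dots> = F (\<lambda>i. X i \<omega>)" by (rule F) (simp add: c_def)
    finally show ?thesis by simp
  qed
  have "(LINT \<omega>|M. F (\<lambda>i. X i \<omega>)) = (LINT \<omega>|M. (\<Sum>a\<in>S. indicator (B a) \<omega> * F a))"
    by (rule Bochner_Integration.integral_cong) (auto simp: eq)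
  also have "\<dots> = (\<Sum>a\<in>S. (LINT \<omega>|M. indicator (B a) \<omega> * F a))"
    by (rule Bochner_Integration.integral_sum)
       (intro integrable_mult_left integrable_real_indicator B_sets, simp add: emeasure_eq_measure)
  also have "\<dots> = (\<Sum>a\<in>S. prob (B a) * F a)"
    using B_sets by (intro sum.cong) auto
  also have "\<dots> = (\<Sum>a\<in>S. pmf (rademacher I) a *\<^sub>R F a)"
    by (simp add: probB)
  also have "\<dots> = measure_pmf.expectation (rademacher I) F"
    by (rule integral_measure_pmf[symmetric, OF finS])
       (use fin in \<open>simp add: set_pmf_rademacher S_def\<close>)
  finally show ?thesis .
qed

lemma expected_signed_norm_eq:
  assumes "rademacher_family M (V \<times> V) X" "finite V"
  shows "expected_signed_norm V E =
           (LINT \<omega>|M. l2_opnorm V (\<lambda>i j. of_bool (E i j) * X (i, j) \<omega>))"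
proof -
  have "(LINT \<omega>|M. l2_opnorm V (signed_adj E (\<lambda>i. X i \<omega>))) = expected_signed_norm V E"
    unfolding expected_signed_norm_def
    by (rule rademacher_family_expectation[OF assms(1)])
       (use assms(2) in \<open>auto simp: l2_opnorm_def signed_adj_def
          intro!: SUP_cong L2_set_cong sum.cong\<close>)
  then show ?thesis by (simp add: signed_adj_def[abs_def])
qed

lemma N_eps_eq:
  assumes "rademacher_family M (V \<times> V) X" "finite V"
  shows "N_eps p V E =
           (SUP (s, t)\<in>{(s, t). L2_set s V \<le> 1 \<and> L2_set t V \<le> 1}.
              Lp_norm M p (\<lambda>\<omega>. \<Sum>(i, j)\<in>V \<times> V. of_bool (E i j) * X (i, j) \<omega> * s i * t j))"
proof -
  have "(LINT \<omega>|M. \<bar>\<Sum>(i, j)\<in>V \<times> V. of_bool (E i j) * X (i, j) \<omega> * s i * t j\<bar> powr p)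
      = measure_pmf.expectation (rademacher (V \<times> V))
          (\<lambda>\<epsilon>. \<bar>\<Sum>(i, j)\<in>V \<times> V. of_bool (E i j) * \<epsilon> (i, j) * s i * t j\<bar> powr p)" for s t
    by (rule rademacher_family_expectation[OF assms(1),
          where F = "\<lambda>\<epsilon>. \<bar>\<Sum>(i, j)\<in>V \<times> V. of_bool (E i j) * \<epsilon> (i, j) * s i * t j\<bar> powr p"])
       (use assms(2) in \<open>auto intro!: arg_cong2[where f="(powr)"] arg_cong[where f=abs] sum.cong\<close>)
  then show ?thesis unfolding N_eps_def Lp_norm_def by simp
qed


subsection \<open>The suprema are over bounded nonempty sets\<close>

lemma abs_le_L2_set:
  assumes "finite V" "i \<in> V"
  shows "\<bar>t i\<bar> \<le> L2_set t V"
  using member_le_L2_set[of V i "\<lambda>i. \<bar>t i\<bar>"] assms by (simp add: L2_set_def)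

lemma bdd_above_l2_opnorm:
  assumes "finite V"
  shows "bdd_above ((\<lambda>t. L2_set (\<lambda>i. \<Sum>j\<in>V. A i j * t j) V) ` {t. L2_set t V \<le> 1})"
proof (rule bdd_aboveI2)
  fix t :: "'a \<Rightarrow> real" assume t: "t \<in> {t. L2_set t V \<le> 1}"
  have "L2_set (\<lambda>i. \<Sum>j\<in>V. A i j * t j) V \<le> (\<Sum>i\<in>V. \<bar>\<Sum>j\<in>V. A i j * t j\<bar>)"
    by (rule L2_set_le_sum_abs)
  also have "\<dots> \<le> (\<Sum>i\<in>V. \<Sum>j\<in>V. \<bar>A i j\<bar>)"
  proof (rule sum_mono, rule order.trans[OF sum_abs], rule sum_mono)
    fix i j assume "j \<in> V"
    then have "\<bar>t j\<bar> \<le> 1" using abs_le_L2_set[OF assms, of j t] t by simp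
    then show "\<bar>A i j * t j\<bar> \<le> \<bar>A i j\<bar>" by (simp add: abs_mult mult_left_le)
  qed
  finally show "L2_set (\<lambda>i. \<Sum>j\<in>V. A i j * t j) V \<le> (\<Sum>i\<in>V. \<Sum>j\<in>V. \<bar>A i j\<bar>)" .
qed

lemma bdd_above_N_eps:
  assumes "finite V" "p > 0"
  shows "bdd_above ((\<lambda>(s, t). Lp_norm (measure_pmf (rademacher (V \<times> V))) p
            (\<lambda>\<epsilon>. \<Sum>(i, j)\<in>V \<times> V. of_bool (E i j) * \<epsilon> (i, j) * s i * t j)) `
          {(s, t). L2_set s V \<le> 1 \<and> L2_set t V \<le> 1})"
proof (rule bdd_aboveI2, clarify)
  fix s t :: "'a \<Rightarrow> real" assume st: "L2_set s V \<le> 1" "L2_set t V \<le> 1"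
  let ?K = "real (card (V \<times> V))" and ?R = "rademacher (V \<times> V)"
  let ?S = "\<lambda>\<epsilon>. \<Sum>(i, j)\<in>V \<times> V. of_bool (E i j) * \<epsilon> (i, j) * s i * t j"
  have bound: "\<bar>?S \<epsilon>\<bar> powr p \<le> ?K powr p" if e: "\<epsilon> \<in> set_pmf ?R" for \<epsilon>
  proof -
    have "\<bar>?S \<epsilon>\<bar> \<le> (\<Sum>(i, j)\<in>V \<times> V. 1)"
      unfolding case_prod_unfold
    proof (rule order.trans[OF sum_abs], rule sum_mono)
      fix x assume x: "x \<in> V \<times> V"
      have 1: "\<bar>s (fst x)\<bar> \<le> 1" "\<bar>t (snd x)\<bar> \<le> 1"
        using x st abs_le_L2_set[OF assms(1), of "fst x" s] abs_le_L2_set[OF assms(1), of "snd x" t]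
        by (auto simp: mem_Times_iff)
      have "\<epsilon> x \<in> {-1, 1}"
        using e x assms(1) by (force simp: set_pmf_rademacher PiE_dflt_def)
      then have 2: "\<bar>\<epsilon> (fst x, snd x)\<bar> = 1" by auto
      show "\<bar>of_bool (E (fst x) (snd x)) * \<epsilon> (fst x, snd x) * s (fst x) * t (snd x)\<bar> \<le> 1"
        using 1 2 by (auto simp: abs_mult mult_le_one)
    qed
    also have "\<dots> = ?K" by simp
    finally show ?thesis using assms(2) by (intro powr_mono2) auto
  qed
  have "measure_pmf.expectation ?R (\<lambda>\<epsilon>. \<bar>?S \<epsilon>\<bar> powr p)
      \<le> measure_pmf.expectation ?R (\<lambda>_. ?K powr p)"
    by (rule integral_mono_AE)
       (use assms bound in \<open>auto intro!: integrable_measure_pmf_finite finite_set_pmf_rademacher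
          simp: AE_measure_pmf_iff\<close>)
  then show "Lp_norm (measure_pmf ?R) p ?S \<le> (?K powr p) powr (1 / p)"
    unfolding Lp_norm_def using assms(2) by (intro powr_mono2) auto
qed

end

(*
  Write p = d ln m and let A be the signed adjacency matrix. Both sides of the equivalence are
  compared with sqrt (d * r), where r is the largest integer for which two adjacent layers r - 1, r of
  a cube of dimension n = d div 2 span at most about p edges.

  Lower bounds. The biadjacency matrix of two adjacent layers has norm sqrt (r * (n - r + 1)). The
  torus contains m^(d - n) disjoint copies of this configuration, so with probability at least 1/2
  all signs are positive on one of them; on a single copy this happens with probability at least
  e^(-p), which is all that the p-th moment needs.

  Upper bounds. If B_k is the alternating product of k factors A and A^T, then ||A||^(2k) is at
  most the squared Frobenius norm of B_k. Passing from B_k to B_{k+1} acts on Walsh coefficients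
  g(S, v) by moving v to a neighbour u and toggling the traversed entry in S, and Schur's test
  bounds the norm of this operator: a step to a vertex not met by S gets the weight 1 / sqrt Delta
  (it is undone in a unique way), any other step v -> u the weight f(u) / f(v), where f is a positive
  supersolution of the adjacency operator on the at most 2k vertices met by S and v. This gives
  E ||A||^(2k) <= |V| (C (sqrt Delta + L))^(2k), where L bounds the top eigenvalues of the
  subgraphs with at most 2k vertices. A two-point inequality between energy and entropy,
  tensorised through subadditivity of entropy, yields L <= C sqrt (d * r) for k of order p.
*)
theory Submission
  imports Defs
begin

subsection \<open>Walsh functions of independent signs\<close>

text \<open>Bounding the norm by a Frobenius norm loses the number of vertices, m^d = e^p, which
  only a power of order p makes harmless. The obstacle at such powers is that walks reuse entries so
  often that the degree no longer controls them: a small subgraph whose signs all agree already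
  forces the norm up to its top eigenvalue. Counting walks by shape would cost combinatorial factors
  that grow with the power; the operator on Walsh coefficients charges every single step a fixed
  factor instead, whatever the past of the walk. The side m matters only through p. A residue has at
  most two cyclic neighbours, which is all that the energy estimate asks of a coordinate, and
  conversely 0 and 1 are adjacent for every m, so every torus contains the same cube layers. Hence a
  torus can be matched with a moment on the hypercube. The cube occupies only half of the
  coordinates because the others have to label copies with disjoint sets of signs. There are m^(d -
  n) \<ge> e^(p/2) labels, enough to compensate the small probability of planting one copy.\<close>

lemma expectation_rademacher_prod:
  fixes g :: "'i \<Rightarrow> real \<Rightarrow> real"
  assumes "finite I"
  shows "measure_pmf.expectation (rademacher I) (\<lambda>\<epsilon>. \<Prod>i\<in>I. g i (\<epsilon> i)) = (\<Prod>i\<in>I. (g i 1 + g i (-1)) / 2)"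
proof (cases "I = {}")
  case True
  then show ?thesis by simp
next
  case False
  have "prob_space.indep_vars (measure_pmf (rademacher I)) (\<lambda>_. borel) (\<lambda>i \<epsilon>. g i (\<epsilon> i)) I"
    unfolding rademacher_def
    using prob_space.indep_vars_compose2[OF measure_pmf.prob_space_axioms indep_vars_Pi_pmf[OF assms], where Y = g and N = "\<lambda>_. borel"]
    by simp
  then have "measure_pmf.expectation (rademacher I) (\<lambda>\<epsilon>. \<Prod>i\<in>I. g i (\<epsilon> i))
      = (\<Prod>i\<in>I. measure_pmf.expectation (rademacher I) (\<lambda>\<epsilon>. g i (\<epsilon> i)))"
    using assms False
    by (intro prob_space.indep_vars_lebesgue_integral measure_pmf.prob_space_axioms)
       (auto intro!: integrable_measure_pmf_finite finite_set_pmf_rademacher)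
  also have "\<dots> = (\<Prod>i\<in>I. measure_pmf.expectation (pmf_of_set {-1, 1::real}) (g i))"
  proof (rule prod.cong[OF refl])
    fix i assume "i \<in> I"
    then have "pmf_of_set {-1, 1::real} = map_pmf (\<lambda>\<epsilon>. \<epsilon> i) (rademacher I)"
      unfolding rademacher_def using assms by (subst Pi_pmf_component) auto
    then show "measure_pmf.expectation (rademacher I) (\<lambda>\<epsilon>. g i (\<epsilon> i))
        = measure_pmf.expectation (pmf_of_set {-1, 1::real}) (g i)" by simp
  qed
  also have "\<dots> = (\<Prod>i\<in>I. (g i 1 + g i (-1)) / 2)"
    by (rule prod.cong[OF refl]) (subst integral_pmf_of_set, auto)
  finally show ?thesis .
qed

lemma integrable_rademacher [simp]:
  fixes F :: "('i \<Rightarrow> real) \<Rightarrow> real"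
  shows "finite I \<Longrightarrow> integrable (measure_pmf (rademacher I)) F"
  by (intro integrable_measure_pmf_finite finite_set_pmf_rademacher)

lemma expectation_rademacher_mono:
  fixes F G :: "('i \<Rightarrow> real) \<Rightarrow> real"
  assumes "finite I" and "\<And>\<epsilon>. (\<And>i. i \<in> I \<Longrightarrow> \<epsilon> i \<in> {-1, 1}) \<Longrightarrow> F \<epsilon> \<le> G \<epsilon>"
  shows "measure_pmf.expectation (rademacher I) F \<le> measure_pmf.expectation (rademacher I) G"
proof (rule integral_mono_AE)
  show "AE \<epsilon> in measure_pmf (rademacher I). F \<epsilon> \<le> G \<epsilon>"
    unfolding AE_measure_pmf_iff using assms
    by (intro ballI assms(2)) (force simp: set_pmf_rademacher PiE_dflt_def)
qed (use assms(1) in auto)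

definition walsh :: "'i set \<Rightarrow> ('i \<Rightarrow> real) \<Rightarrow> real" where
  "walsh S \<epsilon> = (\<Prod>i\<in>S. \<epsilon> i)"

lemma expectation_walsh_mult:
  assumes "finite I" "S \<subseteq> I" "T \<subseteq> I"
  shows "measure_pmf.expectation (rademacher I) (\<lambda>\<epsilon>. walsh S \<epsilon> * walsh T \<epsilon>) = of_bool (S = T)"
proof -
  define g :: "'a \<Rightarrow> real \<Rightarrow> real" where
    "g i x = (if i \<in> S then x else 1) * (if i \<in> T then x else 1)" for i x
  have "walsh U \<epsilon> = (\<Prod>i\<in>I. if i \<in> U then \<epsilon> i else 1)" if "U \<subseteq> I" for U \<epsilon>
    unfolding walsh_def using prod.inter_restrict[OF assms(1), of \<epsilon> U] that by (simp add: Int_absorb1)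
  then have "walsh S \<epsilon> * walsh T \<epsilon> = (\<Prod>i\<in>I. g i (\<epsilon> i))" for \<epsilon>
    using assms(2,3) by (simp add: prod.distrib g_def)
  then have "measure_pmf.expectation (rademacher I) (\<lambda>\<epsilon>. walsh S \<epsilon> * walsh T \<epsilon>)
      = (\<Prod>i\<in>I. (g i 1 + g i (-1)) / 2)"
    using expectation_rademacher_prod[OF assms(1), of g] by simp
  also have "\<dots> = of_bool (S = T)"
  proof (cases "S = T")
    case True
    then show ?thesis by (auto simp: g_def intro!: prod.neutral)
  next
    case False
    \<comment> \<open>A coordinate in exactly one of the two sets contributes the mean of a single
      sign, which is 0.\<close>
    then obtain i where i: "i \<in> I" "(i \<in> S) \<noteq> (i \<in> T)" using assms(2,3) by blast
    then have "(g i 1 + g i (-1)) / 2 = 0" by (auto simp: g_def)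
    then show ?thesis using i False assms(1) by (auto intro: prod_zero)
  qed
  finally show ?thesis .
qed

lemma parseval_walsh:
  assumes "finite I"
  shows "measure_pmf.expectation (rademacher I) (\<lambda>\<epsilon>. (\<Sum>S\<in>Pow I. a S * walsh S \<epsilon>)\<^sup>2)
           = (\<Sum>S\<in>Pow I. (a S)\<^sup>2)"
proof -
  have "(\<Sum>S\<in>Pow I. a S * walsh S \<epsilon>)\<^sup>2
      = (\<Sum>S\<in>Pow I. \<Sum>T\<in>Pow I. a S * a T * (walsh S \<epsilon> * walsh T \<epsilon>))" for \<epsilon>
    by (simp add: power2_eq_square sum_product mult_ac)
  then have "measure_pmf.expectation (rademacher I) (\<lambda>\<epsilon>. (\<Sum>S\<in>Pow I. a S * walsh S \<epsilon>)\<^sup>2)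
      = (\<Sum>S\<in>Pow I. \<Sum>T\<in>Pow I. a S * a T *
          measure_pmf.expectation (rademacher I) (\<lambda>\<epsilon>. walsh S \<epsilon> * walsh T \<epsilon>))"
    using assms by (simp add: Bochner_Integration.integral_sum)
  also have "\<dots> = (\<Sum>S\<in>Pow I. \<Sum>T\<in>Pow I. if S = T then a S * a T else 0)"
    by (intro sum.cong refl) (use assms in \<open>auto simp: expectation_walsh_mult\<close>)
  also have "\<dots> = (\<Sum>S\<in>Pow I. (a S)\<^sup>2)"
    using assms by (simp add: power2_eq_square)
  finally show ?thesis .
qed

subsection \<open>Energy and entropy on product sets\<close>

text \<open>Shannon entropy of the distribution proportional to \<open>g\<close>, times the total
  mass. Left unnormalised, it can be added over the fibres of a product set, which carry different
  masses; vanishing values contribute 0 whatever \<open>ln 0\<close> is.\<close>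

definition mass_entropy :: "'a set \<Rightarrow> ('a \<Rightarrow> real) \<Rightarrow> real" where
  "mass_entropy A g = sum g A * ln (sum g A) - (\<Sum>a\<in>A. g a * ln (g a))"

lemma mass_entropy_eq:
  "mass_entropy A g = (\<Sum>a\<in>A. g a * (ln (sum g A) - ln (g a)))"
  by (simp add: mass_entropy_def right_diff_distrib sum_subtractf sum_distrib_right)

text \<open>Entropy is largest for the uniform distribution on the support: sum
  \<open>ln x \<le> x - 1\<close> at \<open>x = sum g A / (g a * M)\<close> over \<open>B\<close>.
  Through this bound the number of vertices of a subgraph enters its energy estimate.\<close>

lemma mass_entropy_le_ln:
  assumes fin: "finite A" and nn: "\<And>a. a \<in> A \<Longrightarrow> g a \<ge> 0"
    and B: "B \<subseteq> A" "\<And>a. a \<in> A - B \<Longrightarrow> g a = 0" and M: "real (card B) \<le> M" "M > 0"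
  shows "mass_entropy A g \<le> sum g A * ln M"
proof -
  let ?T = "sum g A"
  have T: "?T \<ge> 0" using nn by (intro sum_nonneg) auto
  have TB: "?T = sum g B"
    using fin B by (intro sum.mono_neutral_right) auto
  have *: "g a * (ln ?T - ln (g a)) - g a * ln M \<le> ?T / M - g a" if a: "a \<in> B" for a
  proof (cases "g a = 0")
    case True
    then show ?thesis using T M by simp
  next
    case False
    have g: "g a > 0" using False nn[of a] a B(1) by auto
    have "g a \<le> ?T" using a B(1) fin nn by (intro member_le_sum) auto
    then have Tp: "?T > 0" using g by simp
    have "ln (?T / (g a * M)) \<le> ?T / (g a * M) - 1"
      using g Tp M by (intro ln_le_minus_one) auto
    then have "g a * ln (?T / (g a * M)) \<le> g a * (?T / (g a * M) - 1)"
      using g by (intro mult_left_mono) auto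
    also have "\<dots> = ?T / M - g a" using g M by (simp add: field_simps)
    also have "ln (?T / (g a * M)) = ln ?T - ln (g a) - ln M"
      using g Tp M by (simp add: ln_div ln_mult)
    finally show ?thesis by (simp add: algebra_simps)
  qed
  have "mass_entropy A g - ?T * ln M = (\<Sum>a\<in>B. g a * (ln ?T - ln (g a)) - g a * ln M)"
  proof -
    have "mass_entropy A g = (\<Sum>a\<in>B. g a * (ln ?T - ln (g a)))"
      unfolding mass_entropy_eq using fin B by (intro sum.mono_neutral_right) auto
    then show ?thesis by (simp add: sum_subtractf sum_distrib_right TB)
  qed
  also have "\<dots> \<le> (\<Sum>a\<in>B. ?T / M - g a)" by (intro sum_mono *)
  also have "\<dots> = card B * ?T / M - ?T" by (simp add: sum_subtractf TB)
  also have "\<dots> \<le> 0" using M T mult_right_mono[OF M(1) T] by (simp add: field_simps)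
  finally show ?thesis by simp
qed

text \<open>Up to the factor \<open>T\<close>, the difference of the two sides is the relative
  entropy of \<open>g\<close> with respect to the product of its marginals \<open>G\<close> and
  \<open>F\<close>. Summing \<open>ln x \<le> x - 1\<close> at
  \<open>x = G a * F b / (g a b * T)\<close> bounds it from below by
  \<open>T - T * T / T\<close>.\<close>

lemma mutual_information_nonneg:
  fixes g :: "'a \<Rightarrow> 'b \<Rightarrow> real"
  assumes fin: "finite A" "finite B" and nn: "\<And>a b. a \<in> A \<Longrightarrow> b \<in> B \<Longrightarrow> g a b \<ge> 0"
  defines "G \<equiv> \<lambda>a. \<Sum>b\<in>B. g a b" and "F \<equiv> \<lambda>b. \<Sum>a\<in>A. g a b"
    and "T \<equiv> \<Sum>a\<in>A. \<Sum>b\<in>B. g a b"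
  shows "(\<Sum>a\<in>A. G a * ln (G a)) + (\<Sum>b\<in>B. F b * ln (F b))
           \<le> T * ln T + (\<Sum>a\<in>A. \<Sum>b\<in>B. g a b * ln (g a b))"
proof -
  have T: "T \<ge> 0" unfolding T_def by (intro sum_nonneg nn)
  have GT: "(\<Sum>a\<in>A. G a) = T" by (simp add: G_def T_def)
  have FT: "(\<Sum>b\<in>B. F b) = T" unfolding F_def T_def by (rule sum.swap)
  have *: "g a b - G a * F b / T \<le> g a b * (ln (g a b) + ln T - ln (G a) - ln (F b))"
    if ab: "a \<in> A" "b \<in> B" for a b
  proof -
    have G0: "G a \<ge> 0" "F b \<ge> 0" unfolding G_def F_def using ab nn by (auto intro!: sum_nonneg)
    show ?thesis
    proof (cases "g a b = 0")
      case True
      then show ?thesis using G0 T by simp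
    next
      case False
      have g: "g a b > 0" using False nn[OF ab] by simp
      have "g a b \<le> G a" unfolding G_def using ab fin nn by (intro member_le_sum) auto
      then have Gp: "G a > 0" using g by simp
      have "g a b \<le> F b" unfolding F_def
        using ab fin nn member_le_sum[of a A "\<lambda>a. g a b"] by auto
      then have Fp: "F b > 0" using g by simp
      have "G a \<le> T" unfolding GT[symmetric] using ab fin nn
        by (intro member_le_sum) (auto simp: G_def intro!: sum_nonneg)
      then have Tp: "T > 0" using Gp by simp
      have "ln (G a * F b / (g a b * T)) \<le> G a * F b / (g a b * T) - 1"
        using g Gp Fp Tp by (intro ln_le_minus_one) auto
      then have "g a b * ln (G a * F b / (g a b * T)) \<le> g a b * (G a * F b / (g a b * T) - 1)"
        using g by (intro mult_left_mono) auto
      also have "\<dots> = G a * F b / T - g a b" using g Tp by (simp add: field_simps)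
      also have "ln (G a * F b / (g a b * T)) = ln (G a) + ln (F b) - ln (g a b) - ln T"
        using g Gp Fp Tp by (simp add: ln_div ln_mult)
      finally show ?thesis by (simp add: algebra_simps)
    qed
  qed
  have "0 = T - T * T / T" by simp
  also have "T * T = (\<Sum>a\<in>A. \<Sum>b\<in>B. G a * F b)"
    by (simp add: sum_product[symmetric] GT FT)
  also have "T - (\<Sum>a\<in>A. \<Sum>b\<in>B. G a * F b) / T = (\<Sum>a\<in>A. \<Sum>b\<in>B. g a b - G a * F b / T)"
    by (simp add: sum_subtractf sum_divide_distrib T_def)
  also have "\<dots> \<le> (\<Sum>a\<in>A. \<Sum>b\<in>B. g a b * (ln (g a b) + ln T - ln (G a) - ln (F b)))"
    by (intro sum_mono *)
  also have "\<dots> = (\<Sum>a\<in>A. \<Sum>b\<in>B. g a b * ln (g a b)) + (\<Sum>a\<in>A. \<Sum>b\<in>B. g a b * ln T)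
      - (\<Sum>a\<in>A. \<Sum>b\<in>B. g a b * ln (G a)) - (\<Sum>a\<in>A. \<Sum>b\<in>B. g a b * ln (F b))"
    by (simp add: algebra_simps sum.distrib sum_subtractf)
  also have "(\<Sum>a\<in>A. \<Sum>b\<in>B. g a b * ln T) = T * ln T"
    by (simp add: T_def sum_distrib_right)
  also have "(\<Sum>a\<in>A. \<Sum>b\<in>B. g a b * ln (G a)) = (\<Sum>a\<in>A. G a * ln (G a))"
    by (simp add: G_def sum_distrib_right)
  also have "(\<Sum>a\<in>A. \<Sum>b\<in>B. g a b * ln (F b)) = (\<Sum>b\<in>B. F b * ln (F b))"
    by (subst sum.swap) (simp add: F_def sum_distrib_right)
  finally show ?thesis by linarith
qed

text \<open>The parameter \<open>w\<close> is a threshold for \<open>y / x\<close>. Above it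
  \<open>x * y\<close> is at most \<open>y\<^sup>2 / w\<close>. Below it the larger value does not
  dominate, so the smaller one has enough entropy to pay for the product alone. The later choice of
  \<open>w\<close> trades one term against the other.\<close>

lemma two_point_energy_aux:
  fixes x y w :: real
  assumes "0 \<le> x" "x \<le> y" "w \<ge> 1"
  shows "2 * x * y \<le> 2 / w * (x\<^sup>2 + y\<^sup>2) + 6 * w / (1 + ln w) * (x\<^sup>2 * (ln (x\<^sup>2 + y\<^sup>2) - ln (x\<^sup>2)))"
proof -
  have lnw: "ln w \<ge> 0" using assms by simp
  consider "x = 0" | "x > 0" "w * x \<le> y" | "x > 0" "y < w * x" using assms by linarith
  then show ?thesis
  proof cases
    case 1
    then show ?thesis using assms by simp
  next
    case 2
    have "x * y \<le> y / w * y" using 2 assms by (intro mult_right_mono) (auto simp: field_simps)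
    also have "\<dots> \<le> 1 / w * (x\<^sup>2 + y\<^sup>2)"
      using assms by (simp add: power2_eq_square divide_simps)
    finally have "2 * (x * y) \<le> 2 * (1 / w * (x\<^sup>2 + y\<^sup>2))" by (rule mult_left_mono) simp
    moreover have "2 * (1 / w * (x\<^sup>2 + y\<^sup>2)) = 2 / w * (x\<^sup>2 + y\<^sup>2)" by simp
    ultimately have "2 * x * y \<le> 2 / w * (x\<^sup>2 + y\<^sup>2)" by (simp only: mult.assoc)
    moreover have "ln (x\<^sup>2) \<le> ln (x\<^sup>2 + y\<^sup>2)" using 2 by (intro ln_mono) (auto intro: add_pos_nonneg)
    ultimately show ?thesis using lnw assms
      by (intro order.trans[of "2 * x * y" _ _, OF _ add_increasing2[OF _ order.refl]]) auto
  next
    case 3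
    define z where "z = y / x"
    have z: "z \<ge> 1" "z < w" "y = z * x" using 3 assms by (auto simp: z_def field_simps)
    \<comment> \<open>That is, \<open>z / (1 + ln z)\<close> is nondecreasing for
      \<open>z \<ge> 1\<close>.\<close>
    have "1 + ln w \<le> (w / z) * (1 + ln z)"
    proof -
      have "ln (w / z) \<le> w / z - 1" using z by (intro ln_le_minus_one) auto
      moreover have "w / z - 1 \<le> (w / z - 1) * (1 + ln z)"
        using z by (simp add: mult_le_cancel_left1)
      moreover have "ln (w / z) = ln w - ln z" using z by (simp add: ln_div)
      ultimately show ?thesis by (simp add: algebra_simps)
    qed
    then have 1: "z * (1 + ln w) \<le> w * (1 + ln z)" using z by (simp add: field_simps)
    have "ln (1 + z\<^sup>2) \<ge> ln (z\<^sup>2)" using z by (intro ln_mono) (auto intro: add_pos_nonneg)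
    then have a: "ln (1 + z\<^sup>2) \<ge> 2 * ln z" using z by (simp add: ln_realpow)
    have "ln (1 + z\<^sup>2) \<ge> ln 2" using z by (intro ln_mono) (auto simp: one_le_power)
    then have "ln (1 + z\<^sup>2) \<ge> 2 / 3" using ln2_ge_two_thirds by linarith
    \<comment> \<open>Half of the factor 3 pays for the 1 through \<open>ln 2 \<ge> 2 / 3\<close>,
      the other half for \<open>ln z\<close>. Doubled, it is the 6 of the statement.\<close>
    then have 2: "1 + ln z \<le> 3 * ln (1 + z\<^sup>2)" using a by linarith
    have "z \<le> w / (1 + ln w) * (1 + ln z)" using 1 lnw by (simp add: field_simps)
    also have "\<dots> \<le> w / (1 + ln w) * (3 * ln (1 + z\<^sup>2))"
      using 2 lnw assms by (intro mult_left_mono) auto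
    finally have e1: "2 * x\<^sup>2 * z \<le> 2 * x\<^sup>2 * (w / (1 + ln w) * (3 * ln (1 + z\<^sup>2)))"
      by (intro mult_left_mono) auto
    have e2: "x\<^sup>2 * (ln (x\<^sup>2 + y\<^sup>2) - ln (x\<^sup>2)) = x\<^sup>2 * ln (1 + z\<^sup>2)"
    proof -
      have "x\<^sup>2 + y\<^sup>2 = x\<^sup>2 * (1 + z\<^sup>2)" using z by (simp add: algebra_simps power_mult_distrib)
      moreover have "1 + z\<^sup>2 > 0" by (intro add_pos_nonneg) auto
      ultimately show ?thesis using 3 by (simp add: ln_mult)
    qed
    have e3: "2 * x * y = 2 * x\<^sup>2 * z" using z by (simp add: power2_eq_square)
    have e4: "2 * x\<^sup>2 * (w / (1 + ln w) * (3 * ln (1 + z\<^sup>2)))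
        = 6 * w / (1 + ln w) * (x\<^sup>2 * ln (1 + z\<^sup>2))" by simp
    have "2 * x * y \<le> 6 * w / (1 + ln w) * (x\<^sup>2 * (ln (x\<^sup>2 + y\<^sup>2) - ln (x\<^sup>2)))"
      unfolding e2 e3 e4[symmetric] by (rule e1)
    moreover have "0 \<le> 2 / w * (x\<^sup>2 + y\<^sup>2)" using assms by simp
    ultimately show ?thesis by linarith
  qed
qed

text \<open>Measuring against an ambient mass \<open>T\<close> instead of the mass of the pair only
  enlarges the entropy terms, and the term of the larger value is nonnegative. In this form the
  bound can be summed over many pairs from one set.\<close>

lemma two_point_energy:
  fixes x y w T :: real
  assumes "0 \<le> x" "0 \<le> y" "w \<ge> 1" and T: "x\<^sup>2 + y\<^sup>2 \<le> T"
  shows "2 * x * y \<le> 2 / w * (x\<^sup>2 + y\<^sup>2)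
    + 6 * w / (1 + ln w) * (x\<^sup>2 * (ln T - ln (x\<^sup>2)) + y\<^sup>2 * (ln T - ln (y\<^sup>2)))"
proof -
  have *: "x\<^sup>2 * (ln (x\<^sup>2 + y\<^sup>2) - ln (x\<^sup>2)) \<le> x\<^sup>2 * (ln T - ln (x\<^sup>2)) + y\<^sup>2 * (ln T - ln (y\<^sup>2))"
    if "0 \<le> x" "0 \<le> y" "x\<^sup>2 + y\<^sup>2 \<le> T" for x y :: real
  proof -
    have 1: "x\<^sup>2 * (ln (x\<^sup>2 + y\<^sup>2) - ln (x\<^sup>2)) \<le> x\<^sup>2 * (ln T - ln (x\<^sup>2))"
    proof (cases "x = 0")
      case False
      then have "ln (x\<^sup>2 + y\<^sup>2) \<le> ln T" using that by (intro ln_mono) (auto intro: add_pos_nonneg)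
      then show ?thesis by (intro mult_left_mono) auto
    qed simp
    have 2: "0 \<le> y\<^sup>2 * (ln T - ln (y\<^sup>2))"
    proof (cases "y = 0")
      case False
      then have "ln (y\<^sup>2) \<le> ln T"
        using that by (intro ln_mono) (auto intro: order.trans[OF _ that(3)])
      then show ?thesis by simp
    qed simp
    show ?thesis using 1 2 by linarith
  qed
  have lnw: "6 * w / (1 + ln w) \<ge> 0" using assms by simp
  show ?thesis
  proof (cases "x \<le> y")
    case True
    show ?thesis
      using two_point_energy_aux[OF assms(1) True assms(3)]
        mult_left_mono[OF *[OF assms(1,2) T] lnw] by linarith
  next
    case False
    then show ?thesis
      using two_point_energy_aux[OF assms(2) _ assms(3), of x]
        mult_left_mono[OF *[OF assms(2,1)] lnw] T by (simp add: add.commute mult_ac)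
  qed
qed

text \<open>Half of the two-point bound is split into a charge \<open>\<psi>\<close> at each end of
  a pair. A point is charged at most twice as first and twice as second member, hence 4 times the
  constants 1 and 3. The size of \<open>A\<close> does not enter, which makes the bound uniform in
  \<open>m\<close>.\<close>

lemma degree_two_energy:
  fixes h :: "'a \<Rightarrow> real" and w :: real
  assumes fin: "finite A" and h: "\<And>a. a \<in> A \<Longrightarrow> h a \<ge> 0" and w: "w \<ge> 1"
    and R: "\<And>a b. R a b \<Longrightarrow> R b a" "\<And>a. \<not> R a a"
    and deg: "\<And>a. a \<in> A \<Longrightarrow> card {b\<in>A. R a b} \<le> 2"
  shows "(\<Sum>a\<in>A. \<Sum>b | b \<in> A \<and> R a b. h a * h b)
    \<le> 4 / w * (\<Sum>a\<in>A. (h a)\<^sup>2) + 12 * w / (1 + ln w) * mass_entropy A (\<lambda>a. (h a)\<^sup>2)"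
proof -
  define T where "T = (\<Sum>a\<in>A. (h a)\<^sup>2)"
  define \<psi> where "\<psi> a = 1 / w * (h a)\<^sup>2 + 3 * w / (1 + ln w) * ((h a)\<^sup>2 * (ln T - ln ((h a)\<^sup>2)))" for a
  have c: "w / (1 + ln w) \<ge> 0" using w by simp
  have psi: "\<psi> a \<ge> 0" if "a \<in> A" for a
  proof (cases "h a = 0")
    case False
    have "(h a)\<^sup>2 \<le> T" unfolding T_def
      using that fin member_le_sum[of a A "\<lambda>a. (h a)\<^sup>2"] by simp
    then have "ln ((h a)\<^sup>2) \<le> ln T" using False by (intro ln_mono) (auto intro: order.strict_trans2[OF _ \<open>(h a)\<^sup>2 \<le> T\<close>])
    then show ?thesis using c w by (auto simp: \<psi>_def intro!: add_nonneg_nonneg mult_nonneg_nonneg)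
  qed (simp add: \<psi>_def)
  have pair: "h a * h b \<le> \<psi> a + \<psi> b" if ab: "a \<in> A" "b \<in> A" "R a b" for a b
  proof -
    have "a \<noteq> b" using ab R(2) by auto
    then have "(h a)\<^sup>2 + (h b)\<^sup>2 = (\<Sum>a\<in>{a, b}. (h a)\<^sup>2)" by simp
    also have "\<dots> \<le> T" unfolding T_def using ab fin by (intro sum_mono2) auto
    finally have le: "(h a)\<^sup>2 + (h b)\<^sup>2 \<le> T" .
    define k v where "k = w / (1 + ln w)" and "v = 1 / w"
    have kv: "2 / w = 2 * v" "6 * w / (1 + ln w) = 6 * k" "3 * w / (1 + ln w) = 3 * k" "1 / w = v"
      by (simp_all add: k_def v_def)
    have "2 * h a * h b \<le> 2 * (\<psi> a + \<psi> b)"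
      using two_point_energy[OF h[OF ab(1)] h[OF ab(2)] w le]
      unfolding \<psi>_def kv by argo
    then have "2 * (h a * h b) \<le> 2 * (\<psi> a + \<psi> b)" by (simp only: mult.assoc)
    then show ?thesis by (rule mult_left_le_imp_le) simp
  qed
  have deg2: "(\<Sum>a\<in>A. \<Sum>b | b \<in> A \<and> R a b. \<psi> a) \<le> (\<Sum>a\<in>A. 2 * \<psi> a)"
  proof (rule sum_mono)
    fix a assume a: "a \<in> A"
    have "real (card {b\<in>A. R a b}) \<le> 2" using deg[OF a] by simp
    from mult_right_mono[OF this psi[OF a]] show "(\<Sum>b | b \<in> A \<and> R a b. \<psi> a) \<le> 2 * \<psi> a"
      by simp
  qed
  have "(\<Sum>a\<in>A. \<Sum>b | b \<in> A \<and> R a b. h a * h b) \<le> (\<Sum>a\<in>A. \<Sum>b | b \<in> A \<and> R a b. \<psi> a + \<psi> b)"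
    by (intro sum_mono pair) auto
  also have "\<dots> = (\<Sum>a\<in>A. \<Sum>b | b \<in> A \<and> R a b. \<psi> a) + (\<Sum>a\<in>A. \<Sum>b | b \<in> A \<and> R a b. \<psi> b)"
    by (simp add: sum.distrib)
  also have "(\<Sum>a\<in>A. \<Sum>b | b \<in> A \<and> R a b. \<psi> b) = (\<Sum>b\<in>A. \<Sum>a | a \<in> A \<and> R a b. \<psi> b)"
    using sum.swap_restrict[OF fin fin, of "\<lambda>a b. \<psi> b" "\<lambda>a b. R a b"] by simp
  also have "\<dots> = (\<Sum>b\<in>A. \<Sum>a | a \<in> A \<and> R b a. \<psi> b)"
    by (intro sum.cong refl) (use R(1) in blast)
  also have "(\<Sum>a\<in>A. \<Sum>b | b \<in> A \<and> R a b. \<psi> a) + (\<Sum>b\<in>A. \<Sum>a | a \<in> A \<and> R b a. \<psi> b)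
      \<le> 4 * (\<Sum>a\<in>A. \<psi> a)"
    using deg2 by (simp add: sum_distrib_left[symmetric])
  also have "(\<Sum>a\<in>A. \<psi> a) = 1 / w * T + 3 * w / (1 + ln w) * mass_entropy A (\<lambda>a. (h a)\<^sup>2)"
    unfolding mass_entropy_eq \<psi>_def T_def by (simp add: sum.distrib sum_distrib_left)
  finally show ?thesis by (simp add: T_def algebra_simps)
qed

lemma sum_PiE_insert:
  assumes "i \<notin> I"
  shows "(\<Sum>x\<in>PiE (insert i I) A. F x) = (\<Sum>a\<in>A i. \<Sum>x\<in>PiE I A. F (x(i := a)))"
proof -
  have "(\<Sum>x\<in>PiE (insert i I) A. F x) = (\<Sum>(a, x)\<in>A i \<times> PiE I A. F (x(i := a)))"
    unfolding PiE_insert_eq using sum.reindex[OF inj_combinator[OF assms, of A], of F]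
    by (simp add: case_prod_unfold)
  then show ?thesis by (simp add: sum.cartesian_product)
qed

text \<open>Edges in old coordinates are handled on the fibres over a value of the new coordinate,
  edges in the new coordinate on the fibres over a point of the old ones. While
  \<open>\<alpha>\<close> adds up over the coordinates, \<open>\<beta>\<close> is not multiplied by
  their number: all the fibre entropies together are at most the entropy of the whole.\<close>

lemma energy_tensorization:
  fixes f :: "('i \<Rightarrow> 'a) \<Rightarrow> real" and \<alpha> \<beta> :: real
  assumes fin: "finite I" "finite A" and \<beta>: "\<beta> \<ge> 0" and f: "\<And>x. f x \<ge> 0"
    and one: "\<And>h. (\<And>a. h a \<ge> 0) \<Longrightarrow> (\<Sum>a\<in>A. \<Sum>b | b \<in> A \<and> R a b. h a * h b)
                 \<le> \<alpha> * (\<Sum>a\<in>A. (h a)\<^sup>2) + \<beta> * mass_entropy A (\<lambda>a. (h a)\<^sup>2)"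
  shows "(\<Sum>i\<in>I. \<Sum>x\<in>I \<rightarrow>\<^sub>E A. \<Sum>a | a \<in> A \<and> R (x i) a. f x * f (x(i := a)))
    \<le> card I * \<alpha> * (\<Sum>x\<in>I \<rightarrow>\<^sub>E A. (f x)\<^sup>2) + \<beta> * mass_entropy (I \<rightarrow>\<^sub>E A) (\<lambda>x. (f x)\<^sup>2)"
  using fin(1) f
proof (induction I arbitrary: f rule: finite_induct)
  case empty
  then show ?case by (simp add: mass_entropy_def)
next
  case (insert j I f)
  let ?P = "I \<rightarrow>\<^sub>E A" and ?Q = "insert j I \<rightarrow>\<^sub>E A"
  have finP: "finite ?P" using insert.hyps fin by (intro finite_PiE) auto
  define g where "g a x = (f (x(j := a)))\<^sup>2" for a x
  define T where "T = (\<Sum>a\<in>A. \<Sum>x\<in>?P. g a x)"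
  have T: "(\<Sum>x\<in>?Q. (f x)\<^sup>2) = T"
    unfolding T_def g_def by (rule sum_PiE_insert) (fact insert.hyps)
  have comm: "x(j := a, i := b) = x(i := b, j := a)" if "i \<in> I" for x :: "'i \<Rightarrow> 'a" and a b i
    using that insert.hyps by (intro fun_upd_twist) auto
  have "(\<Sum>i\<in>I. \<Sum>x\<in>?Q. \<Sum>b | b \<in> A \<and> R (x i) b. f x * f (x(i := b)))
      = (\<Sum>i\<in>I. \<Sum>a\<in>A. \<Sum>x\<in>?P. \<Sum>b | b \<in> A \<and> R (x i) b. f (x(j := a)) * f (x(i := b, j := a)))"
  proof (rule sum.cong[OF refl])
    fix i assume i: "i \<in> I"
    then have "i \<noteq> j" using insert.hyps by auto
    then show "(\<Sum>x\<in>?Q. \<Sum>b | b \<in> A \<and> R (x i) b. f x * f (x(i := b)))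
      = (\<Sum>a\<in>A. \<Sum>x\<in>?P. \<Sum>b | b \<in> A \<and> R (x i) b. f (x(j := a)) * f (x(i := b, j := a)))"
      by (subst sum_PiE_insert[OF insert.hyps(2)]) (simp add: comm[OF i])
  qed
  also have "\<dots> = (\<Sum>a\<in>A. \<Sum>i\<in>I. \<Sum>x\<in>?P. \<Sum>b | b \<in> A \<and> R (x i) b. f (x(j := a)) * f (x(i := b, j := a)))"
    by (rule sum.swap)
  also have "\<dots> \<le> (\<Sum>a\<in>A. card I * \<alpha> * (\<Sum>x\<in>?P. g a x) + \<beta> * mass_entropy ?P (g a))"
  proof (rule sum_mono)
    fix a assume "a \<in> A"
    show "(\<Sum>i\<in>I. \<Sum>x\<in>?P. \<Sum>b | b \<in> A \<and> R (x i) b. f (x(j := a)) * f (x(i := b, j := a)))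
        \<le> card I * \<alpha> * (\<Sum>x\<in>?P. g a x) + \<beta> * mass_entropy ?P (g a)"
      unfolding g_def by (rule insert.IH[of "\<lambda>x. f (x(j := a))"]) (rule insert.prems)
  qed
  finally have old: "(\<Sum>i\<in>I. \<Sum>x\<in>?Q. \<Sum>b | b \<in> A \<and> R (x i) b. f x * f (x(i := b)))
      \<le> card I * \<alpha> * T + \<beta> * (\<Sum>a\<in>A. mass_entropy ?P (g a))"
    by (simp add: T_def sum.distrib sum_distrib_left)
  have "(\<Sum>x\<in>?Q. \<Sum>b | b \<in> A \<and> R (x j) b. f x * f (x(j := b)))
      = (\<Sum>x\<in>?P. \<Sum>a\<in>A. \<Sum>b | b \<in> A \<and> R a b. f (x(j := a)) * f (x(j := b)))"
    by (subst sum_PiE_insert[OF insert.hyps(2)]) (simp, rule sum.swap)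
  also have "\<dots> \<le> (\<Sum>x\<in>?P. \<alpha> * (\<Sum>a\<in>A. g a x) + \<beta> * mass_entropy A (\<lambda>a. g a x))"
    unfolding g_def using insert.prems by (intro sum_mono one) auto
  also have "\<dots> = \<alpha> * T + \<beta> * (\<Sum>x\<in>?P. mass_entropy A (\<lambda>a. g a x))"
    unfolding T_def by (subst sum.swap) (simp add: sum.distrib sum_distrib_left)
  finally have new: "(\<Sum>x\<in>?Q. \<Sum>b | b \<in> A \<and> R (x j) b. f x * f (x(j := b)))
      \<le> \<alpha> * T + \<beta> * (\<Sum>x\<in>?P. mass_entropy A (\<lambda>a. g a x))" .
  \<comment> \<open>The two conditional entropies sum to at most the joint entropy, which is
    nonnegativity of mutual information rearranged.\<close>
  have "(\<Sum>a\<in>A. mass_entropy ?P (g a)) + (\<Sum>x\<in>?P. mass_entropy A (\<lambda>a. g a x))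
      \<le> mass_entropy ?Q (\<lambda>x. (f x)\<^sup>2)"
  proof -
    have "mass_entropy ?Q (\<lambda>x. (f x)\<^sup>2) = T * ln T - (\<Sum>a\<in>A. \<Sum>x\<in>?P. g a x * ln (g a x))"
      unfolding mass_entropy_def T by (subst sum_PiE_insert[OF insert.hyps(2)]) (simp add: g_def)
    moreover have "(\<Sum>x\<in>?P. \<Sum>a\<in>A. g a x * ln (g a x)) = (\<Sum>a\<in>A. \<Sum>x\<in>?P. g a x * ln (g a x))"
      by (rule sum.swap)
    ultimately show ?thesis
      using mutual_information_nonneg[OF fin(2) finP, of g]
      by (simp add: mass_entropy_def sum_subtractf T_def g_def)
  qed
  from mult_left_mono[OF this \<beta>] old new
  have "(\<Sum>x\<in>?Q. \<Sum>b | b \<in> A \<and> R (x j) b. f x * f (x(j := b)))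
      + (\<Sum>i\<in>I. \<Sum>x\<in>?Q. \<Sum>b | b \<in> A \<and> R (x i) b. f x * f (x(i := b)))
      \<le> \<alpha> * T + card I * \<alpha> * T + \<beta> * mass_entropy ?Q (\<lambda>x. (f x)\<^sup>2)"
    unfolding distrib_left by linarith
  moreover have "real (card (insert j I)) * \<alpha> * T = \<alpha> * T + card I * \<alpha> * T"
    using insert.hyps by (simp add: algebra_simps)
  ultimately show ?case unfolding sum.insert[OF insert.hyps] T by linarith
qed

subsection \<open>Schur's test for the walk on Walsh coefficients\<close>

lemma weighted_Cauchy_Schwarz:
  fixes c g :: "'a \<Rightarrow> real"
  assumes "\<And>x. x \<in> N \<Longrightarrow> c x > 0"
  shows "(\<Sum>x\<in>N. g x)\<^sup>2 \<le> (\<Sum>x\<in>N. 1 / c x) * (\<Sum>x\<in>N. c x * (g x)\<^sup>2)"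
proof -
  have "(\<Sum>x\<in>N. g x) = (\<Sum>x\<in>N. sqrt (1 / c x) * (sqrt (c x) * g x))"
    by (intro sum.cong refl) (auto simp: real_sqrt_divide dest!: assms)
  also have "\<dots>\<^sup>2 \<le> (\<Sum>x\<in>N. (sqrt (1 / c x))\<^sup>2) * (\<Sum>x\<in>N. (sqrt (c x) * g x)\<^sup>2)"
    by (rule Cauchy_Schwarz_ineq_sum)
  also have "(\<Sum>x\<in>N. (sqrt (1 / c x))\<^sup>2) = (\<Sum>x\<in>N. 1 / c x)"
    using assms by (intro sum.cong refl real_sqrt_pow2) (simp add: less_imp_le)
  also have "(\<Sum>x\<in>N. (sqrt (c x) * g x)\<^sup>2) = (\<Sum>x\<in>N. c x * (g x)\<^sup>2)"
    using assms by (intro sum.cong refl) (simp add: power_mult_distrib less_imp_le)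
  finally show ?thesis .
qed

lemma sum_Pow_remove:
  assumes "e \<in> I"
  shows "(\<Sum>S | S \<in> Pow I \<and> e \<in> S. h (S - {e})) = (\<Sum>S | S \<in> Pow I \<and> e \<notin> S. h S)"
  by (rule sum.reindex_bij_witness[where i = "insert e" and j = "\<lambda>S. S - {e}"]) (use assms in auto)

lemma sum_Pow_insert:
  assumes "e \<in> I"
  shows "(\<Sum>S | S \<in> Pow I \<and> e \<notin> S. h (insert e S)) = (\<Sum>S | S \<in> Pow I \<and> e \<in> S. h S)"
  by (rule sum.reindex_bij_witness[where j = "insert e" and i = "\<lambda>S. S - {e}"]) (use assms in auto)

section \<open>Sets of matrix entries and the vertices they meet\<close>

definition toggle :: "'e \<Rightarrow> 'e set \<Rightarrow> 'e set" where
  "toggle e S = (if e \<in> S then S - {e} else insert e S)"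

text \<open>
  A path alternating between columns and rows passes through the matrix entry \<open>lab b v u\<close> when
  it moves from \<open>v\<close> to \<open>u\<close>; the flag \<open>b\<close> tells whether \<open>v\<close> is the row index.
\<close>

definition lab :: "bool \<Rightarrow> 'v \<Rightarrow> 'v \<Rightarrow> 'v \<times> 'v" where
  "lab b v u = (if b then (v, u) else (u, v))"

lemma lab_flip: "lab (\<not> b) u v = lab b v u"
  by (simp add: lab_def)

lemma lab_eq_iff [simp]: "lab b v u = lab b v' u' \<longleftrightarrow> v = v' \<and> u = u'"
  by (auto simp: lab_def)

text \<open>The vertices that \<open>S\<close> meets on the side to which the step leads: columns if
  \<open>b\<close> holds, rows otherwise. Whether \<open>u\<close> is new has to be tested on this
  side: an entry added when \<open>u\<close> is new is afterwards the only one with end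
  \<open>u\<close> there, so the step can be undone in one way only.\<close>

definition tgt :: "bool \<Rightarrow> ('v \<times> 'v) set \<Rightarrow> 'v set" where
  "tgt b S = {u. \<exists>v. lab b v u \<in> S}"

definition ends :: "('v \<times> 'v) set \<Rightarrow> 'v set" where
  "ends S = fst ` S \<union> snd ` S"

lemma ends_subset: "S \<subseteq> V \<times> V \<Longrightarrow> ends S \<subseteq> V"
  by (auto simp: ends_def)

lemma lab_in_ends: "lab b v u \<in> S \<Longrightarrow> v \<in> ends S \<and> u \<in> ends S"
  by (cases b) (force simp: ends_def lab_def)+

lemma tgt_subset_ends: "tgt b S \<subseteq> ends S"
  using lab_in_ends by (fastforce simp: tgt_def)

lemma card_ends_le: "finite S \<Longrightarrow> card (ends S) \<le> 2 * card S"
  unfolding ends_def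
  using card_Un_le[of "fst ` S" "snd ` S"] card_image_le[of S fst] card_image_le[of S snd] by linarith

text \<open>The backward sum runs over the entries of \<open>S\<close> with target \<open>u\<close>,
  each with its own smaller set. If \<open>u\<close> remains a target after the removal, only
  \<open>v\<close> can get lost, so all weights refer to the single vertex set \<open>ends S\<close>
  and one supersolution serves them all.\<close>

lemma ends_remove:
  assumes "lab b v u \<in> S" "u \<in> tgt b (S - {lab b v u})"
  shows "insert v (ends (S - {lab b v u})) = ends S"
proof -
  have S: "S = insert (lab b v u) (S - {lab b v u})" using assms(1) by blast
  have "ends S = {v, u} \<union> ends (S - {lab b v u})"
    by (subst S) (auto simp: ends_def lab_def)
  then show ?thesis using assms(2) tgt_subset_ends by fastforce
qed

text \<open>\<open>F S\<close> is a positive supersolution of the adjacency operator on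
  \<open>S\<close>, with \<open>\<Lambda>\<close> in the role of the top eigenvalue, for sets of at
  most \<open>M\<close> vertices. As a parameter it separates the walk argument from the way in
  which the torus provides such functions.\<close>

locale locally_sparse_graph =
  fixes V :: "'v set" and E :: "'v \<Rightarrow> 'v \<Rightarrow> bool" and \<Delta> \<Lambda> :: real and M :: nat
    and F :: "'v set \<Rightarrow> 'v \<Rightarrow> real"
  assumes finV: "finite V" and E_sym: "E v u \<Longrightarrow> E u v"
    and \<Delta>: "\<Delta> > 0" and \<Lambda>: "\<Lambda> \<ge> 0"
    and deg: "v \<in> V \<Longrightarrow> real (card {u. u \<in> V \<and> E v u}) \<le> \<Delta>"
    and F_pos: "S \<subseteq> V \<Longrightarrow> card S \<le> M \<Longrightarrow> v \<in> S \<Longrightarrow> F S v > 0"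
    and F_super: "S \<subseteq> V \<Longrightarrow> card S \<le> M \<Longrightarrow> v \<in> S \<Longrightarrow>
                    (\<Sum>u | u \<in> S \<and> E v u. F S u) \<le> \<Lambda> * F S v"
begin

text \<open>Schur weight of the step from \<open>v\<close> to \<open>u\<close> that adds an entry to
  \<open>S\<close>. It always refers to the smaller of the two entry sets; a step removing an entry
  gets the reciprocal weight of its reversal.\<close>

definition coef :: "bool \<Rightarrow> ('v \<times> 'v) set \<Rightarrow> 'v \<Rightarrow> 'v \<Rightarrow> real" where
  "coef b S v u = (if u \<notin> tgt b S then 1 / sqrt \<Delta>
     else F (insert v (ends S)) u / F (insert v (ends S)) v)"

definition normsq :: "(('v \<times> 'v) set \<Rightarrow> 'v \<Rightarrow> real) \<Rightarrow> real" where
  "normsq g = (\<Sum>v\<in>V. \<Sum>S\<in>Pow (V \<times> V). (g S v)\<^sup>2)"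

definition plus_step where
  "plus_step b g S u = (\<Sum>v | v \<in> V \<and> E v u \<and> lab b v u \<in> S. g (S - {lab b v u}) v)"

text \<open>Adjoint of \<open>plus_step (\<not> b)\<close>, since \<open>lab b v u\<close> is
  \<open>lab (\<not> b) u v\<close>.\<close>

definition minus_step where
  "minus_step b g S u = (\<Sum>v | v \<in> V \<and> E v u \<and> lab b v u \<notin> S. g (insert (lab b v u) S) v)"

definition step :: "bool \<Rightarrow> (('v \<times> 'v) set \<Rightarrow> 'v \<Rightarrow> real) \<Rightarrow> ('v \<times> 'v) set \<Rightarrow> 'v \<Rightarrow> real" where
  "step b g S u = (\<Sum>v | v \<in> V \<and> E v u. g (toggle (lab b v u) S) v)"

lemma step_eq: "step b g S u = plus_step b g S u + minus_step b g S u"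
proof -
  have "{v. v \<in> V \<and> E v u} = {v. v \<in> V \<and> E v u \<and> lab b v u \<in> S} \<union> {v. v \<in> V \<and> E v u \<and> lab b v u \<notin> S}"
    by blast
  then have "step b g S u = (\<Sum>v | v \<in> V \<and> E v u \<and> lab b v u \<in> S. g (toggle (lab b v u) S) v)
      + (\<Sum>v | v \<in> V \<and> E v u \<and> lab b v u \<notin> S. g (toggle (lab b v u) S) v)"
    unfolding step_def using finV by (simp only:) (rule sum.union_disjoint, auto)
  then show ?thesis by (simp add: plus_step_def minus_step_def toggle_def)
qed

lemma finite_edges: "S \<subseteq> V \<times> V \<Longrightarrow> finite S"
  using finV finite_subset[of S "V \<times> V"] by simp

lemma insert_ends:
  assumes "S \<subseteq> V \<times> V" "2 * card S + 1 \<le> M" "v \<in> V"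
  shows "insert v (ends S) \<subseteq> V" "card (insert v (ends S)) \<le> M"
proof -
  show "insert v (ends S) \<subseteq> V" using assms ends_subset by blast
  show "card (insert v (ends S)) \<le> M"
    using card_ends_le[OF finite_edges[OF assms(1)]] assms(2) card_insert_le_m1[of _ "ends S" v]
      card_insert_if[of "ends S" v] finite_subset[OF ends_subset[OF assms(1)] finV]
    by (auto split: if_splits)
qed

lemma coef_pos:
  assumes "S \<subseteq> V \<times> V" "2 * card S + 1 \<le> M" "v \<in> V"
  shows "coef b S v u > 0"
  using \<Delta> insert_ends[OF assms] tgt_subset_ends[of b S] by (auto simp: coef_def intro!: divide_pos_pos F_pos)

text \<open>At most \<open>\<Delta>\<close> new vertices have weight
  \<open>1 / sqrt \<Delta>\<close> each. The targets already met lie in the set on which the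
  supersolution lives, and its inequality at \<open>v\<close> bounds their ratios by
  \<open>\<Lambda>\<close>.\<close>

lemma sum_coef_le:
  assumes S: "S \<subseteq> V \<times> V" "2 * card S + 1 \<le> M" and v: "v \<in> V"
  shows "(\<Sum>u | u \<in> V \<and> E v u. coef b S v u) \<le> sqrt \<Delta> + \<Lambda>"
proof -
  let ?T = "insert v (ends S)"
  note T = insert_ends[OF S v]
  have pos: "F ?T v > 0" "\<And>u. u \<in> ?T \<Longrightarrow> F ?T u > 0" using F_pos[OF T] by auto
  have finT: "finite ?T" using finite_subset[OF T(1) finV] .
  have "(\<Sum>u | u \<in> V \<and> E v u. coef b S v u)
      = (\<Sum>u | u \<in> V \<and> E v u \<and> u \<notin> tgt b S. coef b S v u) + (\<Sum>u | u \<in> V \<and> E v u \<and> u \<in> tgt b S. coef b S v u)"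
    by (subst sum.union_disjoint[symmetric]) (use finV in \<open>auto intro!: sum.cong\<close>)
  also have "(\<Sum>u | u \<in> V \<and> E v u \<and> u \<notin> tgt b S. coef b S v u)
      \<le> (\<Sum>u | u \<in> V \<and> E v u. 1 / sqrt \<Delta>)"
    unfolding coef_def using finV \<Delta> by (simp, intro divide_right_mono of_nat_mono card_mono) auto
  also have "\<dots> \<le> \<Delta> / sqrt \<Delta>"
    using deg[OF v] \<Delta> by (simp add: divide_right_mono)
  also have "\<Delta> / sqrt \<Delta> = sqrt \<Delta>" using \<Delta> by (simp add: real_div_sqrt)
  also have "(\<Sum>u | u \<in> V \<and> E v u \<and> u \<in> tgt b S. coef b S v u)
      = (\<Sum>u | u \<in> V \<and> E v u \<and> u \<in> tgt b S. F ?T u) / F ?T v"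
    by (simp add: coef_def sum_divide_distrib)
  also have "\<dots> \<le> (\<Sum>u | u \<in> ?T \<and> E v u. F ?T u) / F ?T v"
    using finT pos tgt_subset_ends[of b S]
    by (intro divide_right_mono sum_mono2) (auto intro: less_imp_le)
  also have "\<dots> \<le> \<Lambda>"
    using F_super[OF T, of v] pos by (simp add: divide_le_eq)
  finally show ?thesis by simp
qed

text \<open>Either some removal makes \<open>u\<close> new, and then this entry is the only summand;
  or none does, and all summands are ratios of the one function \<open>F (ends S)\<close>, whose
  inequality at \<open>u\<close> applies.\<close>

lemma sum_inverse_coef_le:
  assumes S: "S \<subseteq> V \<times> V" "2 * card S \<le> M" and u: "u \<in> V"
  shows "(\<Sum>v | v \<in> V \<and> E v u \<and> lab b v u \<in> S. 1 / coef b (S - {lab b v u}) v u) \<le> sqrt \<Delta> + \<Lambda>"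
proof -
  let ?N = "{v. v \<in> V \<and> E v u \<and> lab b v u \<in> S}" and ?T = "ends S"
  have T: "?T \<subseteq> V" "card ?T \<le> M"
    using ends_subset[OF S(1)] card_ends_le[OF finite_edges[OF S(1)]] S(2) by auto
  have finT: "finite ?T" using finite_subset[OF T(1) finV] .
  consider "?N = {}" | v where "v \<in> ?N" "u \<notin> tgt b (S - {lab b v u})"
    | v where "v \<in> ?N" "\<And>v. v \<in> ?N \<Longrightarrow> u \<in> tgt b (S - {lab b v u})" by blast
  then show ?thesis
  proof cases
    case 1
    then show ?thesis using \<Delta> \<Lambda> by (simp only: sum.empty) simp
  next
    case (2 v)
    then have "?N = {v}" by (auto simp: tgt_def)
    then have "(\<Sum>v\<in>?N. 1 / coef b (S - {lab b v u}) v u) = 1 / coef b (S - {lab b v u}) v u"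
      by (simp only:) simp
    also have "\<dots> = sqrt \<Delta>" using 2 by (simp add: coef_def)
    finally show ?thesis using \<Lambda> by simp
  next
    case (3 v)
    have uT: "u \<in> ?T" using 3(1) lab_in_ends by fastforce
    have pos: "\<And>v. v \<in> ?T \<Longrightarrow> F ?T v > 0" using F_pos[OF T] .
    have "(\<Sum>v\<in>?N. 1 / coef b (S - {lab b v u}) v u) = (\<Sum>v\<in>?N. F ?T v / F ?T u)"
      using 3(2) by (intro sum.cong refl) (simp add: coef_def ends_remove)
    also have "\<dots> = (\<Sum>v\<in>?N. F ?T v) / F ?T u" by (simp add: sum_divide_distrib)
    also have "\<dots> \<le> (\<Sum>v | v \<in> ?T \<and> E u v. F ?T v) / F ?T u"
      using finT pos uT E_sym lab_in_ends[of b _ u S]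
      by (intro divide_right_mono sum_mono2) (auto intro: less_imp_le)
    also have "\<dots> \<le> \<Lambda>" using F_super[OF T uT] pos[OF uT] by (simp add: divide_le_eq)
    finally show ?thesis using \<Delta> by (smt (verit) real_sqrt_ge_zero)
  qed
qed

text \<open>Schur's test: \<open>sum_inverse_coef_le\<close> gives one factor in Cauchy-Schwarz, and
  after exchanging the sums \<open>sum_coef_le\<close> gives the other. The support condition keeps
  all vertex sets within the size \<open>M\<close> for which supersolutions exist; larger entry sets
  contribute zero.\<close>

lemma normsq_plus_step_le:
  assumes supp: "\<And>S v. S \<subseteq> V \<times> V \<Longrightarrow> j < card S \<Longrightarrow> g S v = 0" and j: "2 * (j + 1) \<le> M"
  shows "normsq (plus_step b g) \<le> (sqrt \<Delta> + \<Lambda>)\<^sup>2 * normsq g"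
proof -
  let ?L = "sqrt \<Delta> + \<Lambda>" and ?I = "V \<times> V"
  define h where "h S v u = coef b S v u * (g S v)\<^sup>2" for S v u
  have L: "?L \<ge> 0" using \<Delta> \<Lambda> by simp
  have h0: "h S v u \<ge> 0" if "S \<subseteq> ?I" "v \<in> V" for S v u
  proof (cases "card S \<le> j")
    case True
    then show ?thesis using coef_pos[of S v b u] that j by (simp add: h_def)
  next
    case False
    then show ?thesis using supp[of S v] that by (simp add: h_def)
  qed
  have *: "(plus_step b g S u)\<^sup>2 \<le> ?L * (\<Sum>v | v \<in> V \<and> E v u \<and> lab b v u \<in> S. h (S - {lab b v u}) v u)"
    if S: "S \<subseteq> ?I" and u: "u \<in> V" for S u
  proof -
    have sub: "S - {x} \<subseteq> ?I" for x using S by blast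
    have sum0: "(\<Sum>v | v \<in> V \<and> E v u \<and> lab b v u \<in> S. h (S - {lab b v u}) v u) \<ge> 0"
      by (intro sum_nonneg h0 sub) auto
    have cardS: "card (S - {lab b v u}) = card S - 1" if "lab b v u \<in> S" for v
      using that finite_edges[OF S] by simp
    show ?thesis
    proof (cases "card S \<le> j + 1")
      case True
      have pos: "coef b (S - {lab b v u}) v u > 0" if "v \<in> V" "lab b v u \<in> S" for v
      proof (rule coef_pos[OF sub _ that(1)])
        have "card S > 0" using that(2) finite_edges[OF S] by (auto simp: card_gt_0_iff)
        then show "2 * card (S - {lab b v u}) + 1 \<le> M" using True j cardS[OF that(2)] by simp
      qed
      have "(plus_step b g S u)\<^sup>2
        \<le> (\<Sum>v | v \<in> V \<and> E v u \<and> lab b v u \<in> S. 1 / coef b (S - {lab b v u}) v u)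
          * (\<Sum>v | v \<in> V \<and> E v u \<and> lab b v u \<in> S. h (S - {lab b v u}) v u)"
        unfolding plus_step_def h_def by (rule weighted_Cauchy_Schwarz) (use pos in auto)
      also have "\<dots> \<le> ?L * (\<Sum>v | v \<in> V \<and> E v u \<and> lab b v u \<in> S. h (S - {lab b v u}) v u)"
        using True j by (intro mult_right_mono sum_inverse_coef_le S u sum0) auto
      finally show ?thesis .
    next
      case False
      have "plus_step b g S u = 0" unfolding plus_step_def
      proof (rule sum.neutral, safe)
        fix v assume "v \<in> V" "lab b v u \<in> S"
        then show "g (S - {lab b v u}) v = 0" using False cardS by (intro supp sub) auto
      qed
      then show ?thesis using L sum0 by simp
    qed
  qed
  have "normsq (plus_step b g)
      \<le> (\<Sum>u\<in>V. \<Sum>S\<in>Pow ?I. ?L * (\<Sum>v | v \<in> V \<and> E v u \<and> lab b v u \<in> S. h (S - {lab b v u}) v u))"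
    unfolding normsq_def by (intro sum_mono *) auto
  also have "\<dots> = ?L * (\<Sum>u\<in>V. \<Sum>v | v \<in> V \<and> E v u. \<Sum>S | S \<in> Pow ?I \<and> lab b v u \<in> S. h (S - {lab b v u}) v u)"
  proof -
    have "(\<Sum>S\<in>Pow ?I. \<Sum>v | v \<in> V \<and> E v u \<and> lab b v u \<in> S. h (S - {lab b v u}) v u)
      = (\<Sum>v | v \<in> V \<and> E v u. \<Sum>S | S \<in> Pow ?I \<and> lab b v u \<in> S. h (S - {lab b v u}) v u)" for u
      using sum.swap_restrict[of "Pow ?I" "{v. v \<in> V \<and> E v u}" "\<lambda>S v. h (S - {lab b v u}) v u"
          "\<lambda>S v. lab b v u \<in> S"] finV by (simp add: conj_assoc)
    then show ?thesis by (simp only: sum_distrib_left[symmetric])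
  qed
  also have "\<dots> = ?L * (\<Sum>u\<in>V. \<Sum>v | v \<in> V \<and> E v u. \<Sum>S | S \<in> Pow ?I \<and> lab b v u \<notin> S. h S v u)"
    by (intro arg_cong2[where f = "(*)"] refl sum.cong sum_Pow_remove) (auto simp: lab_def)
  also have "\<dots> \<le> ?L * (\<Sum>u\<in>V. \<Sum>v | v \<in> V \<and> E v u. \<Sum>S\<in>Pow ?I. h S v u)"
    using L finV by (intro mult_left_mono sum_mono sum_mono2) (auto intro: h0)
  also have "(\<Sum>u\<in>V. \<Sum>v | v \<in> V \<and> E v u. \<Sum>S\<in>Pow ?I. h S v u)
      = (\<Sum>v\<in>V. \<Sum>u | u \<in> V \<and> E v u. \<Sum>S\<in>Pow ?I. h S v u)"
    using sum.swap_restrict[OF finV finV, of "\<lambda>u v. \<Sum>S\<in>Pow ?I. h S v u" "\<lambda>u v. E v u"] by simp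
  also have "\<dots> = (\<Sum>v\<in>V. \<Sum>S\<in>Pow ?I. (\<Sum>u | u \<in> V \<and> E v u. coef b S v u) * (g S v)\<^sup>2)"
    by (intro sum.cong refl) (subst sum.swap, simp add: h_def sum_distrib_right)
  also have "\<dots> \<le> (\<Sum>v\<in>V. \<Sum>S\<in>Pow ?I. ?L * (g S v)\<^sup>2)"
  proof (intro sum_mono)
    fix v S assume vS: "v \<in> V" "S \<in> Pow ?I"
    show "(\<Sum>u | u \<in> V \<and> E v u. coef b S v u) * (g S v)\<^sup>2 \<le> ?L * (g S v)\<^sup>2"
    proof (cases "card S \<le> j")
      case True
      then show ?thesis using vS j by (intro mult_right_mono sum_coef_le) auto
    next
      case False
      then show ?thesis using supp[of S v] vS by simp
    qed
  qed
  also have "\<dots> = ?L * normsq g" by (simp add: normsq_def sum_distrib_left)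
  finally show ?thesis using mult_left_mono[OF _ L] by (simp only: power2_eq_square mult.assoc)
qed

text \<open>The same test for the adjoint. With reciprocal weights the two sums change places:
  \<open>sum_coef_le\<close> now serves Cauchy-Schwarz and \<open>sum_inverse_coef_le\<close> the
  exchanged sum.\<close>

lemma normsq_minus_step_le:
  assumes supp: "\<And>S v. S \<subseteq> V \<times> V \<Longrightarrow> j < card S \<Longrightarrow> g S v = 0" and j: "2 * (j + 1) \<le> M"
  shows "normsq (minus_step b g) \<le> (sqrt \<Delta> + \<Lambda>)\<^sup>2 * normsq g"
proof -
  let ?L = "sqrt \<Delta> + \<Lambda>" and ?I = "V \<times> V"
  define h where "h S v u = 1 / coef (\<not> b) (S - {lab b v u}) u v * (g S v)\<^sup>2" for S v u
  have L: "?L \<ge> 0" using \<Delta> \<Lambda> by simp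
  have h0: "h S v u \<ge> 0" if "S \<subseteq> ?I" "u \<in> V" "lab b v u \<in> S" for S v u
  proof (cases "card S \<le> j")
    case True
    have "card (S - {lab b v u}) \<le> card S" using finite_edges[OF that(1)] by (intro card_mono) auto
    then have "coef (\<not> b) (S - {lab b v u}) u v > 0" using that True j by (intro coef_pos) auto
    then show ?thesis by (simp add: h_def)
  next
    case False
    then show ?thesis using supp[of S v] that by (simp add: h_def)
  qed
  have *: "(minus_step b g S u)\<^sup>2 \<le> ?L * (\<Sum>v | v \<in> V \<and> E v u \<and> lab b v u \<notin> S. h (insert (lab b v u) S) v u)"
    if S: "S \<subseteq> ?I" and u: "u \<in> V" for S u
  proof -
    have sub: "insert (lab b v u) S \<subseteq> ?I" if "v \<in> V" for v using S u that by (auto simp: lab_def)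
    have sum0: "(\<Sum>v | v \<in> V \<and> E v u \<and> lab b v u \<notin> S. h (insert (lab b v u) S) v u) \<ge> 0"
      by (intro sum_nonneg h0 sub u) auto
    show ?thesis
    proof (cases "card S \<le> j")
      case True
      have S1: "2 * card S + 1 \<le> M" using True j by simp
      note pos = coef_pos[OF S S1 u]
      have "(minus_step b g S u)\<^sup>2
        \<le> (\<Sum>v | v \<in> V \<and> E v u \<and> lab b v u \<notin> S. 1 / (1 / coef (\<not> b) S u v))
          * (\<Sum>v | v \<in> V \<and> E v u \<and> lab b v u \<notin> S. 1 / coef (\<not> b) S u v * (g (insert (lab b v u) S) v)\<^sup>2)"
        unfolding minus_step_def by (rule weighted_Cauchy_Schwarz) (use pos in auto)
      also have "\<dots> = (\<Sum>v | v \<in> V \<and> E v u \<and> lab b v u \<notin> S. coef (\<not> b) S u v)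
          * (\<Sum>v | v \<in> V \<and> E v u \<and> lab b v u \<notin> S. h (insert (lab b v u) S) v u)"
        by (intro arg_cong2[where f = "(*)"] sum.cong refl) (auto simp: h_def)
      also have "\<dots> \<le> (\<Sum>v | v \<in> V \<and> E u v. coef (\<not> b) S u v)
          * (\<Sum>v | v \<in> V \<and> E v u \<and> lab b v u \<notin> S. h (insert (lab b v u) S) v u)"
        using finV E_sym pos by (intro mult_right_mono sum_mono2 sum0) (auto intro: less_imp_le)
      also have "\<dots> \<le> ?L * (\<Sum>v | v \<in> V \<and> E v u \<and> lab b v u \<notin> S. h (insert (lab b v u) S) v u)"
        by (intro mult_right_mono sum_coef_le S S1 u sum0)
      finally show ?thesis .
    next
      case False
      have "minus_step b g S u = 0" unfolding minus_step_def
      proof (rule sum.neutral, safe)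
        fix v assume "v \<in> V" "lab b v u \<notin> S"
        then show "g (insert (lab b v u) S) v = 0"
          using False finite_edges[OF S] sub by (intro supp) auto
      qed
      then show ?thesis using L sum0 by simp
    qed
  qed
  have "normsq (minus_step b g)
      \<le> (\<Sum>u\<in>V. \<Sum>S\<in>Pow ?I. ?L * (\<Sum>v | v \<in> V \<and> E v u \<and> lab b v u \<notin> S. h (insert (lab b v u) S) v u))"
    unfolding normsq_def by (intro sum_mono *) auto
  also have "\<dots> = ?L * (\<Sum>u\<in>V. \<Sum>v | v \<in> V \<and> E v u. \<Sum>S | S \<in> Pow ?I \<and> lab b v u \<notin> S. h (insert (lab b v u) S) v u)"
  proof -
    have "(\<Sum>S\<in>Pow ?I. \<Sum>v | v \<in> V \<and> E v u \<and> lab b v u \<notin> S. h (insert (lab b v u) S) v u)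
      = (\<Sum>v | v \<in> V \<and> E v u. \<Sum>S | S \<in> Pow ?I \<and> lab b v u \<notin> S. h (insert (lab b v u) S) v u)" for u
      using sum.swap_restrict[of "Pow ?I" "{v. v \<in> V \<and> E v u}" "\<lambda>S v. h (insert (lab b v u) S) v u"
          "\<lambda>S v. lab b v u \<notin> S"] finV by (simp add: conj_assoc)
    then show ?thesis by (simp only: sum_distrib_left[symmetric])
  qed
  also have "\<dots> = ?L * (\<Sum>u\<in>V. \<Sum>v | v \<in> V \<and> E v u. \<Sum>S | S \<in> Pow ?I \<and> lab b v u \<in> S. h S v u)"
    by (intro arg_cong2[where f = "(*)"] refl sum.cong sum_Pow_insert) (auto simp: lab_def)
  also have "(\<Sum>u\<in>V. \<Sum>v | v \<in> V \<and> E v u. \<Sum>S | S \<in> Pow ?I \<and> lab b v u \<in> S. h S v u)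
      = (\<Sum>v\<in>V. \<Sum>u | u \<in> V \<and> E v u. \<Sum>S | S \<in> Pow ?I \<and> lab b v u \<in> S. h S v u)"
    using sum.swap_restrict[OF finV finV, of "\<lambda>u v. \<Sum>S | S \<in> Pow ?I \<and> lab b v u \<in> S. h S v u" "\<lambda>u v. E v u"] by simp
  also have "\<dots> = (\<Sum>v\<in>V. \<Sum>S\<in>Pow ?I. \<Sum>u | u \<in> V \<and> E v u \<and> lab b v u \<in> S. h S v u)"
  proof (rule sum.cong[OF refl])
    fix v
    show "(\<Sum>u | u \<in> V \<and> E v u. \<Sum>S | S \<in> Pow ?I \<and> lab b v u \<in> S. h S v u)
        = (\<Sum>S\<in>Pow ?I. \<Sum>u | u \<in> V \<and> E v u \<and> lab b v u \<in> S. h S v u)"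
      using sum.swap_restrict[of "{u. u \<in> V \<and> E v u}" "Pow ?I" "\<lambda>u S. h S v u"
          "\<lambda>u S. lab b v u \<in> S"] finV by (simp add: conj_assoc)
  qed
  also have "\<dots> \<le> (\<Sum>v\<in>V. \<Sum>S\<in>Pow ?I. ?L * (g S v)\<^sup>2)"
  proof (intro sum_mono)
    fix v S assume vS: "v \<in> V" "S \<in> Pow ?I"
    have "(\<Sum>u | u \<in> V \<and> E v u \<and> lab b v u \<in> S. h S v u)
        = (\<Sum>u | u \<in> V \<and> E u v \<and> lab (\<not> b) u v \<in> S. 1 / coef (\<not> b) (S - {lab (\<not> b) u v}) u v) * (g S v)\<^sup>2"
      unfolding h_def lab_flip sum_distrib_right using E_sym by (intro sum.cong) auto
    also have "\<dots> \<le> ?L * (g S v)\<^sup>2"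
    proof (cases "card S \<le> j")
      case True
      then show ?thesis using vS j by (intro mult_right_mono sum_inverse_coef_le) auto
    next
      case False
      then show ?thesis using supp[of S v] vS by simp
    qed
    finally show "(\<Sum>u | u \<in> V \<and> E v u \<and> lab b v u \<in> S. h S v u) \<le> ?L * (g S v)\<^sup>2" .
  qed
  also have "\<dots> = ?L * normsq g" by (simp add: normsq_def sum_distrib_left)
  finally show ?thesis using mult_left_mono[OF _ L] by (simp only: power2_eq_square mult.assoc)
qed

lemma normsq_step_le:
  assumes supp: "\<And>S v. S \<subseteq> V \<times> V \<Longrightarrow> j < card S \<Longrightarrow> g S v = 0" and j: "2 * (j + 1) \<le> M"
  shows "normsq (step b g) \<le> (2 * (sqrt \<Delta> + \<Lambda>))\<^sup>2 * normsq g"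
proof -
  have "normsq (step b g) \<le> (\<Sum>v\<in>V. \<Sum>S\<in>Pow (V \<times> V). 2 * (plus_step b g S v)\<^sup>2 + 2 * (minus_step b g S v)\<^sup>2)"
    unfolding normsq_def step_eq
  proof (intro sum_mono)
    fix S v
    show "(plus_step b g S v + minus_step b g S v)\<^sup>2 \<le> 2 * (plus_step b g S v)\<^sup>2 + 2 * (minus_step b g S v)\<^sup>2"
      using zero_le_power2[of "plus_step b g S v - minus_step b g S v"]
      by (simp add: power2_eq_square algebra_simps)
  qed
  also have "\<dots> = 2 * normsq (plus_step b g) + 2 * normsq (minus_step b g)"
    by (simp add: normsq_def sum.distrib sum_distrib_left)
  also have "\<dots> \<le> 4 * ((sqrt \<Delta> + \<Lambda>)\<^sup>2 * normsq g)"
    using normsq_plus_step_le[of j g b] normsq_minus_step_le[of j g b] supp j by fastforce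
  also have "\<dots> = (2 * (sqrt \<Delta> + \<Lambda>))\<^sup>2 * normsq g"
    by (simp only: power_mult_distrib) simp
  finally show ?thesis .
qed

end

subsection \<open>Moments of the operator norm\<close>

lemma walsh_toggle:
  assumes "\<epsilon> e \<in> {-1, 1}" "finite S"
  shows "\<epsilon> e * walsh S \<epsilon> = walsh (toggle e S) \<epsilon>"
proof (cases "e \<in> S")
  case True
  then have "walsh S \<epsilon> = \<epsilon> e * walsh (S - {e}) \<epsilon>"
    unfolding walsh_def using assms(2) by (rule prod.remove[rotated])
  then show ?thesis using True assms(1) by (auto simp: toggle_def)
qed (use assms(2) in \<open>simp add: toggle_def walsh_def\<close>)

lemma l2_opnorm_nonneg:
  assumes "finite V"
  shows "0 \<le> l2_opnorm V A"
proof -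
  have "L2_set (\<lambda>i. \<Sum>j\<in>V. A i j * (\<lambda>_. 0) j) V \<le> l2_opnorm V A"
    unfolding l2_opnorm_def by (intro cSUP_upper bdd_above_l2_opnorm assms) (simp add: L2_set_def)
  then show ?thesis by (simp add: L2_set_def)
qed

lemma bilinear_le_opnorm:
  assumes finV: "finite V" and st: "L2_set s V \<le> 1" "L2_set t V \<le> 1"
  shows "\<bar>\<Sum>(i, j)\<in>V \<times> V. of_bool (E i j) * \<epsilon> (i, j) * s i * t j\<bar> \<le> l2_opnorm V (signed_adj E \<epsilon>)"
proof -
  let ?A = "\<lambda>i. \<Sum>j\<in>V. signed_adj E \<epsilon> i j * t j"
  have "(\<Sum>(i, j)\<in>V \<times> V. of_bool (E i j) * \<epsilon> (i, j) * s i * t j) = (\<Sum>i\<in>V. s i * ?A i)"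
    by (simp add: sum.cartesian_product[symmetric] signed_adj_def sum_distrib_left mult_ac)
  also have "\<bar>\<dots>\<bar> \<le> (\<Sum>i\<in>V. \<bar>s i\<bar> * \<bar>?A i\<bar>)"
    by (rule order.trans[OF sum_abs]) (simp add: abs_mult)
  also have "\<dots> \<le> L2_set s V * L2_set ?A V" by (rule L2_set_mult_ineq)
  also have "\<dots> \<le> 1 * l2_opnorm V (signed_adj E \<epsilon>)"
    using st unfolding l2_opnorm_def
    by (intro mult_mono cSUP_upper bdd_above_l2_opnorm finV) auto
  finally show ?thesis by simp
qed

text \<open>By log-convexity the ratios of consecutive terms do not decrease, so each is at least
  the first. For the norms of alternating products on a fixed vector this takes the place of a
  spectral decomposition.\<close>

lemma log_convex_power_le:
  fixes a :: "nat \<Rightarrow> real"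
  assumes nn: "\<And>j. a j \<ge> 0" and conv: "\<And>j. (a (Suc j))\<^sup>2 \<le> a j * a (Suc (Suc j))" and a0: "a 0 \<le> 1"
    and k: "k \<ge> 1"
  shows "a 1 ^ k \<le> a k"
proof -
  have ratio: "a 1 * a j \<le> a 0 * a (Suc j)" for j
  proof (induction j)
    case (Suc j)
    show ?case
    proof (cases "a (Suc j) = 0")
      case False
      then have pos: "a (Suc j) > 0" using nn[of "Suc j"] by simp
      have "a 1 * (a (Suc j))\<^sup>2 \<le> a 1 * (a j * a (Suc (Suc j)))" by (intro mult_left_mono conv nn)
      also have "\<dots> \<le> a 0 * a (Suc j) * a (Suc (Suc j))"
        using mult_right_mono[OF Suc nn[of "Suc (Suc j)"]] by (simp add: mult_ac)
      finally have "a (Suc j) * (a 1 * a (Suc j)) \<le> a (Suc j) * (a 0 * a (Suc (Suc j)))"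
        by (simp add: power2_eq_square mult_ac)
      then show ?thesis using pos by simp
    qed (use nn in simp)
  qed (simp add: mult.commute)
  show ?thesis using k
  proof (induction k rule: dec_induct)
    case (step k)
    have "a 1 ^ Suc k \<le> a 1 * a k" using step nn by (simp add: mult_left_mono)
    also have "\<dots> \<le> a 0 * a (Suc k)" by (rule ratio)
    also have "\<dots> \<le> 1 * a (Suc k)" by (intro mult_right_mono a0 nn)
    finally show ?case by simp
  qed simp
qed

section \<open>Alternating products of the signed matrix and its transpose\<close>

context locally_sparse_graph
begin

text \<open>The step from \<open>j\<close> to \<open>Suc j\<close> reads the entry
  \<open>(u, v)\<close> for even \<open>j\<close> and \<open>(v, u)\<close> for odd
  \<open>j\<close>, so the matrix itself acts first and its transpose second.\<close>

fun alt :: "nat \<Rightarrow> ('v \<times> 'v \<Rightarrow> real) \<Rightarrow> ('v \<Rightarrow> real) \<Rightarrow> 'v \<Rightarrow> real" where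
  "alt 0 \<epsilon> t = t"
| "alt (Suc j) \<epsilon> t = (\<lambda>u. \<Sum>v | v \<in> V \<and> E v u. \<epsilon> (lab (odd j) v u) * alt j \<epsilon> t v)"

fun alt_coef :: "nat \<Rightarrow> 'v \<Rightarrow> ('v \<times> 'v) set \<Rightarrow> 'v \<Rightarrow> real" where
  "alt_coef 0 w = (\<lambda>S u. of_bool (S = {} \<and> u = w))"
| "alt_coef (Suc j) w = step (odd j) (alt_coef j w)"

definition frob :: "nat \<Rightarrow> ('v \<times> 'v \<Rightarrow> real) \<Rightarrow> real" where
  "frob k \<epsilon> = (\<Sum>w\<in>V. \<Sum>u\<in>V. (alt k \<epsilon> (\<lambda>v. of_bool (v = w)) u)\<^sup>2)"

text \<open>Because the flag alternates, the transpose of one step is the next step. With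
  Cauchy-Schwarz this is log-convexity of the norms.\<close>

lemma alt_Suc_norm:
  "(\<Sum>u\<in>V. (alt (Suc j) \<epsilon> t u)\<^sup>2) = (\<Sum>v\<in>V. alt j \<epsilon> t v * alt (Suc (Suc j)) \<epsilon> t v)"
proof -
  have "(\<Sum>u\<in>V. (alt (Suc j) \<epsilon> t u)\<^sup>2)
      = (\<Sum>u\<in>V. \<Sum>v | v \<in> V \<and> E v u. \<epsilon> (lab (odd j) v u) * alt j \<epsilon> t v * alt (Suc j) \<epsilon> t u)"
    by (simp add: power2_eq_square sum_distrib_right)
  also have "\<dots> = (\<Sum>v\<in>V. \<Sum>u | u \<in> V \<and> E v u. \<epsilon> (lab (odd j) v u) * alt j \<epsilon> t v * alt (Suc j) \<epsilon> t u)"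
    using sum.swap_restrict[OF finV finV, of "\<lambda>u v. \<epsilon> (lab (odd j) v u) * alt j \<epsilon> t v * alt (Suc j) \<epsilon> t u"
        "\<lambda>u v. E v u"] by simp
  also have "\<dots> = (\<Sum>v\<in>V. alt j \<epsilon> t v * alt (Suc (Suc j)) \<epsilon> t v)"
  proof (intro sum.cong refl)
    fix v
    have "(\<Sum>u | u \<in> V \<and> E v u. \<epsilon> (lab (odd j) v u) * alt j \<epsilon> t v * alt (Suc j) \<epsilon> t u)
        = (\<Sum>u | u \<in> V \<and> E u v. alt j \<epsilon> t v * (\<epsilon> (lab (\<not> odd j) u v) * alt (Suc j) \<epsilon> t u))"
      unfolding lab_flip using E_sym by (intro sum.cong) (auto simp del: alt.simps)
    then show "(\<Sum>u | u \<in> V \<and> E v u. \<epsilon> (lab (odd j) v u) * alt j \<epsilon> t v * alt (Suc j) \<epsilon> t u)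
        = alt j \<epsilon> t v * alt (Suc (Suc j)) \<epsilon> t v"
      by (simp only: sum_distrib_left alt.simps(2)[of "Suc j"] even_Suc)
  qed
  finally show ?thesis .
qed

lemma alt_linear:
  "u \<in> V \<Longrightarrow> alt j \<epsilon> t u = (\<Sum>w\<in>V. t w * alt j \<epsilon> (\<lambda>v. of_bool (v = w)) u)"
proof (induction j arbitrary: u)
  case 0
  have "(\<Sum>w\<in>V. t w * of_bool (u = w)) = (\<Sum>w\<in>V. if u = w then t w else 0)"
    by (intro sum.cong) auto
  then show ?case using 0 finV by simp
next
  case (Suc j)
  have "alt (Suc j) \<epsilon> t u = (\<Sum>v | v \<in> V \<and> E v u. \<Sum>w\<in>V. t w * (\<epsilon> (lab (odd j) v u) * alt j \<epsilon> (\<lambda>v. of_bool (v = w)) v))"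
    unfolding alt.simps by (intro sum.cong refl) (simp add: Suc.IH sum_distrib_left mult_ac)
  also have "\<dots> = (\<Sum>w\<in>V. t w * alt (Suc j) \<epsilon> (\<lambda>v. of_bool (v = w)) u)"
    by (subst sum.swap) (simp add: sum_distrib_left)
  finally show ?case .
qed

lemma l2_opnorm_pow_le_frob:
  assumes k: "k \<ge> 1"
  shows "l2_opnorm V (signed_adj E \<epsilon>) ^ (2 * k) \<le> frob k \<epsilon>"
proof -
  have frob0: "frob k \<epsilon> \<ge> 0" unfolding frob_def by (intro sum_nonneg zero_le_power2)
  have *: "L2_set (\<lambda>i. \<Sum>j\<in>V. signed_adj E \<epsilon> i j * t j) V \<le> root (2 * k) (frob k \<epsilon>)" if t: "L2_set t V \<le> 1" for t
  proof -
    define a where "a j = L2_set (alt j \<epsilon> t) V" for j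
    have "(a (Suc j))\<^sup>2 \<le> a j * a (Suc (Suc j))" for j
    proof -
      have "(a (Suc j))\<^sup>2 = (\<Sum>v\<in>V. alt j \<epsilon> t v * alt (Suc (Suc j)) \<epsilon> t v)"
        unfolding a_def L2_set_def alt_Suc_norm[symmetric] by (intro real_sqrt_pow2 sum_nonneg zero_le_power2)
      also have "\<dots> \<le> (\<Sum>v\<in>V. \<bar>alt j \<epsilon> t v\<bar> * \<bar>alt (Suc (Suc j)) \<epsilon> t v\<bar>)"
        by (intro sum_mono) (simp del: alt.simps flip: abs_mult)
      also have "\<dots> \<le> a j * a (Suc (Suc j))" unfolding a_def by (rule L2_set_mult_ineq)
      finally show ?thesis .
    qed
    moreover have "a j \<ge> 0" for j by (simp add: a_def)
    ultimately have "a 1 ^ k \<le> a k" using t k by (intro log_convex_power_le) (auto simp: a_def)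
    then have "(a 1 ^ k)\<^sup>2 \<le> (a k)\<^sup>2" by (intro power_mono) (auto simp: a_def)
    also have "(a k)\<^sup>2 = (\<Sum>u\<in>V. (alt k \<epsilon> t u)\<^sup>2)"
      unfolding a_def L2_set_def by (intro real_sqrt_pow2 sum_nonneg zero_le_power2)
    also have "\<dots> \<le> (\<Sum>u\<in>V. \<Sum>w\<in>V. (alt k \<epsilon> (\<lambda>v. of_bool (v = w)) u)\<^sup>2)"
    proof (rule sum_mono)
      fix u assume u: "u \<in> V"
      have "(alt k \<epsilon> t u)\<^sup>2 \<le> (\<Sum>w\<in>V. (t w)\<^sup>2) * (\<Sum>w\<in>V. (alt k \<epsilon> (\<lambda>v. of_bool (v = w)) u)\<^sup>2)"
        unfolding alt_linear[OF u, of k \<epsilon> t] by (rule Cauchy_Schwarz_ineq_sum)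
      also have "\<dots> \<le> 1 * (\<Sum>w\<in>V. (alt k \<epsilon> (\<lambda>v. of_bool (v = w)) u)\<^sup>2)"
        using t by (intro mult_right_mono sum_nonneg) (auto simp: L2_set_def real_sqrt_le_1_iff)
      finally show "(alt k \<epsilon> t u)\<^sup>2 \<le> (\<Sum>w\<in>V. (alt k \<epsilon> (\<lambda>v. of_bool (v = w)) u)\<^sup>2)" by simp
    qed
    also have "\<dots> = frob k \<epsilon>" unfolding frob_def by (rule sum.swap)
    finally have "a 1 ^ (2 * k) \<le> frob k \<epsilon>" by (simp add: power_mult[symmetric] mult.commute)
    then have "root (2 * k) (a 1 ^ (2 * k)) \<le> root (2 * k) (frob k \<epsilon>)" using k by simp
    then have "a 1 \<le> root (2 * k) (frob k \<epsilon>)" using k by (simp add: real_root_power_cancel a_def)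
    moreover have "a 1 = L2_set (\<lambda>i. \<Sum>j\<in>V. signed_adj E \<epsilon> i j * t j) V"
      unfolding a_def
    proof (rule L2_set_cong[OF refl])
      fix i
      have "(\<Sum>j\<in>V. signed_adj E \<epsilon> i j * t j) = (\<Sum>j\<in>V. if E j i then \<epsilon> (i, j) * t j else 0)"
        using E_sym by (intro sum.cong) (auto simp: signed_adj_def)
      then show "alt 1 \<epsilon> t i = (\<Sum>j\<in>V. signed_adj E \<epsilon> i j * t j)"
        by (simp add: lab_def sum.inter_filter[OF finV])
    qed
    ultimately show ?thesis by simp
  qed
  have "l2_opnorm V (signed_adj E \<epsilon>) \<le> root (2 * k) (frob k \<epsilon>)"
    unfolding l2_opnorm_def by (rule cSUP_least) (use * in \<open>auto intro!: exI[of _ "\<lambda>_. 0"] simp: L2_set_def\<close>)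
  then have "l2_opnorm V (signed_adj E \<epsilon>) ^ (2 * k) \<le> root (2 * k) (frob k \<epsilon>) ^ (2 * k)"
    by (intro power_mono l2_opnorm_nonneg finV)
  then show ?thesis using k frob0 by simp
qed

lemma toggle_Pow: "e \<in> I \<Longrightarrow> S \<subseteq> I \<Longrightarrow> toggle e S \<subseteq> I"
  by (auto simp: toggle_def)

lemma toggle_toggle [simp]: "toggle e (toggle e S) = S"
  by (auto simp: toggle_def)

lemma alt_walsh:
  assumes \<epsilon>: "\<And>e. e \<in> V \<times> V \<Longrightarrow> \<epsilon> e \<in> {-1, 1}" and w: "w \<in> V"
  shows "u \<in> V \<Longrightarrow> alt j \<epsilon> (\<lambda>v. of_bool (v = w)) u
           = (\<Sum>S\<in>Pow (V \<times> V). alt_coef j w S u * walsh S \<epsilon>)"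
proof (induction j arbitrary: u)
  case 0
  have "(\<Sum>S\<in>Pow (V \<times> V). of_bool (S = {} \<and> u = w) * walsh S \<epsilon>)
      = (\<Sum>S\<in>Pow (V \<times> V). if S = {} then of_bool (u = w) else 0)"
    by (intro sum.cong) (auto simp: walsh_def)
  then show ?case using finV by simp
next
  case (Suc j)
  have lab: "lab (odd j) v u \<in> V \<times> V" if "v \<in> V" for v using that Suc.prems by (auto simp: lab_def)
  have "alt (Suc j) \<epsilon> (\<lambda>v. of_bool (v = w)) u
      = (\<Sum>v | v \<in> V \<and> E v u. \<Sum>S\<in>Pow (V \<times> V). alt_coef j w (toggle (lab (odd j) v u) S) v * walsh S \<epsilon>)"
    unfolding alt.simps
  proof (rule sum.cong[OF refl])
    fix v assume "v \<in> {v. v \<in> V \<and> E v u}"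
    then have v: "v \<in> V" by simp
    let ?e = "lab (odd j) v u"
    have "\<epsilon> ?e * alt j \<epsilon> (\<lambda>v. of_bool (v = w)) v
        = (\<Sum>S\<in>Pow (V \<times> V). alt_coef j w S v * (\<epsilon> ?e * walsh S \<epsilon>))"
      by (simp add: Suc.IH[OF v] sum_distrib_left mult_ac)
    also have "\<dots> = (\<Sum>S\<in>Pow (V \<times> V). alt_coef j w S v * walsh (toggle ?e S) \<epsilon>)"
      using \<epsilon>[OF lab[OF v]] finite_edges by (intro sum.cong refl) (simp add: walsh_toggle)
    also have "\<dots> = (\<Sum>S\<in>Pow (V \<times> V). alt_coef j w (toggle ?e S) v * walsh S \<epsilon>)"
      by (rule sum.reindex_bij_witness[where i = "toggle ?e" and j = "toggle ?e"])
         (use toggle_Pow[OF lab[OF v]] in auto)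
    finally show "\<epsilon> ?e * alt j \<epsilon> (\<lambda>v. of_bool (v = w)) v
        = (\<Sum>S\<in>Pow (V \<times> V). alt_coef j w (toggle ?e S) v * walsh S \<epsilon>)" .
  qed
  also have "\<dots> = (\<Sum>S\<in>Pow (V \<times> V). alt_coef (Suc j) w S u * walsh S \<epsilon>)"
    by (subst sum.swap) (simp add: step_def sum_distrib_right)
  finally show ?case .
qed

text \<open>Each step toggles one entry, so \<open>j\<close> steps produce Walsh degree at most
  \<open>j\<close>. This keeps the number of vertices met within reach of supersolutions on small
  subgraphs.\<close>

lemma alt_coef_supp: "finite S \<Longrightarrow> j < card S \<Longrightarrow> alt_coef j w S v = 0"
proof (induction j arbitrary: S v)
  case (Suc j)
  have "finite (toggle e S) \<and> j < card (toggle e S)" for e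
    using Suc.prems by (auto simp: toggle_def)
  then show ?case by (simp add: step_def Suc.IH)
qed auto

lemma normsq_alt_coef_le:
  assumes w: "w \<in> V"
  shows "2 * j \<le> M \<Longrightarrow> normsq (alt_coef j w) \<le> (2 * (sqrt \<Delta> + \<Lambda>)) ^ (2 * j)"
proof (induction j)
  case 0
  have "normsq (alt_coef 0 w) = (\<Sum>v\<in>V. \<Sum>S\<in>Pow (V \<times> V). if S = {} then of_bool (v = w) else 0)"
    unfolding normsq_def by (intro sum.cong) auto
  also have "\<dots> = (\<Sum>v\<in>V. if v = w then 1 else 0)" using finV by (simp add: of_bool_def)
  also have "\<dots> = 1" using w finV by simp
  finally show ?case by simp
next
  case (Suc j)
  have "normsq (alt_coef (Suc j) w) \<le> (2 * (sqrt \<Delta> + \<Lambda>))\<^sup>2 * normsq (alt_coef j w)"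
    unfolding alt_coef.simps by (rule normsq_step_le[where j = j]) (use alt_coef_supp finite_edges Suc in auto)
  also have "\<dots> \<le> (2 * (sqrt \<Delta> + \<Lambda>))\<^sup>2 * (2 * (sqrt \<Delta> + \<Lambda>)) ^ (2 * j)"
    using Suc by (intro mult_left_mono) auto
  also have "\<dots> = (2 * (sqrt \<Delta> + \<Lambda>)) ^ (2 * Suc j)" by (simp add: power_add[symmetric])
  finally show ?case .
qed

text \<open>Parseval turns the expected squared Frobenius norm into a sum of \<open>normsq\<close>
  over the starting vertices \<open>w\<close>, whence the factor \<open>card V\<close>; each step
  costs one squared Schur bound.\<close>

lemma expectation_opnorm_pow_le:
  assumes k: "k \<ge> 1" "2 * k \<le> M"
  shows "measure_pmf.expectation (rademacher (V \<times> V)) (\<lambda>\<epsilon>. l2_opnorm V (signed_adj E \<epsilon>) ^ (2 * k))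
           \<le> real (card V) * (2 * (sqrt \<Delta> + \<Lambda>)) ^ (2 * k)"
proof -
  let ?X = "\<lambda>\<epsilon>. \<Sum>w\<in>V. \<Sum>u\<in>V. (\<Sum>S\<in>Pow (V \<times> V). alt_coef k w S u * walsh S \<epsilon>)\<^sup>2"
  have fin: "finite (V \<times> V)" using finV by simp
  have "measure_pmf.expectation (rademacher (V \<times> V)) (\<lambda>\<epsilon>. l2_opnorm V (signed_adj E \<epsilon>) ^ (2 * k))
      \<le> measure_pmf.expectation (rademacher (V \<times> V)) ?X"
  proof (rule expectation_rademacher_mono[OF fin])
    fix \<epsilon> :: "'v \<times> 'v \<Rightarrow> real" assume "\<And>i. i \<in> V \<times> V \<Longrightarrow> \<epsilon> i \<in> {-1, 1}"
    then have "frob k \<epsilon> = ?X \<epsilon>"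
      unfolding frob_def by (intro sum.cong refl arg_cong[where f = "\<lambda>x. x\<^sup>2"] alt_walsh) auto
    then show "l2_opnorm V (signed_adj E \<epsilon>) ^ (2 * k) \<le> ?X \<epsilon>"
      using l2_opnorm_pow_le_frob[OF k(1), of \<epsilon>] by simp
  qed
  also have "\<dots> = (\<Sum>w\<in>V. normsq (alt_coef k w))"
    unfolding normsq_def using fin
    by (subst Bochner_Integration.integral_sum | simp add: parseval_walsh)+
  also have "\<dots> \<le> (\<Sum>w\<in>V. (2 * (sqrt \<Delta> + \<Lambda>)) ^ (2 * k))"
    by (intro sum_mono normsq_alt_coef_le k)
  finally show ?thesis by simp
qed

lemma expectation_opnorm_powr_le:
  assumes k: "k \<ge> 1" "2 * k \<le> M" and V: "real (card V) \<le> exp (2 * real k)" and p: "1 \<le> p" "p \<le> 2 * real k"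
  defines "a \<equiv> 2 * exp 1 * (sqrt \<Delta> + \<Lambda>)"
  shows "measure_pmf.expectation (rademacher (V \<times> V)) (\<lambda>\<epsilon>. l2_opnorm V (signed_adj E \<epsilon>) powr p) \<le> 2 * a powr p"
proof -
  have a: "a > 0" unfolding a_def using \<Delta> \<Lambda> by (intro mult_pos_pos add_pos_nonneg) auto
  \<comment> \<open>Splitting at the level \<open>a\<close> replaces an interpolation of moments.
    The factor \<open>exp 1\<close> in \<open>a\<close> absorbs the at most
    \<open>exp (2 * k)\<close> vertices into the power \<open>2 * k\<close>.\<close>
  have "x powr p \<le> a powr p + a powr p / a ^ (2 * k) * x ^ (2 * k)" if "x \<ge> 0" for x
  proof (cases "x \<le> a")
    case True
    then have "x powr p \<le> a powr p" using that p by (intro powr_mono2) auto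
    then show ?thesis using a that by (simp add: add_increasing2)
  next
    case False
    then have "(x / a) powr p \<le> (x / a) powr (2 * real k)" using a p by (intro powr_mono) auto
    also have "\<dots> = (x / a) ^ (2 * k)" using False a by (simp flip: powr_realpow)
    finally have "x powr p / a powr p \<le> x ^ (2 * k) / a ^ (2 * k)"
      using False a by (simp add: powr_divide power_divide)
    then have "x powr p \<le> a powr p / a ^ (2 * k) * x ^ (2 * k)" using a by (simp add: field_simps)
    then show ?thesis using powr_ge_zero[of a p] by linarith
  qed
  then have "measure_pmf.expectation (rademacher (V \<times> V)) (\<lambda>\<epsilon>. l2_opnorm V (signed_adj E \<epsilon>) powr p)
      \<le> measure_pmf.expectation (rademacher (V \<times> V)) (\<lambda>\<epsilon>. a powr p + a powr p / a ^ (2 * k) * l2_opnorm V (signed_adj E \<epsilon>) ^ (2 * k))"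
    using finV l2_opnorm_nonneg[OF finV] by (intro expectation_rademacher_mono) auto
  also have "\<dots> = a powr p + a powr p / a ^ (2 * k)
      * measure_pmf.expectation (rademacher (V \<times> V)) (\<lambda>\<epsilon>. l2_opnorm V (signed_adj E \<epsilon>) ^ (2 * k))"
    using finV by simp
  also have "\<dots> \<le> a powr p + a powr p / a ^ (2 * k) * (exp (2 * real k) * (2 * (sqrt \<Delta> + \<Lambda>)) ^ (2 * k))"
    using a \<Delta> \<Lambda> by (intro add_left_mono mult_left_mono order.trans[OF expectation_opnorm_pow_le[OF k]] mult_right_mono V) auto
  also have "exp (2 * real k) * (2 * (sqrt \<Delta> + \<Lambda>)) ^ (2 * k) = a ^ (2 * k)"
    unfolding a_def power_mult_distrib by (simp add: exp_of_nat_mult[symmetric])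
  also have "a powr p + a powr p / a ^ (2 * k) * a ^ (2 * k) = 2 * a powr p" using a by simp
  finally show ?thesis .
qed

lemma expected_signed_norm_le:
  assumes k: "k \<ge> 1" "2 * k \<le> M" and V: "real (card V) \<le> exp (2 * real k)"
  shows "expected_signed_norm V E \<le> 4 * exp 1 * (sqrt \<Delta> + \<Lambda>)"
proof -
  have "expected_signed_norm V E
      = measure_pmf.expectation (rademacher (V \<times> V)) (\<lambda>\<epsilon>. l2_opnorm V (signed_adj E \<epsilon>) powr 1)"
    unfolding expected_signed_norm_def using l2_opnorm_nonneg[OF finV] by simp
  also have "\<dots> \<le> 2 * (2 * exp 1 * (sqrt \<Delta> + \<Lambda>)) powr 1"
    using k by (intro expectation_opnorm_powr_le[OF k V]) auto
  also have "\<dots> = 4 * exp 1 * (sqrt \<Delta> + \<Lambda>)" using \<Delta> \<Lambda> by simp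
  finally show ?thesis .
qed

text \<open>The supremum over \<open>s\<close> and \<open>t\<close> stands outside the expectation,
  and each bilinear form is at most the operator norm, so the moment bound for the latter is
  enough.\<close>

lemma N_eps_le:
  assumes k: "k \<ge> 1" "2 * k \<le> M" and V: "real (card V) \<le> exp (2 * real k)" and p: "1 \<le> p" "p \<le> 2 * real k"
  shows "N_eps p V E \<le> 4 * exp 1 * (sqrt \<Delta> + \<Lambda>)"
proof -
  define a where "a = 2 * exp 1 * (sqrt \<Delta> + \<Lambda>)"
  have a: "a > 0" unfolding a_def using \<Delta> \<Lambda> by (intro mult_pos_pos add_pos_nonneg) auto
  have "Lp_norm (measure_pmf (rademacher (V \<times> V))) p
          (\<lambda>\<epsilon>. \<Sum>(i, j)\<in>V \<times> V. of_bool (E i j) * \<epsilon> (i, j) * s i * t j) \<le> 2 * a"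
    if st: "L2_set s V \<le> 1" "L2_set t V \<le> 1" for s t
  proof -
    have "measure_pmf.expectation (rademacher (V \<times> V))
        (\<lambda>\<epsilon>. \<bar>\<Sum>(i, j)\<in>V \<times> V. of_bool (E i j) * \<epsilon> (i, j) * s i * t j\<bar> powr p)
      \<le> measure_pmf.expectation (rademacher (V \<times> V)) (\<lambda>\<epsilon>. l2_opnorm V (signed_adj E \<epsilon>) powr p)"
      using finV p by (intro expectation_rademacher_mono powr_mono2 bilinear_le_opnorm[OF finV] st) auto
    also have "\<dots> \<le> 2 * a powr p"
      unfolding a_def by (rule expectation_opnorm_powr_le[OF k V p])
    also have "\<dots> \<le> 2 powr p * a powr p"
      using p powr_mono[of 1 p "2::real"] by (intro mult_right_mono) auto
    also have "\<dots> = (2 * a) powr p" using a by (simp add: powr_mult)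
    finally have "Lp_norm (measure_pmf (rademacher (V \<times> V))) p
          (\<lambda>\<epsilon>. \<Sum>(i, j)\<in>V \<times> V. of_bool (E i j) * \<epsilon> (i, j) * s i * t j) \<le> ((2 * a) powr p) powr (1 / p)"
      unfolding Lp_norm_def using p by (intro powr_mono2) auto
    also have "\<dots> = 2 * a" using a p by (simp add: powr_powr)
    finally show ?thesis .
  qed
  then have "N_eps p V E \<le> 2 * a"
    unfolding N_eps_def by (intro cSUP_least) (auto simp: L2_set_def intro!: exI[of _ "\<lambda>_. 0"])
  then show ?thesis by (simp add: a_def)
qed

end

subsection \<open>Positive supersolutions\<close>

text \<open>A truncated Neumann series: \<open>f\<close> sums \<open>B^j 1 / \<mu>^j\<close> over
  \<open>j < card S\<close>, so \<open>B f\<close> equals \<open>\<mu> * (f - 1)\<close> plus a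
  tail, which has to be at most \<open>\<mu>\<close>. It is positive everywhere because it starts
  with 1, whereas a top eigenvector may vanish on components of \<open>S\<close>. The form is
  bounded on nonnegative functions only, as the entropy estimate provides.\<close>

lemma supersolution_exists:
  fixes E :: "'v \<Rightarrow> 'v \<Rightarrow> bool" and \<Lambda> :: real
  assumes fin: "finite S" and sym: "\<And>u v. E u v \<Longrightarrow> E v u" and L: "\<Lambda> > 0"
    and form: "\<And>f. (\<And>v. f v \<ge> 0) \<Longrightarrow> (\<Sum>v\<in>S. \<Sum>u | u \<in> S \<and> E v u. f v * f u) \<le> \<Lambda> * (\<Sum>v\<in>S. (f v)\<^sup>2)"
  shows "\<exists>f. \<forall>v\<in>S. f v > 0 \<and> (\<Sum>u | u \<in> S \<and> E v u. f u) \<le> 2 * \<Lambda> * f v"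
proof -
  define B where "B h v = (\<Sum>u | u \<in> S \<and> E v u. h u)" for h :: "'v \<Rightarrow> real" and v
  have Bform: "(\<Sum>v\<in>S. f v * B f v) \<le> \<Lambda> * (\<Sum>v\<in>S. (f v)\<^sup>2)" if "\<And>v. f v \<ge> 0" for f
    using form[OF that] by (simp add: B_def sum_distrib_left)
  have B0: "B h v \<ge> 0" if "\<And>v. h v \<ge> 0" for h v unfolding B_def using that by (intro sum_nonneg) auto
  have Badj: "(\<Sum>v\<in>S. f v * B g v) = (\<Sum>v\<in>S. B f v * g v)" for f g
  proof -
    have "(\<Sum>v\<in>S. f v * B g v) = (\<Sum>v\<in>S. \<Sum>u | u \<in> S \<and> E v u. f v * g u)"
      by (simp add: B_def sum_distrib_left)
    also have "\<dots> = (\<Sum>u\<in>S. \<Sum>v | v \<in> S \<and> E v u. f v * g u)"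
      by (rule sum.swap_restrict[OF fin fin])
    also have "\<dots> = (\<Sum>u\<in>S. \<Sum>v | v \<in> S \<and> E u v. f v * g u)"
      by (intro sum.cong refl) (use sym in blast)
    finally show ?thesis by (simp add: B_def sum_distrib_right)
  qed
  have Bnorm: "(\<Sum>v\<in>S. (B h v)\<^sup>2) \<le> 2 * \<Lambda>\<^sup>2 * (\<Sum>v\<in>S. (h v)\<^sup>2)" if h: "\<And>v. h v \<ge> 0" for h
  proof -
    define N P Q where "N = (\<Sum>v\<in>S. (h v)\<^sup>2)" and "P = (\<Sum>v\<in>S. h v * B h v)" and "Q = (\<Sum>v\<in>S. (B h v)\<^sup>2)"
    \<comment> \<open>Testing the form on this nonnegative function turns a one-sided bound on the
      form into a bound on the norm of \<open>B\<close>. The lost factor 2 is afforded by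
      \<open>\<mu> = 2 * \<Lambda>\<close>.\<close>
    let ?f = "\<lambda>v. B h v + \<Lambda> * h v"
    have Bf: "B ?f v = B (B h) v + \<Lambda> * B h v" for v
      by (simp add: B_def sum.distrib sum_distrib_left)
    have "(\<Sum>v\<in>S. ?f v * B ?f v) \<le> \<Lambda> * (\<Sum>v\<in>S. (?f v)\<^sup>2)"
      by (rule Bform) (use B0[OF h] h L in auto)
    also have "(\<Sum>v\<in>S. (?f v)\<^sup>2) = Q + 2 * \<Lambda> * P + \<Lambda>\<^sup>2 * N"
      by (simp add: N_def P_def Q_def power2_eq_square algebra_simps sum.distrib sum_distrib_left)
    also have "(\<Sum>v\<in>S. ?f v * B ?f v) = (\<Sum>v\<in>S. B h v * B (B h) v) + \<Lambda> * Q + \<Lambda> * (\<Sum>v\<in>S. h v * B (B h) v) + \<Lambda>\<^sup>2 * P"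
      by (simp add: Bf P_def Q_def power2_eq_square algebra_simps sum.distrib sum_distrib_left)
    also have "(\<Sum>v\<in>S. h v * B (B h) v) = Q" by (simp only: Badj[of h "B h"] Q_def power2_eq_square)
    finally have 1: "(\<Sum>v\<in>S. B h v * B (B h) v) + 2 * (\<Lambda> * Q) + \<Lambda>\<^sup>2 * P \<le> \<Lambda> * Q + 2 * (\<Lambda>\<^sup>2 * P) + \<Lambda> * (\<Lambda>\<^sup>2 * N)"
      by (simp add: algebra_simps power2_eq_square)
    have "(\<Sum>v\<in>S. B h v * B (B h) v) \<ge> 0" using B0[OF h] B0[of "B h"] by (intro sum_nonneg mult_nonneg_nonneg) auto
    moreover have "\<Lambda>\<^sup>2 * P \<le> \<Lambda>\<^sup>2 * (\<Lambda> * N)"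
      unfolding P_def N_def by (intro mult_left_mono Bform h) auto
    ultimately have "\<Lambda> * Q \<le> \<Lambda> * (2 * \<Lambda>\<^sup>2 * N)" using 1 by (simp add: algebra_simps)
    then show ?thesis using L by (simp add: Q_def N_def)
  qed
  define h where "h j = (B ^^ j) (\<lambda>_. 1)" for j
  have h_Suc: "h (Suc j) = B (h j)" for j by (simp add: h_def)
  have h0: "h j v \<ge> 0" for j v
    by (induction j arbitrary: v) (simp add: h_def, simp add: h_Suc B0)
  have hnorm: "(\<Sum>v\<in>S. (h j v)\<^sup>2) \<le> (2 * \<Lambda>\<^sup>2) ^ j * real (card S)" for j
  proof (induction j)
    case 0
    then show ?case by (simp add: h_def)
  next
    case (Suc j)
    have "(\<Sum>v\<in>S. (h (Suc j) v)\<^sup>2) \<le> 2 * \<Lambda>\<^sup>2 * (\<Sum>v\<in>S. (h j v)\<^sup>2)"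
      unfolding h_Suc by (rule Bnorm) (rule h0)
    also have "\<dots> \<le> 2 * \<Lambda>\<^sup>2 * ((2 * \<Lambda>\<^sup>2) ^ j * real (card S))" using Suc by (intro mult_left_mono) auto
    finally show ?case by (simp add: mult_ac)
  qed
  define J where "J = card S"
  define \<mu> where "\<mu> = 2 * \<Lambda>"
  have mu: "\<mu> > 0" using L by (simp add: \<mu>_def)
  define f where "f v = (\<Sum>j<J. h j v / \<mu> ^ j)" for v
  have tail: "h J v \<le> \<mu> ^ J" if v: "v \<in> S" for v
  proof -
    have "(h J v)\<^sup>2 \<le> (\<Sum>v\<in>S. (h J v)\<^sup>2)"
      using v fin by (intro member_le_sum) auto
    also have "\<dots> \<le> (2 * \<Lambda>\<^sup>2) ^ J * real J" using hnorm[of J] by (simp add: J_def)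
    \<comment> \<open>The choice of \<open>card S\<close> as length pays off here: the squared norm
      \<open>J\<close> of the constant 1 fits into the gap between
      \<open>2 * \<Lambda>\<^sup>2\<close> and \<open>\<mu>\<^sup>2\<close>.\<close>
    also have "\<dots> \<le> (2 * \<Lambda>\<^sup>2) ^ J * 2 ^ J"
      by (intro mult_left_mono less_imp_le[OF of_nat_less_two_power]) auto
    also have "\<dots> = (\<mu> ^ J)\<^sup>2"
    proof -
      have "(\<mu> ^ J)\<^sup>2 = (\<mu>\<^sup>2) ^ J" by (simp only: power_mult[symmetric] mult.commute)
      also have "\<mu>\<^sup>2 = 2 * \<Lambda>\<^sup>2 * 2" by (simp add: \<mu>_def power_mult_distrib)
      finally show ?thesis by (simp only: power_mult_distrib)
    qed
    finally show ?thesis using mu by (intro power2_le_imp_le[of "h J v"]) auto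
  qed
  show ?thesis
  proof (intro exI[of _ f] ballI conjI)
    fix v assume v: "v \<in> S"
    then have J: "J > 0" using fin by (auto simp: J_def card_gt_0_iff)
    have split: "f v = 1 + (\<Sum>j\<in>{1..<J}. h j v / \<mu> ^ j)"
      unfolding f_def lessThan_atLeast0 using J by (subst sum.atLeast_Suc_lessThan) (auto simp: h_def)
    have nn: "(\<Sum>j\<in>{1..<J}. h j v / \<mu> ^ j) \<ge> 0" using h0 mu by (intro sum_nonneg) auto
    then show "f v > 0" using split by simp
    have "(\<Sum>u | u \<in> S \<and> E v u. f u) = (\<Sum>j<J. h (Suc j) v / \<mu> ^ j)"
      unfolding f_def h_Suc B_def by (subst sum.swap) (simp add: sum_divide_distrib)
    also have "\<dots> = \<mu> * (\<Sum>j<J. h (Suc j) v / \<mu> ^ Suc j)"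
      using mu by (simp add: sum_distrib_left)
    also have "(\<Sum>j<J. h (Suc j) v / \<mu> ^ Suc j) = (\<Sum>j\<in>{1..<Suc J}. h j v / \<mu> ^ j)"
      unfolding lessThan_atLeast0 using sum.shift_bounds_Suc_ivl[of "\<lambda>j. h j v / \<mu> ^ j" 0 J] by simp
    also have "\<dots> = (\<Sum>j\<in>{1..<J}. h j v / \<mu> ^ j) + h J v / \<mu> ^ J" using J by simp
    also have "\<mu> * \<dots> \<le> \<mu> * f v"
      using tail[OF v] mu split by (intro mult_left_mono) auto
    finally show "(\<Sum>u | u \<in> S \<and> E v u. f u) \<le> 2 * \<Lambda> * f v" by (simp add: \<mu>_def)
  qed
qed

subsection \<open>Upper bounds for the torus\<close>

definition cyc :: "nat \<Rightarrow> nat \<Rightarrow> nat \<Rightarrow> bool" where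
  "cyc m a b \<longleftrightarrow> a \<noteq> b \<and> ([a = b + 1] (mod m) \<or> [b = a + 1] (mod m))"

lemma card_cyc_le:
  assumes "a < m"
  shows "card {b\<in>{..<m}. cyc m a b} \<le> 2"
proof -
  \<comment> \<open>The second element is the cyclic predecessor of \<open>a\<close>. For
    \<open>m = 2\<close> both elements coincide.\<close>
  have "{b\<in>{..<m}. cyc m a b} \<subseteq> {(a + 1) mod m, (a + (m - 1)) mod m}"
  proof
    fix b assume b: "b \<in> {b\<in>{..<m}. cyc m a b}"
    then consider "[a = b + 1] (mod m)" | "[b = a + 1] (mod m)" by (auto simp: cyc_def)
    then show "b \<in> {(a + 1) mod m, (a + (m - 1)) mod m}"
    proof cases
      case 1
      then have a: "a = (b + 1) mod m" using assms by (simp add: cong_def)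
      show ?thesis
      proof (cases "b + 1 < m")
        case True
        then have "a + (m - 1) = b + m" using a by simp
        then show ?thesis using b by simp
      next
        case False
        then have "b + 1 = m" using b by simp
        then show ?thesis using a by auto
      qed
    next
      case 2
      then have "b = (a + 1) mod m" using b by (simp add: cong_def)
      then show ?thesis by blast
    qed
  qed
  then have "card {b\<in>{..<m}. cyc m a b} \<le> card {(a + 1) mod m, (a + (m - 1)) mod m}"
    by (intro card_mono) auto
  also have "\<dots> \<le> 2" by (simp add: card_insert_if)
  finally show ?thesis .
qed

section \<open>Degrees and energies of subgraphs of the torus\<close>

lemma finite_torus_verts [simp]: "finite (torus_verts m d)"
  unfolding torus_verts_def by (intro finite_PiE) auto

lemma card_torus_verts: "card (torus_verts m d) = m ^ d"
  unfolding torus_verts_def by (simp add: card_PiE)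

lemma torus_adj_sym:
  assumes "torus_adj m d x y"
  shows "torus_adj m d y x"
proof -
  have "{l. l < d \<and> y l \<noteq> x l} = {l. l < d \<and> x l \<noteq> y l}" by auto
  then show ?thesis using assms unfolding torus_adj_def by auto
qed

lemma torus_nbrs_subset:
  assumes "x \<in> torus_verts m d"
  shows "{y \<in> torus_verts m d. torus_adj m d x y}
           \<subseteq> (\<lambda>(i, a). x(i := a)) ` (SIGMA i:{..<d}. {a\<in>{..<m}. cyc m (x i) a})"
proof
  fix y assume "y \<in> {y \<in> torus_verts m d. torus_adj m d x y}"
  then have y: "y \<in> torus_verts m d" "torus_adj m d x y" by blast+
  then obtain k where k: "{l. l < d \<and> x l \<noteq> y l} = {k}"
    and c: "[x k = y k + 1] (mod m) \<or> [y k = x k + 1] (mod m)"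
    unfolding torus_adj_def by blast
  have kd: "k < d" "x k \<noteq> y k" using k by blast+
  have eq: "x l = y l" if "l < d" "l \<noteq> k" for l using k that by blast
  have "y l = (x(k := y k)) l" for l
  proof (cases "l < d")
    case True
    then show ?thesis using eq[OF True] by simp
  next
    case False
    then have "x l = undefined" "y l = undefined"
      using assms y(1) by (auto simp: torus_verts_def intro: PiE_arb)
    then show ?thesis using False kd(1) by simp
  qed
  then have "y = x(k := y k)" by (rule ext)
  moreover have "y k < m" using y(1) kd(1) PiE_mem[of y "{..<d}" "\<lambda>_. {..<m}" k]
    by (simp add: torus_verts_def)
  then have "(k, y k) \<in> (SIGMA i:{..<d}. {a\<in>{..<m}. cyc m (x i) a})"
    using kd c by (simp add: cyc_def)
  ultimately show "y \<in> (\<lambda>(i, a). x(i := a)) ` (SIGMA i:{..<d}. {a\<in>{..<m}. cyc m (x i) a})"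
    by (metis (no_types, lifting) case_prod_conv image_eqI)
qed

lemma torus_degree_le:
  assumes "x \<in> torus_verts m d"
  shows "card {y. y \<in> torus_verts m d \<and> torus_adj m d x y} \<le> 2 * d"
proof -
  let ?S = "SIGMA i:{..<d}. {a\<in>{..<m}. cyc m (x i) a}"
  have "card {y. y \<in> torus_verts m d \<and> torus_adj m d x y} \<le> card ((\<lambda>(i, a). x(i := a)) ` ?S)"
    using torus_nbrs_subset[OF assms] by (intro card_mono) auto
  also have "\<dots> \<le> card ?S" by (intro card_image_le) auto
  also have "\<dots> = (\<Sum>i<d. card {a\<in>{..<m}. cyc m (x i) a})" by (simp add: card_SigmaI)
  also have "\<dots> \<le> (\<Sum>i<d. 2)"
    using assms by (intro sum_mono card_cyc_le) (auto simp: torus_verts_def)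
  finally show ?thesis by simp
qed

lemma torus_energy_le:
  fixes f :: "(nat \<Rightarrow> nat) \<Rightarrow> real" and w L :: real
  assumes S: "S \<subseteq> torus_verts m d" and f: "\<And>x. f x \<ge> 0" and w: "w \<ge> 1"
    and L: "real (card S) \<le> L" "L > 0"
  shows "(\<Sum>x\<in>S. \<Sum>y | y \<in> S \<and> torus_adj m d x y. f x * f y)
           \<le> (4 * real d / w + 12 * w / (1 + ln w) * ln L) * (\<Sum>x\<in>S. (f x)\<^sup>2)"
proof -
  let ?V = "torus_verts m d" and ?\<beta> = "12 * w / (1 + ln w)"
  \<comment> \<open>Tensorisation needs a product domain, so \<open>f\<close> is extended by zero;
    the subgraph survives only as the size of the support, through \<open>ln L\<close>.\<close>
  define g where "g x = (if x \<in> S then f x else 0)" for x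
  have g0: "g x \<ge> 0" for x using f by (simp add: g_def)
  have \<beta>: "?\<beta> \<ge> 0" using w by simp
  have sq: "(\<Sum>x\<in>?V. (g x)\<^sup>2) = (\<Sum>x\<in>S. (f x)\<^sup>2)"
    using S by (intro sum.mono_neutral_cong_right) (auto simp: g_def)
  have "(\<Sum>x\<in>S. \<Sum>y | y \<in> S \<and> torus_adj m d x y. f x * f y)
      \<le> (\<Sum>x\<in>S. \<Sum>i<d. \<Sum>a | a \<in> {..<m} \<and> cyc m (x i) a. g x * g (x(i := a)))"
  proof (rule sum_mono)
    fix x assume x: "x \<in> S"
    let ?D = "SIGMA i:{..<d}. {a\<in>{..<m}. cyc m (x i) a}" and ?h = "\<lambda>(i, a). x(i := a)"
    have "(\<Sum>y | y \<in> S \<and> torus_adj m d x y. f x * f y) = (\<Sum>y | y \<in> S \<and> torus_adj m d x y. g x * g y)"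
      using x by (intro sum.cong) (auto simp: g_def)
    also have "\<dots> \<le> (\<Sum>y\<in>?h ` ?D. g x * g y)"
      using torus_nbrs_subset[of x m d] S x g0 by (intro sum_mono2) auto
    also have "\<dots> \<le> (\<Sum>p\<in>?D. g x * g (?h p))"
      using sum_image_le[of ?D "\<lambda>y. g x * g y" ?h] g0 by (simp add: o_def)
    also have "\<dots> = (\<Sum>i<d. \<Sum>a | a \<in> {..<m} \<and> cyc m (x i) a. g x * g (x(i := a)))"
      by (subst sum.Sigma) (auto intro!: sum.cong)
    finally show "(\<Sum>y | y \<in> S \<and> torus_adj m d x y. f x * f y)
      \<le> (\<Sum>i<d. \<Sum>a | a \<in> {..<m} \<and> cyc m (x i) a. g x * g (x(i := a)))" .
  qed
  also have "\<dots> \<le> (\<Sum>x\<in>?V. \<Sum>i<d. \<Sum>a | a \<in> {..<m} \<and> cyc m (x i) a. g x * g (x(i := a)))"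
    using S g0 by (intro sum_mono2 sum_nonneg) auto
  also have "\<dots> = (\<Sum>i<d. \<Sum>x\<in>?V. \<Sum>a | a \<in> {..<m} \<and> cyc m (x i) a. g x * g (x(i := a)))"
    by (rule sum.swap)
  also have "\<dots> \<le> card {..<d} * (4 / w) * (\<Sum>x\<in>?V. (g x)\<^sup>2) + ?\<beta> * mass_entropy ?V (\<lambda>x. (g x)\<^sup>2)"
    unfolding torus_verts_def
  proof (rule energy_tensorization)
    fix h :: "nat \<Rightarrow> real" assume h: "\<And>a. h a \<ge> 0"
    show "(\<Sum>a<m. \<Sum>b | b \<in> {..<m} \<and> cyc m a b. h a * h b)
        \<le> 4 / w * (\<Sum>a<m. (h a)\<^sup>2) + ?\<beta> * mass_entropy {..<m} (\<lambda>a. (h a)\<^sup>2)"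
      by (rule degree_two_energy) (use h w card_cyc_le in \<open>auto simp: cyc_def\<close>)
  qed (use \<beta> g0 in auto)
  also have "\<dots> \<le> card {..<d} * (4 / w) * (\<Sum>x\<in>?V. (g x)\<^sup>2) + ?\<beta> * ((\<Sum>x\<in>?V. (g x)\<^sup>2) * ln L)"
    by (intro add_left_mono mult_left_mono \<beta> mass_entropy_le_ln[of _ _ S])
       (use S L in \<open>auto simp: g_def\<close>)
  finally show ?thesis unfolding sq distrib_right by (simp add: mult_ac)
qed

text \<open>If \<open>\<rho>\<close> is comparable to \<open>d\<close>, the degree bound suffices
  and a constant function works. Otherwise \<open>w = sqrt (d / \<rho>)\<close> balances the energy
  estimate, both \<open>d / w\<close> and \<open>w * \<rho>\<close> being
  \<open>sqrt (\<rho> * d)\<close>, and the bound on \<open>ln (2 * k)\<close> cancels the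
  denominator \<open>1 + ln w\<close>. The form constant is 4 + 144 = 148, doubled by
  \<open>supersolution_exists\<close>.\<close>

lemma torus_supersolution:
  fixes \<rho> k :: nat
  assumes \<rho>: "\<rho> \<ge> 1" "\<rho> \<le> d" and k: "k \<ge> 1"
    and sparse: "d \<le> 9 * \<rho> \<or> ln (2 * real k) \<le> 6 * \<rho> * (1 + ln (d / \<rho>))"
    and S: "S \<subseteq> torus_verts m d" "card S \<le> 2 * k"
  shows "\<exists>f. \<forall>x\<in>S. f x > 0 \<and>
           (\<Sum>y | y \<in> S \<and> torus_adj m d x y. f y) \<le> 296 * sqrt (real \<rho> * real d) * f x"
proof -
  have finS: "finite S" using S(1) by (rule finite_subset) simp
  from sparse show ?thesis
  proof
    assume "d \<le> 9 * \<rho>"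
    then have "real d \<le> 9 * real \<rho>" by linarith
    then have "real d * real d \<le> 9 * \<rho> * real d" by (intro mult_right_mono) auto
    then have "sqrt (real d * real d) \<le> sqrt (9 * (\<rho> * real d))"
      by (intro real_sqrt_le_mono) (simp only: mult.assoc)
    then have "real d \<le> 3 * sqrt (\<rho> * real d)" by (simp add: real_sqrt_mult)
    then have d: "2 * real d \<le> 296 * sqrt (real \<rho> * real d)" by simp
    show ?thesis
    proof (intro exI[of _ "\<lambda>_. 1"] ballI conjI)
      fix x assume x: "x \<in> S"
      have "card {y. y \<in> S \<and> torus_adj m d x y} \<le> card {y. y \<in> torus_verts m d \<and> torus_adj m d x y}"
        using S by (intro card_mono) auto
      also have "\<dots> \<le> 2 * d" using x S by (intro torus_degree_le) auto
      finally have "real (card {y. y \<in> S \<and> torus_adj m d x y}) \<le> 2 * real d" by linarith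
      then show "(\<Sum>y | y \<in> S \<and> torus_adj m d x y. 1) \<le> 296 * sqrt (real \<rho> * real d) * 1" using d by simp
    qed simp
  next
    assume lnk: "ln (2 * real k) \<le> 6 * \<rho> * (1 + ln (d / \<rho>))"
    define w where "w = sqrt (d / \<rho>)"
    have w: "w \<ge> 1" using \<rho> by (simp add: w_def)
    have lnw: "ln (real d / \<rho>) = 2 * ln w" using \<rho> by (simp add: w_def ln_sqrt)
    have w1: "real d / w = sqrt (real \<rho> * real d)" "w * real \<rho> = sqrt (real \<rho> * real d)"
    proof -
      define x y where "x = sqrt d" and "y = sqrt \<rho>"
      have xy: "x > 0" "y > 0" "real d = x * x" "real \<rho> = y * y" using \<rho> by (simp_all add: x_def y_def)
      have "w = x / y" by (simp add: w_def x_def y_def real_sqrt_divide)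
      moreover have "sqrt (real \<rho> * real d) = y * x" by (simp add: x_def y_def real_sqrt_mult)
      ultimately show "real d / w = sqrt (real \<rho> * real d)" "w * real \<rho> = sqrt (real \<rho> * real d)"
        using xy by simp_all
    qed
    have lw: "ln w \<ge> 0" using w by simp
    have "12 * w / (1 + ln w) * ln (2 * real k) \<le> 12 * w / (1 + ln w) * (12 * \<rho> * (1 + ln w))"
    proof (rule mult_left_mono)
      have "6 * \<rho> * (1 + ln (d / \<rho>)) \<le> 12 * \<rho> * (1 + ln w)"
        unfolding lnw using lw by (simp add: algebra_simps)
      then show "ln (2 * real k) \<le> 12 * \<rho> * (1 + ln w)" using lnk by linarith
    qed (use lw w in simp)
    also have "\<dots> = 144 * (w * \<rho>)" using lw by (simp add: add_nonneg_eq_0_iff field_simps)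
    finally have bound: "4 * real d / w + 12 * w / (1 + ln w) * ln (2 * real k) \<le> 148 * sqrt (real \<rho> * real d)"
      using w1 by simp
    have "\<exists>f. \<forall>x\<in>S. f x > 0 \<and>
           (\<Sum>y | y \<in> S \<and> torus_adj m d x y. f y) \<le> 2 * (148 * sqrt (real \<rho> * real d)) * f x"
    proof (rule supersolution_exists[OF finS])
      fix f :: "(nat \<Rightarrow> nat) \<Rightarrow> real" assume f: "\<And>v. f v \<ge> 0"
      have "(\<Sum>x\<in>S. \<Sum>y | y \<in> S \<and> torus_adj m d x y. f x * f y)
          \<le> (4 * real d / w + 12 * w / (1 + ln w) * ln (2 * real k)) * (\<Sum>x\<in>S. (f x)\<^sup>2)"
        by (rule torus_energy_le) (use S f w k in auto)
      also have "\<dots> \<le> 148 * sqrt (real \<rho> * real d) * (\<Sum>x\<in>S. (f x)\<^sup>2)"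
        by (intro mult_right_mono bound sum_nonneg) auto
      finally show "(\<Sum>x\<in>S. \<Sum>y | y \<in> S \<and> torus_adj m d x y. f x * f y)
          \<le> 148 * sqrt (real \<rho> * real d) * (\<Sum>x\<in>S. (f x)\<^sup>2)" .
    qed (use \<rho> in \<open>auto intro: torus_adj_sym\<close>)
    then show ?thesis by simp
  qed
qed

text \<open>The side \<open>m\<close> enters only through the number of vertices, so torus and
  hypercube may share \<open>\<rho>\<close> and \<open>k\<close>. The degree term is at most
  \<open>2 * sqrt (\<rho> * d)\<close>, which turns 296 into 298.\<close>

lemma torus_upper:
  fixes \<rho> k :: nat
  assumes \<rho>: "\<rho> \<ge> 1" "\<rho> \<le> d" and k: "k \<ge> 1"
    and sparse: "d \<le> 9 * \<rho> \<or> ln (2 * real k) \<le> 6 * \<rho> * (1 + ln (d / \<rho>))"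
    and V: "real (m ^ d) \<le> exp (2 * real k)"
  shows "expected_signed_norm (torus_verts m d) (torus_adj m d) \<le> 4 * exp 1 * (298 * sqrt (real \<rho> * real d))"
    and "1 \<le> p \<Longrightarrow> p \<le> 2 * real k \<Longrightarrow>
           N_eps p (torus_verts m d) (torus_adj m d) \<le> 4 * exp 1 * (298 * sqrt (real \<rho> * real d))"
proof -
  let ?V = "torus_verts m d" and ?\<Lambda> = "296 * sqrt (real \<rho> * real d)"
  define F where "F S = (SOME f :: (nat \<Rightarrow> nat) \<Rightarrow> real. \<forall>x\<in>S. f x > 0 \<and>
           (\<Sum>y | y \<in> S \<and> torus_adj m d x y. f y) \<le> ?\<Lambda> * f x)" for S
  have F: "\<forall>x\<in>S. F S x > 0 \<and> (\<Sum>y | y \<in> S \<and> torus_adj m d x y. F S y) \<le> ?\<Lambda> * F S x"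
    if "S \<subseteq> ?V" "card S \<le> 2 * k" for S
    using someI_ex[OF torus_supersolution[OF \<rho> k sparse that]] unfolding F_def .
  interpret locally_sparse_graph ?V "torus_adj m d" "2 * real d" ?\<Lambda> "2 * k" F
  proof
    fix v assume "v \<in> ?V"
    then show "real (card {u. u \<in> ?V \<and> torus_adj m d v u}) \<le> 2 * real d"
      using torus_degree_le[of v m d] by linarith
  qed (use F \<rho> in \<open>auto intro: torus_adj_sym\<close>)
  have "sqrt (2 * real d) \<le> sqrt (4 * (\<rho> * real d))"
    using \<rho> mult_right_mono[of 1 "real \<rho>" "real d"] by simp
  then have "sqrt (2 * real d) + ?\<Lambda> \<le> 298 * sqrt (real \<rho> * real d)" by (simp add: real_sqrt_mult)
  then have *: "4 * exp 1 * (sqrt (2 * real d) + ?\<Lambda>) \<le> 4 * exp 1 * (298 * sqrt (real \<rho> * real d))"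
    by (intro mult_left_mono) auto
  show "expected_signed_norm ?V (torus_adj m d) \<le> 4 * exp 1 * (298 * sqrt (real \<rho> * real d))"
    using V by (intro order.trans[OF expected_signed_norm_le[OF k order.refl] *]) (simp add: card_torus_verts)
  show "N_eps p ?V (torus_adj m d) \<le> 4 * exp 1 * (298 * sqrt (real \<rho> * real d))"
    if "1 \<le> p" "p \<le> 2 * real k"
    using V by (intro order.trans[OF N_eps_le[OF k order.refl _ that] *]) (simp add: card_torus_verts)
qed

subsection \<open>Planted configurations\<close>

text \<open>For signs, each product is a power of 2 times the indicator that all signs of the set
  are positive. A factor common to both sets has mean 2, every other one mean 1.\<close>

lemma expectation_prod_one_plus:
  assumes "finite I" "A \<subseteq> I" "B \<subseteq> I"
  shows "measure_pmf.expectation (rademacher I) (\<lambda>\<epsilon>. (\<Prod>i\<in>A. 1 + \<epsilon> i) * (\<Prod>i\<in>B. 1 + \<epsilon> i))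
           = 2 ^ card (A \<inter> B)"
proof -
  define g :: "'a \<Rightarrow> real \<Rightarrow> real" where
    "g i x = (if i \<in> A then 1 + x else 1) * (if i \<in> B then 1 + x else 1)" for i x
  have "(\<Prod>i\<in>C. 1 + \<epsilon> i) = (\<Prod>i\<in>I. if i \<in> C then 1 + \<epsilon> i else 1)" if "C \<subseteq> I" for C and \<epsilon> :: "'a \<Rightarrow> real"
    using prod.inter_restrict[OF assms(1), of "\<lambda>i. 1 + \<epsilon> i" C] that by (simp add: Int_absorb1)
  then have "(\<Prod>i\<in>A. 1 + \<epsilon> i) * (\<Prod>i\<in>B. 1 + \<epsilon> i) = (\<Prod>i\<in>I. g i (\<epsilon> i))" for \<epsilon>
    using assms(2,3) by (simp add: prod.distrib g_def)
  then have "measure_pmf.expectation (rademacher I) (\<lambda>\<epsilon>. (\<Prod>i\<in>A. 1 + \<epsilon> i) * (\<Prod>i\<in>B. 1 + \<epsilon> i))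
      = (\<Prod>i\<in>I. (g i 1 + g i (-1)) / 2)"
    using expectation_rademacher_prod[OF assms(1), of g] by simp
  also have "\<dots> = (\<Prod>i\<in>I. if i \<in> A \<inter> B then 2 else 1)"
    by (intro prod.cong) (auto simp: g_def)
  also have "\<dots> = (\<Prod>i\<in>I \<inter> (A \<inter> B). 2)" by (rule prod.inter_restrict[OF assms(1), symmetric])
  also have "I \<inter> (A \<inter> B) = A \<inter> B" using assms(2) by blast
  finally show ?thesis by simp
qed

lemma prod_one_plus_sign:
  fixes \<epsilon> :: "'i \<Rightarrow> real"
  assumes "finite D" "\<And>i. i \<in> D \<Longrightarrow> \<epsilon> i \<in> {-1, 1}"
  shows "(\<Prod>i\<in>D. 1 + \<epsilon> i) = 2 ^ card D * of_bool (\<forall>i\<in>D. \<epsilon> i = 1)"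
proof (cases "\<forall>i\<in>D. \<epsilon> i = 1")
  case False
  then obtain i where "i \<in> D" "1 + \<epsilon> i = 0" using assms(2) by force
  then show ?thesis using False assms(1) by (auto intro: prod_zero)
qed auto

text \<open>A second moment argument: \<open>F\<close> averages the normalised indicators of
  independent planting events, so it has mean 1, and second moment at most 2 once there are
  \<open>2 ^ e\<close> copies. Since \<open>F - F\<^sup>2 / 4\<close> is at most 1 and vanishes if
  nothing is planted, its mean, at least 1/2, gives the bound directly.\<close>

lemma planted_expected_norm_ge:
  fixes D :: "'u \<Rightarrow> ('v \<times> 'v) set" and Q :: real
  assumes finV: "finite V" and U: "finite U" and D: "\<And>u. u \<in> U \<Longrightarrow> D u \<subseteq> V \<times> V" "\<And>u. u \<in> U \<Longrightarrow> card (D u) = e"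
    and disj: "\<And>u u'. u \<in> U \<Longrightarrow> u' \<in> U \<Longrightarrow> u \<noteq> u' \<Longrightarrow> D u \<inter> D u' = {}"
    and many: "2 ^ e \<le> card U" and Q: "Q \<ge> 0"
    and large: "\<And>u \<epsilon>. u \<in> U \<Longrightarrow> (\<And>x. x \<in> D u \<Longrightarrow> \<epsilon> x = 1) \<Longrightarrow> Q \<le> l2_opnorm V (signed_adj E \<epsilon>)"
  shows "Q / 2 \<le> expected_signed_norm V E"
proof -
  let ?I = "V \<times> V"
  have finI: "finite ?I" using finV by simp
  define K where "K = real (card U)"
  have "card U > 0" using many by (auto intro: gr0I)
  then have K: "K > 0" by (simp add: K_def)
  define f where "f u \<epsilon> = (\<Prod>x\<in>D u. 1 + \<epsilon> x)" for u and \<epsilon> :: "'v \<times> 'v \<Rightarrow> real"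
  define F where "F \<epsilon> = (\<Sum>u\<in>U. f u \<epsilon>) / K" for \<epsilon>
  let ?E = "measure_pmf.expectation (rademacher ?I)"
  have EF: "?E F = 1"
  proof -
    have "?E (f u) = 1" if "u \<in> U" for u
      using expectation_prod_one_plus[OF finI D(1)[OF that], of "{}"] by (simp add: f_def[abs_def])
    then have "?E F = (\<Sum>u\<in>U. 1) / K"
      unfolding F_def using finI by (simp add: Bochner_Integration.integral_sum)
    then show ?thesis using K by (simp add: K_def)
  qed
  have EF2: "?E (\<lambda>\<epsilon>. (F \<epsilon>)\<^sup>2) \<le> 2"
  proof -
    have *: "?E (\<lambda>\<epsilon>. f u \<epsilon> * f u' \<epsilon>) \<le> (if u = u' then 2 ^ e else 0) + 1" if "u \<in> U" "u' \<in> U" for u u'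
      unfolding f_def using expectation_prod_one_plus[OF finI D(1)[OF that(1)] D(1)[OF that(2)]] that disj D(2)
      by auto
    have "(F \<epsilon>)\<^sup>2 = (\<Sum>u\<in>U. \<Sum>u'\<in>U. f u \<epsilon> * f u' \<epsilon>) / K\<^sup>2" for \<epsilon>
      by (simp add: F_def power_divide power2_eq_square sum_product)
    then have "?E (\<lambda>\<epsilon>. (F \<epsilon>)\<^sup>2) = (\<Sum>u\<in>U. \<Sum>u'\<in>U. ?E (\<lambda>\<epsilon>. f u \<epsilon> * f u' \<epsilon>)) / K\<^sup>2"
      using finI by (simp add: Bochner_Integration.integral_sum)
    also have "\<dots> \<le> (\<Sum>u\<in>U. \<Sum>u'\<in>U. (if u = u' then 2 ^ e else 0) + 1) / K\<^sup>2"
      by (intro divide_right_mono sum_mono *) auto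
    also have "(\<Sum>u\<in>U. \<Sum>u'\<in>U. (if u = u' then 2 ^ e else 0) + 1) = K * 2 ^ e + K * K"
      using U by (simp add: sum.distrib K_def distrib_left)
    also have "\<dots> \<le> K * K + K * K"
    proof -
      have "real (2 ^ e) \<le> K" using many unfolding K_def by (rule of_nat_mono)
      then show ?thesis using K by (intro add_right_mono mult_left_mono) auto
    qed
    finally show ?thesis using K by (simp add: power2_eq_square divide_right_mono)
  qed
  have "Q / 2 \<le> Q * (?E F - ?E (\<lambda>\<epsilon>. (F \<epsilon>)\<^sup>2) / 4)"
    using EF EF2 Q mult_left_mono[of "1 / 2" "?E F - ?E (\<lambda>\<epsilon>. (F \<epsilon>)\<^sup>2) / 4" Q] by simp
  also have "\<dots> = ?E (\<lambda>\<epsilon>. Q * (F \<epsilon> - (F \<epsilon>)\<^sup>2 / 4))" using finI by simp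
  also have "\<dots> \<le> expected_signed_norm V E"
    unfolding expected_signed_norm_def
  proof (rule expectation_rademacher_mono[OF finI])
    fix \<epsilon> :: "'v \<times> 'v \<Rightarrow> real" assume \<epsilon>: "\<And>i. i \<in> ?I \<Longrightarrow> \<epsilon> i \<in> {-1, 1}"
    show "Q * (F \<epsilon> - (F \<epsilon>)\<^sup>2 / 4) \<le> l2_opnorm V (signed_adj E \<epsilon>)"
    proof (cases "\<exists>u\<in>U. \<forall>x\<in>D u. \<epsilon> x = 1")
      case True
      have "F \<epsilon> - (F \<epsilon>)\<^sup>2 / 4 \<le> 1"
        using zero_le_power2[of "F \<epsilon> - 2"] by (simp add: power2_eq_square algebra_simps)
      then have "Q * (F \<epsilon> - (F \<epsilon>)\<^sup>2 / 4) \<le> Q * 1" using Q by (intro mult_left_mono)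
      then show ?thesis using True large[of _ \<epsilon>] by fastforce
    next
      case False
      have "f u \<epsilon> = 0" if u: "u \<in> U" for u
      proof -
        have "finite (D u)" using finite_subset[OF D(1)[OF u] finI] .
        moreover have "\<epsilon> i \<in> {-1, 1}" if "i \<in> D u" for i using \<epsilon> D(1)[OF u] that by blast
        moreover have "\<not> (\<forall>i\<in>D u. \<epsilon> i = 1)" using False u by blast
        ultimately show ?thesis unfolding f_def by (subst prod_one_plus_sign) simp_all
      qed
      then have "F \<epsilon> = 0" by (simp add: F_def)
      then show ?thesis using l2_opnorm_nonneg[OF finV] by simp
    qed
  qed
  finally show ?thesis .
qed

text \<open>The test vectors are normalised indicators, which for a biregular bipartite graph, such
  as two adjacent cube layers, are top singular vectors.\<close>

lemma planted_bilinear: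
  fixes X Y :: "'v set"
  assumes finV: "finite V" and XY: "X \<subseteq> V" "Y \<subseteq> V" "X \<noteq> {}" "Y \<noteq> {}"
    and D: "D = {(i, j) \<in> X \<times> Y. E i j}" and \<epsilon>: "\<And>x. x \<in> D \<Longrightarrow> \<epsilon> x = 1"
  defines "s \<equiv> \<lambda>i. of_bool (i \<in> X) / sqrt (card X)" and "t \<equiv> \<lambda>j. of_bool (j \<in> Y) / sqrt (card Y)"
  shows "(\<Sum>(i, j)\<in>V \<times> V. of_bool (E i j) * \<epsilon> (i, j) * s i * t j) = card D / sqrt (card X * card Y)"
proof -
  have "(\<Sum>(i, j)\<in>V \<times> V. of_bool (E i j) * \<epsilon> (i, j) * s i * t j) = (\<Sum>(i, j)\<in>D. 1 / sqrt (card X * card Y))"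
  proof (rule sum.mono_neutral_cong_right)
    show "finite (V \<times> V)" using finV by simp
    show "D \<subseteq> V \<times> V" using D XY by auto
    show "\<forall>x\<in>V \<times> V - D. (case x of (i, j) \<Rightarrow> of_bool (E i j) * \<epsilon> (i, j) * s i * t j) = 0"
      by (auto simp: D s_def t_def)
    show "(case x of (i, j) \<Rightarrow> of_bool (E i j) * \<epsilon> (i, j) * s i * t j) = (case x of (i, j) \<Rightarrow> 1 / sqrt (card X * card Y))"
      if "x \<in> D" for x
      using that \<epsilon>[OF that] by (auto simp: D s_def t_def real_sqrt_mult)
  qed
  then show ?thesis by (simp add: case_prod_unfold)
qed

lemma L2_set_normalized_indicator:
  assumes "finite V" "X \<subseteq> V" "X \<noteq> {}"
  shows "L2_set (\<lambda>i. of_bool (i \<in> X) / sqrt (card X)) V = 1"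
proof -
  have X: "card X > 0" using assms finite_subset by (auto simp: card_gt_0_iff)
  have "(\<Sum>i\<in>V. (of_bool (i \<in> X) / sqrt (card X))\<^sup>2) = (\<Sum>i\<in>X. 1 / card X)"
    using assms by (intro sum.mono_neutral_cong_right) (auto simp: power_divide)
  then show ?thesis using X by (simp add: L2_set_def)
qed

text \<open>A single configuration suffices: it has probability \<open>2 ^ (- card D)\<close>, and
  the p-th root reduces this to a constant as long as \<open>card D\<close> is of order
  \<open>p\<close>.\<close>

lemma N_eps_planted_ge:
  fixes X Y :: "'v set"
  assumes finV: "finite V" and XY: "X \<subseteq> V" "Y \<subseteq> V" "X \<noteq> {}" "Y \<noteq> {}"
    and D: "D = {(i, j) \<in> X \<times> Y. E i j}" and p: "p > 0"
  shows "card D / sqrt (card X * card Y) * 2 powr (- (card D / p)) \<le> N_eps p V E"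
proof -
  let ?s = "\<lambda>i. of_bool (i \<in> X) / sqrt (card X)" and ?t = "\<lambda>j. of_bool (j \<in> Y) / sqrt (card Y)"
  let ?S = "\<lambda>\<epsilon>. \<Sum>(i, j)\<in>V \<times> V. of_bool (E i j) * \<epsilon> (i, j) * ?s i * ?t j"
  define Q where "Q = card D / sqrt (card X * card Y)"
  have Q: "Q \<ge> 0" by (simp add: Q_def)
  have finI: "finite (V \<times> V)" using finV by simp
  have DI: "D \<subseteq> V \<times> V" using D XY by auto
  have finD: "finite D" using finite_subset[OF DI finI] .
  have "Q powr p / 2 ^ card D
      = measure_pmf.expectation (rademacher (V \<times> V)) (\<lambda>\<epsilon>. Q powr p / 2 ^ card D * (\<Prod>x\<in>D. 1 + \<epsilon> x))"
    using expectation_prod_one_plus[OF finI DI, of "{}"] by simp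
  also have "\<dots> \<le> measure_pmf.expectation (rademacher (V \<times> V)) (\<lambda>\<epsilon>. \<bar>?S \<epsilon>\<bar> powr p)"
  proof (rule expectation_rademacher_mono[OF finI])
    fix \<epsilon> :: "'v \<times> 'v \<Rightarrow> real" assume \<epsilon>: "\<And>i. i \<in> V \<times> V \<Longrightarrow> \<epsilon> i \<in> {-1, 1}"
    have *: "(\<Prod>x\<in>D. 1 + \<epsilon> x) = 2 ^ card D * of_bool (\<forall>x\<in>D. \<epsilon> x = 1)"
      using finD \<epsilon> DI by (intro prod_one_plus_sign) auto
    show "Q powr p / 2 ^ card D * (\<Prod>x\<in>D. 1 + \<epsilon> x) \<le> \<bar>?S \<epsilon>\<bar> powr p"
    proof (cases "\<forall>x\<in>D. \<epsilon> x = 1")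
      case True
      then have "?S \<epsilon> = Q" unfolding Q_def by (intro planted_bilinear[OF finV XY D]) auto
      then show ?thesis using True Q unfolding * by simp
    next
      case False
      then have "(\<Prod>x\<in>D. 1 + \<epsilon> x) = 0" unfolding * by auto
      then show ?thesis by simp
    qed
  qed
  finally have "(Q powr p / 2 ^ card D) powr (1 / p) \<le> Lp_norm (measure_pmf (rademacher (V \<times> V))) p ?S"
    unfolding Lp_norm_def using p by (intro powr_mono2) auto
  also have "\<dots> \<le> N_eps p V E"
    unfolding N_eps_def
  proof (rule cSUP_upper2[OF bdd_above_N_eps[OF finV p], where x = "(?s, ?t)"])
    show "(?s, ?t) \<in> {(s, t). L2_set s V \<le> 1 \<and> L2_set t V \<le> 1}"
      using L2_set_normalized_indicator[OF finV] XY by simp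
  qed (simp only: prod.case)
  also have "(Q powr p / 2 ^ card D) powr (1 / p) = Q * 2 powr (- (card D / p))"
  proof -
    have "Q powr p / 2 ^ card D = Q powr p * 2 powr (- real (card D))"
      by (simp add: powr_minus powr_realpow divide_inverse)
    then have "(Q powr p / 2 ^ card D) powr (1 / p) = (Q powr p) powr (1 / p) * (2 powr (- real (card D))) powr (1 / p)"
      by (simp add: powr_mult)
    then show ?thesis using Q p by (simp add: powr_powr)
  qed
  finally show ?thesis by (simp add: Q_def)
qed

lemma opnorm_planted_ge:
  assumes finV: "finite V" and XY: "X \<subseteq> V" "Y \<subseteq> V" "X \<noteq> {}" "Y \<noteq> {}"
    and D: "D = {(i, j) \<in> X \<times> Y. E i j}" and \<epsilon>: "\<And>x. x \<in> D \<Longrightarrow> \<epsilon> x = 1"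
  shows "card D / sqrt (card X * card Y) \<le> l2_opnorm V (signed_adj E \<epsilon>)"
proof -
  let ?s = "\<lambda>i. of_bool (i \<in> X) / sqrt (card X)" and ?t = "\<lambda>j. of_bool (j \<in> Y) / sqrt (card Y)"
  have "card D / sqrt (card X * card Y) = (\<Sum>(i, j)\<in>V \<times> V. of_bool (E i j) * \<epsilon> (i, j) * ?s i * ?t j)"
    by (rule planted_bilinear[OF assms, symmetric])
  also have "\<dots> \<le> l2_opnorm V (signed_adj E \<epsilon>)"
    using L2_set_normalized_indicator[OF finV] XY
    by (intro order.trans[OF abs_ge_self bilinear_le_opnorm[OF finV]]) simp_all
  finally show ?thesis .
qed

section \<open>Adjacent layers of subcubes of the torus\<close>

definition cube_pt :: "nat \<Rightarrow> nat set \<Rightarrow> (nat \<Rightarrow> nat) \<Rightarrow> nat \<Rightarrow> nat" where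
  "cube_pt n T u = (\<lambda>l. if l < n then of_bool (l \<in> T) else u l)"

definition layer :: "nat \<Rightarrow> nat \<Rightarrow> nat set set" where
  "layer n r = {T. T \<subseteq> {..<n} \<and> card T = r}"

lemma finite_layer [simp]: "finite (layer n r)"
  by (rule finite_subset[of _ "Pow {..<n}"]) (auto simp: layer_def)

lemma card_layer: "card (layer n r) = n choose r"
  using n_subsets[of "{..<n}" r] by (simp add: layer_def)

lemma cube_pt_inj:
  assumes "T \<subseteq> {..<n}" "T' \<subseteq> {..<n}" "cube_pt n T u = cube_pt n T' u'"
  shows "T = T'"
proof -
  have "l \<in> T \<longleftrightarrow> l \<in> T'" if "l < n" for l
    using fun_cong[OF assms(3), of l] that by (simp add: cube_pt_def of_bool_eq_iff)
  then show ?thesis using assms(1,2) by blast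
qed

text \<open>The label \<open>u\<close> can be read off from any point of its copy, so different
  copies share no vertex and use disjoint sets of signs.\<close>

lemma cube_pt_inj2:
  assumes "u \<in> {n..<d} \<rightarrow>\<^sub>E A" "u' \<in> {n..<d} \<rightarrow>\<^sub>E A" "cube_pt n T u = cube_pt n T' u'"
  shows "u = u'"
proof
  fix l show "u l = u' l"
  proof (cases "l < n")
    case True
    then have "l \<notin> {n..<d}" by simp
    then have "u l = undefined" "u' l = undefined"
      using PiE_arb[OF assms(1)] PiE_arb[OF assms(2)] by blast+
    then show ?thesis by simp
  next
    case False
    then show ?thesis using fun_cong[OF assms(3), of l] by (simp add: cube_pt_def)
  qed
qed

lemma cube_pt_in_torus:
  assumes "m \<ge> 2" "n \<le> d" "u \<in> {n..<d} \<rightarrow>\<^sub>E {..<m}"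
  shows "cube_pt n T u \<in> torus_verts m d"
  unfolding torus_verts_def
proof (rule PiE_I)
  fix l assume "l \<in> {..<d}"
  then show "cube_pt n T u l \<in> {..<m}"
    using assms(1) PiE_mem[OF assms(3), of l] by (cases "l < n") (simp_all add: cube_pt_def)
next
  fix l assume "l \<notin> {..<d}"
  then have "\<not> l < n" "l \<notin> {n..<d}" using assms(2) by auto
  then show "cube_pt n T u l = undefined" using PiE_arb[OF assms(3)] by (simp add: cube_pt_def)
qed

text \<open>The sizes differ by one, so a difference in exactly one coordinate forces inclusion;
  conversely the values 0 and 1 are adjacent modulo every \<open>m\<close>.\<close>

lemma cube_pt_adj_iff:
  assumes T: "T \<in> layer n r" "T' \<in> layer n (Suc r)" and n: "n \<le> d"
  shows "torus_adj m d (cube_pt n T u) (cube_pt n T' u) \<longleftrightarrow> T \<subseteq> T'"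
proof -
  have sub: "T \<subseteq> {..<n}" "T' \<subseteq> {..<n}" "card T = r" "card T' = Suc r" using T by (auto simp: layer_def)
  then have fin: "finite T" "finite T'" using finite_subset by auto
  let ?x = "cube_pt n T u" and ?y = "cube_pt n T' u"
  have diff: "l < d \<and> ?x l \<noteq> ?y l \<longleftrightarrow> (l \<in> T) \<noteq> (l \<in> T')" for l
  proof (cases "l < n")
    case True
    then show ?thesis using n by (simp add: cube_pt_def of_bool_eq_iff)
  next
    case False
    then have "l \<notin> T" "l \<notin> T'" using sub(1,2) by auto
    then show ?thesis using False by (simp add: cube_pt_def)
  qed
  show ?thesis
  proof
    assume "torus_adj m d ?x ?y"
    then obtain k where "{l. l < d \<and> ?x l \<noteq> ?y l} = {k}" unfolding torus_adj_def by blast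
    then have k: "(l \<in> T) \<noteq> (l \<in> T') \<longleftrightarrow> l = k" for l
      unfolding diff set_eq_iff by simp
    show "T \<subseteq> T'"
    proof (rule ccontr)
      assume "\<not> T \<subseteq> T'"
      then obtain l where "l \<in> T" "l \<notin> T'" by blast
      then have "k \<notin> T'" using k[of l] by simp
      then have "T' \<subseteq> T" using k by fast
      from card_mono[OF fin(1) this] show False using sub by simp
    qed
  next
    assume TT: "T \<subseteq> T'"
    then have "card (T' - T) = 1" using sub fin by (simp add: card_Diff_subset)
    then obtain k where k: "T' - T = {k}" using card_1_singletonE by blast
    then have kT: "k \<in> T'" "k \<notin> T" by blast+
    have "k < n" using kT(1) sub(2) by auto
    then have "?y k = ?x k + 1" using kT by (simp add: cube_pt_def)
    then have "[?y k = ?x k + 1] (mod m)" by simp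
    moreover have "(l \<in> T) \<noteq> (l \<in> T') \<longleftrightarrow> l = k" for l
      using k TT kT by blast
    then have "{l. l < d \<and> ?x l \<noteq> ?y l} = {k}" unfolding diff by simp
    ultimately show "torus_adj m d ?x ?y" unfolding torus_adj_def by blast
  qed
qed

lemma card_pairs:
  assumes "finite A" "finite B"
  shows "card {(a, b) \<in> A \<times> B. P a b} = (\<Sum>b\<in>B. card {a\<in>A. P a b})"
proof -
  have "card {(a, b) \<in> A \<times> B. P a b} = card (\<Union>b\<in>B. (\<lambda>a. (a, b)) ` {a\<in>A. P a b})"
    by (rule arg_cong[where f = card]) blast
  also have "\<dots> = (\<Sum>b\<in>B. card ((\<lambda>a. (a, b)) ` {a\<in>A. P a b}))"
    using assms by (intro card_UN_disjoint) auto
  also have "\<dots> = (\<Sum>b\<in>B. card {a\<in>A. P a b})"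
    by (intro sum.cong refl card_image inj_onI) simp
  finally show ?thesis .
qed

lemma card_layer_pairs:
  "card {(T, T') \<in> layer n r \<times> layer n (Suc r). T \<subseteq> T'} = Suc r * (n choose Suc r)"
proof -
  have "card {T \<in> layer n r. T \<subseteq> T'} = Suc r" if "T' \<in> layer n (Suc r)" for T'
  proof -
    have T': "T' \<subseteq> {..<n}" "card T' = Suc r" using that by (simp_all add: layer_def)
    have "{T \<in> layer n r. T \<subseteq> T'} = {T. T \<subseteq> T' \<and> card T = r}"
      unfolding layer_def using T'(1) by blast
    then show ?thesis using n_subsets[OF finite_subset[OF T'(1)], of r] T'(2) by simp
  qed
  then show ?thesis by (subst card_pairs) (simp_all add: card_layer)
qed

text \<open>Counting the inclusions from either layer identifies the quotient as the geometric mean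
  of the two degrees \<open>Suc r\<close> and \<open>n - r\<close>.\<close>

lemma layer_ratio:
  assumes "Suc r \<le> n"
  shows "real (Suc r * (n choose Suc r)) / sqrt (real (n choose r) * real (n choose Suc r))
           = sqrt (real (Suc r) * real (n - r))"
proof -
  define a b where "a = real (n choose r)" and "b = real (n choose Suc r)"
  have pos: "a > 0" "b > 0" using assms by (simp_all add: a_def b_def)
  have "Suc r * (n choose Suc r) = (n - r) * (n choose r)"
    using assms binomial_absorb_comp[of n r] binomial_absorption[of r n] by (simp add: mult_ac)
  then have eq: "real (Suc r) * b = real (n - r) * a"
    unfolding a_def b_def by (simp only: flip: of_nat_mult)
  have "real (Suc r) * real (n - r) * (a * b) = (real (Suc r) * b)\<^sup>2"
    using eq by (simp add: power2_eq_square mult_ac)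
  then have "sqrt (real (Suc r) * real (n - r)) * sqrt (a * b) = real (Suc r) * b"
    using pos by (simp add: real_sqrt_mult[symmetric])
  then show ?thesis using pos by (simp add: a_def b_def field_simps)
qed

text \<open>The number of planted entries is weighed against the number of copies,
  \<open>m ^ (d - n)\<close>, in the first part, and against \<open>p\<close> in the second, where
  one copy is enough.\<close>

lemma torus_lower:
  fixes m d n r :: nat
  assumes m: "m \<ge> 2" and n: "n \<le> d" and r: "Suc r \<le> n"
  shows "2 ^ (Suc r * (n choose Suc r)) \<le> m ^ (d - n) \<Longrightarrow>
           sqrt (real (Suc r) * real (n - r)) / 2 \<le> expected_signed_norm (torus_verts m d) (torus_adj m d)"
    and "p > 0 \<Longrightarrow> sqrt (real (Suc r) * real (n - r)) * 2 powr (- (real (Suc r * (n choose Suc r)) / p))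
           \<le> N_eps p (torus_verts m d) (torus_adj m d)"
proof -
  let ?V = "torus_verts m d" and ?E = "torus_adj m d" and ?e = "Suc r * (n choose Suc r)"
  define U where "U = ({n..<d} \<rightarrow>\<^sub>E {..<m})"
  define X where "X u = (\<lambda>T. cube_pt n T u) ` layer n r" for u
  define Y where "Y u = (\<lambda>T. cube_pt n T u) ` layer n (Suc r)" for u
  define D where "D u = {(i, j) \<in> X u \<times> Y u. ?E i j}" for u
  have inj: "inj_on (\<lambda>T. cube_pt n T u) (layer n q)" for u q
    by (rule inj_onI) (auto simp: layer_def dest: cube_pt_inj)
  have cX: "card (X u) = n choose r" and cY: "card (Y u) = n choose Suc r" for u
    unfolding X_def Y_def by (simp_all add: card_image[OF inj] card_layer)
  have ne: "X u \<noteq> {}" "Y u \<noteq> {}" for u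
    using cX[of u] cY[of u] r by (auto simp: binomial_eq_0_iff)
  have sub: "X u \<subseteq> ?V" "Y u \<subseteq> ?V" if "u \<in> U" for u
    using that cube_pt_in_torus[OF m n] by (auto simp: X_def Y_def U_def)
  have Dim: "D u = (\<lambda>(T, T'). (cube_pt n T u, cube_pt n T' u)) `
      {(T, T') \<in> layer n r \<times> layer n (Suc r). T \<subseteq> T'}" for u
  proof (intro set_eqI iffI)
    fix x assume "x \<in> D u"
    then obtain T T' where "x = (cube_pt n T u, cube_pt n T' u)" "T \<in> layer n r" "T' \<in> layer n (Suc r)"
      "?E (cube_pt n T u) (cube_pt n T' u)"
      unfolding D_def X_def Y_def by blast
    then show "x \<in> (\<lambda>(T, T'). (cube_pt n T u, cube_pt n T' u)) `
      {(T, T') \<in> layer n r \<times> layer n (Suc r). T \<subseteq> T'}"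
      using cube_pt_adj_iff[OF _ _ n] by (intro rev_image_eqI[of "(T, T')"]) simp_all
  next
    fix x assume "x \<in> (\<lambda>(T, T'). (cube_pt n T u, cube_pt n T' u)) `
      {(T, T') \<in> layer n r \<times> layer n (Suc r). T \<subseteq> T'}"
    then obtain T T' where "x = (cube_pt n T u, cube_pt n T' u)" "T \<in> layer n r" "T' \<in> layer n (Suc r)" "T \<subseteq> T'"
      by (elim imageE) auto
    then show "x \<in> D u" using cube_pt_adj_iff[OF _ _ n] by (simp add: D_def X_def Y_def)
  qed
  have cD: "card (D u) = ?e" for u
    unfolding Dim
  proof (subst card_image)
    show "inj_on (\<lambda>(T, T'). (cube_pt n T u, cube_pt n T' u)) {(T, T') \<in> layer n r \<times> layer n (Suc r). T \<subseteq> T'}"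
      by (rule inj_onI) (auto dest: inj_onD[OF inj])
  qed (rule card_layer_pairs)
  have DV: "D u \<subseteq> ?V \<times> ?V" if "u \<in> U" for u using sub[OF that] by (auto simp: D_def)
  have disj: "D u \<inter> D u' = {}" if "u \<in> U" "u' \<in> U" "u \<noteq> u'" for u u'
    using that cube_pt_inj2[of u n d "{..<m}" u'] by (fastforce simp: Dim U_def)
  have Q: "card (D u) / sqrt (card (X u) * card (Y u)) = sqrt (real (Suc r) * real (n - r))" for u
    using layer_ratio[OF r] by (simp add: cX cY cD del: binomial_Suc_Suc)
  show "sqrt (real (Suc r) * real (n - r)) / 2 \<le> expected_signed_norm ?V ?E"
    if "2 ^ ?e \<le> m ^ (d - n)"
  proof (rule planted_expected_norm_ge[of _ U D ?e])
    show "finite U" unfolding U_def by (intro finite_PiE) auto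
    show "2 ^ ?e \<le> card U" using that by (simp add: U_def card_PiE)
    fix u and \<epsilon> :: "(nat \<Rightarrow> nat) \<times> (nat \<Rightarrow> nat) \<Rightarrow> real"
    assume "u \<in> U" "\<And>x. x \<in> D u \<Longrightarrow> \<epsilon> x = 1"
    then show "sqrt (real (Suc r) * real (n - r)) \<le> l2_opnorm ?V (signed_adj ?E \<epsilon>)"
      using opnorm_planted_ge[OF _ sub ne D_def, of u \<epsilon>] Q[of u] by simp
  qed (use DV cD disj in auto)
  have "0 \<in> {..<m}" using m by simp
  then have "U \<noteq> {}" unfolding U_def PiE_eq_empty_iff by blast
  then obtain u where u: "u \<in> U" by blast
  show "sqrt (real (Suc r) * real (n - r)) * 2 powr (- (real ?e / p)) \<le> N_eps p ?V ?E" if "p > 0"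
    unfolding Q[of u, symmetric] cD[of u, symmetric]
    by (rule N_eps_planted_ge[OF _ sub[OF u] ne D_def that]) simp
qed

subsection \<open>Comparison of both sides\<close>

text \<open>The easy half of Stirling's formula, by induction from
  \<open>(1 + 1 / q) ^ q \<le> exp 1\<close>.\<close>

lemma self_power_le_fact: "real q ^ q \<le> exp (real q) * fact q"
proof (induction q)
  case (Suc q)
  show ?case
  proof (cases "q = 0")
    case False
    have "(1 + 1 / real q) ^ q \<le> exp (1 / real q) ^ q" by (intro power_mono exp_ge_add_one_self) auto
    also have "\<dots> = exp 1" using False by (simp add: exp_of_nat_mult[symmetric])
    finally have e: "(1 + 1 / real q) ^ q \<le> exp 1" .
    have "real (Suc q) = real q * (1 + 1 / real q)" using False by (simp add: field_simps)
    then have "real (Suc q) ^ q = real q ^ q * (1 + 1 / real q) ^ q"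
      by (simp only: power_mult_distrib)
    then have "real (Suc q) ^ Suc q = real (Suc q) * (real q ^ q * (1 + 1 / real q) ^ q)"
      by (simp only: power_Suc)
    also have "\<dots> \<le> real (Suc q) * ((exp (real q) * fact q) * exp 1)"
      by (intro mult_left_mono mult_mono Suc e) auto
    also have "\<dots> = exp (real (Suc q)) * fact (Suc q)" by (simp add: exp_add mult_ac)
    finally show ?thesis .
  qed (use exp_ge_add_one_self[of 1] in simp)
qed simp

lemma binomial_le_exp_power:
  assumes "q > 0"
  shows "real (n choose q) \<le> (exp 1 * n / q) ^ q"
proof -
  have "real (n choose q) * fact q \<le> real n ^ q"
    using of_nat_mono[OF binomial_fact_pow[of n q], where ?'a = real]
    by (simp only: of_nat_mult of_nat_fact of_nat_power)
  then have "real (n choose q) * (fact q * exp (real q)) \<le> real n ^ q * exp (real q)"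
    by (simp add: mult.assoc[symmetric])
  moreover have "real (n choose q) * real q ^ q \<le> real (n choose q) * (fact q * exp (real q))"
    using self_power_le_fact[of q] by (intro mult_left_mono) (simp_all add: mult.commute)
  ultimately have "real (n choose q) * real q ^ q \<le> real n ^ q * exp (real q)" by linarith
  then have "real (n choose q) \<le> real n ^ q * exp (real q) / real q ^ q"
    using assms by (simp add: pos_le_divide_eq)
  also have "\<dots> = (exp 1 * n / q) ^ q"
    by (simp add: power_mult_distrib power_divide exp_of_nat_mult[symmetric])
  finally show ?thesis .
qed

lemma maximal_layer_exists:
  fixes m d n :: nat
  assumes m: "m \<ge> 2" and n: "n \<ge> 1" "2 * n \<le> d"
  shows "\<exists>\<rho>\<ge>1. \<rho> \<le> n \<and> (\<rho> = 1 \<or> 2 * \<rho> \<le> n) \<and> 2 ^ (\<rho> * (n choose \<rho>)) \<le> m ^ (d - n)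
    \<and> (n < 2 * (\<rho> + 1) \<or> m ^ (d - n) < 2 ^ ((\<rho> + 1) * (n choose (\<rho> + 1))))"
proof -
  define A where "A = {\<rho>. 1 \<le> \<rho> \<and> \<rho> \<le> n \<and> (\<rho> = 1 \<or> 2 * \<rho> \<le> n) \<and> 2 ^ (\<rho> * (n choose \<rho>)) \<le> m ^ (d - n)}"
  have fin: "finite A" by (rule finite_subset[of _ "{..n}"]) (auto simp: A_def)
  have "(2::nat) ^ n \<le> 2 ^ (d - n)" using n by (intro power_increasing) auto
  also have "\<dots> \<le> m ^ (d - n)" using m by (intro power_mono) auto
  finally have "1 \<in> A" using n by (simp add: A_def)
  then have M: "Max A \<in> A" using fin by (intro Max_in) auto
  have "Max A + 1 \<notin> A" using Max_ge[OF fin, of "Max A + 1"] by auto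
  then show ?thesis using M by (intro exI[of _ "Max A"]) (auto simp: A_def not_le)
qed

lemma torus_two_sided:
  fixes m d :: nat
  assumes d: "d \<ge> 2" and m: "m \<ge> 2"
  defines "p \<equiv> real d * ln (real m)"
  shows "\<exists>Q. sqrt (real d) \<le> Q \<and> Q \<le> 2 * sqrt (real d * ln p)
    \<and> Q / 6 \<le> expected_signed_norm (torus_verts m d) (torus_adj m d)
    \<and> expected_signed_norm (torus_verts m d) (torus_adj m d) \<le> 3576 * Q
    \<and> Q / 12 \<le> N_eps p (torus_verts 2 d) (torus_adj 2 d)
    \<and> N_eps p (torus_verts 2 d) (torus_adj 2 d) \<le> 3576 * Q"
proof -
  define n where "n = d div 2"
  have n: "n \<ge> 1" "2 * n \<le> d" "d \<le> 3 * n" using d by (auto simp: n_def)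
  obtain \<rho> where \<rho>: "\<rho> \<ge> 1" "\<rho> \<le> n" "\<rho> = 1 \<or> 2 * \<rho> \<le> n" "2 ^ (\<rho> * (n choose \<rho>)) \<le> m ^ (d - n)"
    and \<rho>_max: "n < 2 * (\<rho> + 1) \<or> m ^ (d - n) < 2 ^ ((\<rho> + 1) * (n choose (\<rho> + 1)))"
    using maximal_layer_exists[OF m n(1,2)] by blast
  define Q where "Q = sqrt (real \<rho> * real d)"
  define e where "e = \<rho> * (n choose \<rho>)"
  have lnm: "ln (real m) \<ge> ln 2" using m by simp
  have ln2: "2 / 3 \<le> ln (2::real)" "ln (2::real) \<le> 25 / 36"
    using ln2_ge_two_thirds ln2_le_25_over_36 by auto
  have "2 * (2 / 3) \<le> p" unfolding p_def using d lnm ln2 by (intro mult_mono) auto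
  then have p: "4 / 3 \<le> p" by simp
  have half: "p / 2 \<le> real (d - n) * ln m" "real (d - n) * ln m \<le> p"
  proof -
    have le: "real d / 2 \<le> real (d - n)" "real (d - n) \<le> real d" using n by (auto simp: of_nat_diff)
    have nn: "0 \<le> ln (real m)" using lnm ln2 by linarith
    from mult_right_mono[OF le(1) nn] mult_right_mono[OF le(2) nn]
    show "p / 2 \<le> real (d - n) * ln m" "real (d - n) * ln m \<le> p"
      unfolding p_def by simp_all
  qed
  have ln_pow: "ln (real (2 ^ a)) = a * ln 2" "ln (real (m ^ a)) = a * ln m" for a
    using m by (simp_all add: ln_realpow)
  have e_le: "e * ln 2 \<le> p"
  proof -
    have "real (2 ^ e) \<le> real (m ^ (d - n))" using \<rho>(4) unfolding e_def by (rule of_nat_mono)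
    then have "ln (real (2 ^ e)) \<le> ln (real (m ^ (d - n)))" using m by (subst ln_le_cancel_iff) auto
    then show ?thesis unfolding ln_pow using half(2) by simp
  qed
  define k where "k = nat \<lceil>p\<rceil>"
  have k: "p \<le> k" "real k \<le> p + 1" "k \<ge> 1" using p unfolding k_def by linarith+
  have sparse: "d \<le> 9 * \<rho> \<or> ln (2 * real k) \<le> 6 * \<rho> * (1 + ln (d / \<rho>))"
  proof (cases "n < 2 * (\<rho> + 1)")
    case True
    then have "n < 2 * \<rho> + 2" by simp
    \<comment> \<open>\<open>d \<le> 3 * n \<le> 6 * \<rho> + 3\<close>, and
      \<open>\<rho> \<ge> 1\<close>.\<close>
    then have "d \<le> 9 * \<rho>" using n(3) \<rho>(1) by linarith
    then show ?thesis ..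
  next
    case False
    \<comment> \<open>Layer \<open>q\<close> spans too many edges by maximality, so \<open>p\<close>
      is at most of order \<open>q * (n choose q)\<close>; taking logarithms then bounds
      \<open>ln (2 * k)\<close>.\<close>
    define q where "q = \<rho> + 1"
    have q: "q > 0" "2 * q \<le> n" "real q \<le> 2 * \<rho>" using False \<rho>(1) by (auto simp: q_def)
    have "real (m ^ (d - n)) < real (2 ^ (q * (n choose q)))"
      using \<rho>_max False unfolding q_def by (simp only: of_nat_less_iff) simp
    then have "ln (real (m ^ (d - n))) < ln (real (2 ^ (q * (n choose q))))" using m by (subst ln_less_cancel_iff) auto
    then have "p / 2 \<le> real (q * (n choose q)) * ln 2" unfolding ln_pow using half(1) by simp
    also have "\<dots> \<le> real (q * (n choose q)) * 1" using ln2 by (intro mult_left_mono) auto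
    finally have "p \<le> 2 * (real q * real (n choose q))" by simp
    also have "\<dots> \<le> 2 * (real q * (exp 1 * n / q) ^ q)"
      by (intro mult_left_mono binomial_le_exp_power q) auto
    finally have pq: "p \<le> 2 * (real q * (exp 1 * n / q) ^ q)" .
    have nq: "real n / q > 0" using q by simp
    \<comment> \<open>\<open>2 * k \<le> 2 * p + 2 \<le> 4 * p\<close>, as
      \<open>p \<ge> 1\<close>.\<close>
    have "2 * real k \<le> 8 * (real q * (exp 1 * n / q) ^ q)" using k(2) p pq by linarith
    then have "ln (2 * real k) \<le> ln (8 * (real q * (exp 1 * n / q) ^ q))"
      using k(3) q by (subst ln_le_cancel_iff) auto
    also have "\<dots> = ln 8 + (ln q + real q * (1 + ln (n / q)))"
    proof -
      have "exp 1 * n / q = exp 1 * (real n / q)" by simp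
      then show ?thesis using q nq by (simp only: ln_mult ln_realpow) (simp add: ln_mult ln_realpow)
    qed
    also have "\<dots> \<le> 3 * real \<rho> + (real \<rho> + 2 * real \<rho> * (1 + ln (d / \<rho>)))"
    proof (intro add_mono)
      have "ln (8::real) = 3 * ln 2" using ln_realpow[of 2 3] by simp
      then show "ln 8 \<le> 3 * real \<rho>" using ln2 \<rho>(1) by simp
      show "ln q \<le> real \<rho>" using ln_le_minus_one[of "real q"] by (simp add: q_def)
      have "real n / q \<le> d / \<rho>" using \<rho>(1) n by (intro frac_le) (auto simp: q_def)
      then have "ln (n / q) \<le> ln (d / \<rho>)" using nq by (intro ln_mono) auto
      moreover have "1 \<le> real n / q" using q by simp
      then have "0 \<le> ln (n / q)" by (rule ln_ge_zero)
      ultimately show "real q * (1 + ln (n / q)) \<le> 2 * real \<rho> * (1 + ln (d / \<rho>))"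
        using q(3) by (intro mult_mono) auto
    qed
    also have "\<dots> \<le> 6 * \<rho> * (1 + ln (d / \<rho>))"
    proof -
      have "ln (d / \<rho>) \<ge> 0" using \<rho> n by (intro ln_ge_zero) simp
      then have "4 * real \<rho> * 1 \<le> 4 * real \<rho> * (1 + ln (d / \<rho>))" by (intro mult_left_mono) auto
      then show ?thesis by (simp add: algebra_simps)
    qed
    finally show ?thesis by blast
  qed
  have V: "real (m ^ d) \<le> exp (2 * real k)" "real (2 ^ d) \<le> exp (2 * real k)"
  proof -
    have "real (m ^ d) = exp p" using m by (simp add: p_def exp_of_nat_mult)
    also have "\<dots> \<le> exp (2 * real k)" using k by simp
    finally show "real (m ^ d) \<le> exp (2 * real k)" .
    moreover have "real (2 ^ d) \<le> real (m ^ d)" using m by (intro of_nat_mono power_mono) auto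
    ultimately show "real (2 ^ d) \<le> exp (2 * real k)" by linarith
  qed
  have \<rho>d: "\<rho> \<le> d" using \<rho> n by simp
  have "4 * exp 1 * (298 * Q) \<le> 4 * 3 * (298 * Q)"
    using exp_le by (intro mult_right_mono mult_left_mono) (auto simp: Q_def)
  then have const: "4 * exp 1 * (298 * Q) \<le> 3576 * Q" by simp
  have upE: "expected_signed_norm (torus_verts m d) (torus_adj m d) \<le> 3576 * Q"
    using torus_upper(1)[OF \<rho>(1) \<rho>d k(3) sparse V(1)] const unfolding Q_def by linarith
  have upN: "N_eps p (torus_verts 2 d) (torus_adj 2 d) \<le> 3576 * Q"
    using torus_upper(2)[OF \<rho>(1) \<rho>d k(3) sparse V(2), of p] const p k(1) unfolding Q_def by linarith
  obtain r where r: "\<rho> = Suc r" using \<rho>(1) by (cases \<rho>) auto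
  \<comment> \<open>Since \<open>n \<ge> d / 3\<close> and either \<open>\<rho> = 1\<close> or
    \<open>2 * \<rho> \<le> n\<close>, the degree \<open>n - r\<close> is at least
    \<open>d / 9\<close>.\<close>
  have "Q / 3 \<le> sqrt (real (Suc r) * real (n - r))"
  proof -
    have "real d / 9 \<le> real (n - r)" using n \<rho>(2,3) r by (auto simp: of_nat_diff)
    then have "real \<rho> * (real d / 9) \<le> real (Suc r) * real (n - r)" unfolding r by (intro mult_left_mono) auto
    then have "sqrt (real \<rho> * real d / 9) \<le> sqrt (real (Suc r) * real (n - r))" by simp
    then show ?thesis by (simp add: Q_def real_sqrt_divide)
  qed
  note Q3 = this
  have loE: "Q / 6 \<le> expected_signed_norm (torus_verts m d) (torus_adj m d)"
  proof -
    have "sqrt (real (Suc r) * real (n - r)) / 2 \<le> expected_signed_norm (torus_verts m d) (torus_adj m d)"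
      by (rule torus_lower(1)) (use m n \<rho> r in auto)
    then show ?thesis using Q3 by linarith
  qed
  have loN: "Q / 12 \<le> N_eps p (torus_verts 2 d) (torus_adj 2 d)"
  proof -
    have "e * (2 / 3) \<le> e * ln 2" using ln2 by (intro mult_left_mono) auto
    \<comment> \<open>At most \<open>2 * p\<close> entries are planted, so the moment loses no more
      than \<open>2 powr (- 2)\<close>.\<close>
    then have "e / p \<le> 2" using e_le p by (simp add: divide_le_eq)
    then have "2 powr (- 2) \<le> 2 powr (- (real e / p))" by (intro powr_mono) auto
    then have "1 / 4 \<le> 2 powr (- (real e / p))" by (simp add: powr_minus_divide)
    then have "Q / 3 * (1 / 4) \<le> sqrt (real (Suc r) * real (n - r)) * 2 powr (- (real e / p))"
      using Q3 by (intro mult_mono) (auto simp: Q_def)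
    also have "\<dots> \<le> N_eps p (torus_verts 2 d) (torus_adj 2 d)"
      unfolding e_def r by (rule torus_lower(2)) (use n \<rho> r p in auto)
    finally show ?thesis by simp
  qed
  have Qd: "sqrt (real d) \<le> Q"
    unfolding Q_def using \<rho>(1) mult_right_mono[of 1 "real \<rho>" "real d"] by simp
  \<comment> \<open>For \<open>\<rho> \<ge> 2\<close> the layers span more than
    \<open>2 ^ \<rho>\<close> edges, so \<open>\<rho>\<close> is at most logarithmic in
    \<open>p\<close>. The factor 4 is dictated by \<open>\<rho> = 1\<close>, where
    \<open>p \<ge> 4 / 3\<close> gives \<open>ln p \<ge> 1 / 4\<close>.\<close>
  have "real \<rho> \<le> 4 * ln p"
  proof (cases "\<rho> = 1")
    case True
    have "1 - 3 / 4 \<le> ln (4 / 3 :: real)" using ln_le_minus_one[of "3 / 4 :: real"] by (simp add: ln_div)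
    moreover have "ln (4 / 3) \<le> ln p" using p by (intro ln_mono) auto
    ultimately show ?thesis using True by simp
  next
    case False
    then have \<rho>2: "2 \<le> \<rho>" "2 * \<rho> \<le> n" using \<rho> by auto
    have "(2::real) ^ \<rho> \<le> (real n / real \<rho>) ^ \<rho>" using \<rho>2 by (intro power_mono) (auto simp: pos_le_divide_eq simp flip: of_nat_mult)
    also have "\<dots> \<le> real (n choose \<rho>)" using \<rho>(2) by (rule binomial_ge_n_over_k_pow_k)
    finally have "2 * 2 ^ \<rho> \<le> real e"
      unfolding e_def of_nat_mult using \<rho>2 by (intro mult_mono) auto
    then have "2 * 2 ^ \<rho> * (2 / 3) \<le> e * ln 2" using ln2 by (intro mult_mono) auto
    moreover have "(0::real) \<le> 2 ^ \<rho>" by simp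
    ultimately have "2 ^ \<rho> \<le> p" using e_le by linarith
    then have "ln (2 ^ \<rho>) \<le> ln p" by (intro ln_mono) auto
    then have "\<rho> * ln 2 \<le> ln p" by (simp add: ln_realpow)
    moreover have "real \<rho> * (2 / 3) \<le> \<rho> * ln 2" using ln2 by (intro mult_left_mono) auto
    ultimately show ?thesis by linarith
  qed
  then have "Q \<le> sqrt (4 * (real d * ln p))"
    unfolding Q_def using mult_right_mono[of "real \<rho>" "4 * ln p" "real d"] by (simp add: mult_ac)
  then have "Q \<le> 2 * sqrt (real d * ln p)" by (simp add: real_sqrt_mult)
  with Qd upE upN loE loN show ?thesis by (intro exI[of _ Q] conjI)
qed

text \<open>For \<open>m \<le> exp d\<close> the product \<open>d * ln m\<close> is at most
  \<open>d * d\<close>, so \<open>x \<le> 2 * ln d\<close> and the denominator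
  \<open>1 + ln d - ln x\<close> is itself at least of order \<open>x\<close>. In this range the
  explicit lower bound thus asks for no more than a multiple of \<open>sqrt d\<close>.\<close>

lemma log_ratio_le:
  fixes m d :: nat
  assumes d: "d \<ge> 2" and m: "m \<ge> 2" and md: "real m \<le> exp (real d)"
  defines "x \<equiv> ln (real d * ln (real m))"
  shows "x / ln (exp 1 * real d / x) \<le> 4"
proof -
  have ln2: "2 / 3 \<le> ln (2::real)" "ln (2::real) \<le> 25 / 36"
    using ln2_ge_two_thirds ln2_le_25_over_36 by auto
  have lnm: "ln (real m) \<ge> ln 2" using m by simp
  have "2 * (2 / 3) \<le> real d * ln m" using d lnm ln2 by (intro mult_mono) auto
  then have "ln 1 < x" unfolding x_def by (subst ln_less_cancel_iff) auto
  then have x: "x > 0" by simp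
  have "ln (real m) \<le> ln (exp (real d))" using m md by (intro ln_mono) auto
  then have "real d * ln m \<le> real d * real d" by (intro mult_left_mono) auto
  then have "x \<le> ln (real d * real d)"
    unfolding x_def using lnm ln2 d by (intro ln_mono) auto
  then have xd: "x \<le> 2 * ln d" using d by (simp add: ln_mult)
  \<comment> \<open>The tangent of \<open>ln\<close> at 4: subtracting \<open>ln x\<close> costs
    only half of \<open>x / 2 \<le> ln d\<close>.\<close>
  have "ln (x / 4) \<le> x / 4 - 1" using x by (intro ln_le_minus_one) auto
  moreover have "ln (4::real) = 2 * ln 2" using ln_realpow[of 2 2] by simp
  ultimately have "ln x \<le> x / 4 - 1 + 2 * ln 2" using x by (simp add: ln_div)
  moreover have "ln (exp 1 * real d / x) = 1 + ln d - ln x" using x d by (simp add: ln_div ln_mult)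
  ultimately have "x / 4 + 1 / 2 \<le> ln (exp 1 * real d / x)" using xd ln2 by linarith
  then show ?thesis using x by (simp add: divide_le_eq)
qed

theorem corollary3p5:
  shows "(\<exists>C>0::real. \<forall>(d::nat)\<ge>2. \<forall>(m::nat)\<ge>2.
            expected_signed_norm (torus_verts m d) (torus_adj m d)
              \<le> C * (sqrt (real d)
                     + N_eps (real d * ln (real m)) (torus_verts 2 d) (torus_adj 2 d)) \<and>
            sqrt (real d) + N_eps (real d * ln (real m)) (torus_verts 2 d) (torus_adj 2 d)
              \<le> C * expected_signed_norm (torus_verts m d) (torus_adj m d))
       \<and> (\<exists>C>0::real. \<forall>(d::nat)\<ge>2. \<forall>(m::nat)\<ge>2. real m \<le> exp (real d) \<longrightarrow>
            sqrt (real d * ln (real d * ln (real m))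
                  / ln (exp 1 * real d / ln (real d * ln (real m))))
              \<le> C * expected_signed_norm (torus_verts m d) (torus_adj m d) \<and>
            expected_signed_norm (torus_verts m d) (torus_adj m d)
              \<le> C * sqrt (real d * ln (real d * ln (real m))))"
proof (intro conjI exI[of _ "50000::real"] allI impI)
  fix d m :: nat assume dm: "2 \<le> d" "2 \<le> m"
  let ?E = "expected_signed_norm (torus_verts m d) (torus_adj m d)"
  let ?N = "N_eps (real d * ln (real m)) (torus_verts 2 d) (torus_adj 2 d)"
  obtain Q where Q: "sqrt (real d) \<le> Q" "Q \<le> 2 * sqrt (real d * ln (real d * ln (real m)))"
    "Q / 6 \<le> ?E" "?E \<le> 3576 * Q" "Q / 12 \<le> ?N" "?N \<le> 3576 * Q"
    using torus_two_sided[OF dm] by blast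
  have d0: "0 \<le> sqrt (real d)" by simp
  \<comment> \<open>This inequality needs the largest constant: \<open>?E \<le> 3576 * Q\<close> and
    \<open>Q \<le> 12 * ?N\<close> give 42912.\<close>
  show "?E \<le> 50000 * (sqrt (real d) + ?N)" using Q d0 unfolding distrib_left by linarith
  show "sqrt (real d) + ?N \<le> 50000 * ?E" using Q d0 by linarith
  assume md: "real m \<le> exp (real d)"
  show "?E \<le> 50000 * sqrt (real d * ln (real d * ln (real m)))" using Q d0 by linarith
  have "real d * (ln (real d * ln (real m)) / ln (exp 1 * real d / ln (real d * ln (real m)))) \<le> real d * 4"
    by (intro mult_left_mono log_ratio_le dm md) auto
  then have "sqrt (real d * ln (real d * ln (real m)) / ln (exp 1 * real d / ln (real d * ln (real m))))
      \<le> sqrt (4 * real d)" by simp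
  also have "\<dots> = 2 * sqrt (real d)" by (simp add: real_sqrt_mult)
  also have "\<dots> \<le> 50000 * ?E" using Q d0 by linarith
  finally show "sqrt (real d * ln (real d * ln (real m)) / ln (exp 1 * real d / ln (real d * ln (real m))))
      \<le> 50000 * ?E" .
qed simp_all

end
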